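(* Let $n\ge 0$. Any Goursat structure on a manifold $M$ of dimension $n+3$ is locally equivalent, at any point $q$ in $M$, to the $n$-trailer system considered around a suitably chosen point $p$ of its configuration space $\mathbb{R}^2\times(S^1)^{n+1}$.
   Context: All objects are smooth. A rank $k$ distribution $\mathcal{D}$ on $M$ assigns smoothly to each point a $k$-dimensional subspace of the tangent space. Its derived flag is $\mathcal{D}^{(0)}=\mathcal{D}$, $\mathcal{D}^{(i+1)}=\mathcal{D}^{(i)}+[\mathcal{D}^{(i)},\mathcal{D}^{(i)}]$. A Goursat structure on a manifold of dimension $m\geq 3$ is a rank two distribution with $\dim\mathcal{D}^{(i)}(q)=i+2$ for $0\le i\le m-2$ and every point $q$. Two distributions $\mathcal{D}$ on $M$ and $\tilde{\mathcal{D}}$ on $\tilde M$ are locally equivalent at $q\in M$ and $\tilde q\in\tilde M$ if there are neighborhoods $U$ of $q$ and $\tilde U$ of $\tilde q$ and a diffeomorphism $\varphi:U\to\tilde U$ with $\varphi(q)=\tilde q$ and $\varphi_*\mathcal{D}=\tilde{\mathcal{D}}$ on $\tilde U$. The $n$-trailer system ($n\ge 0$) is the distribution on $\mathbb{R}^2\times(S^1)^{n+1}$, with coordinates $(\xi_1,\xi_2,\theta_0,\dots,\theta_n)$, spanned by the two vector fields $$\frac{\partial}{\partial\theta_n},\qquad \pi_0\cos(\theta_0)\frac{\partial}{\partial\xi_1}+\pi_0\sin(\theta_0)\frac{\partial}{\partial\xi_2}+\sum_{i=0}^{n-1}\pi_{i+1}\sin(\theta_{i+1}-\theta_i)\frac{\partial}{\partial\theta_i},$$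 where $\pi_i=\prod_{j=i+1}^n\cos(\theta_j-\theta_{j-1})$ and $\pi_n=1$. *)

theory Defs
  imports "HOL-Analysis.Analysis"
begin

section \<open>Smooth maps and Lie brackets on open subsets of Euclidean spaces\<close>

primrec higher_differentiable_on ::
  "'a::real_normed_vector set \<Rightarrow> ('a \<Rightarrow> 'b::real_normed_vector) \<Rightarrow> nat \<Rightarrow> bool" where
  "higher_differentiable_on S f 0 \<longleftrightarrow> continuous_on S f"
| "higher_differentiable_on S f (Suc k) \<longleftrightarrow>
     (\<forall>x\<in>S. f differentiable (at x)) \<and>
     (\<forall>v. higher_differentiable_on S (\<lambda>x. frechet_derivative f (at x) v) k)"

text \<open>Only meant for open \<open>S\<close>, where it says that \<open>f\<close> is of class \<open>C\<close>-infinity on \<open>S\<close>.\<close>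

definition smooth_on :: "'a::real_normed_vector set \<Rightarrow> ('a \<Rightarrow> 'b::real_normed_vector) \<Rightarrow> bool" where
  "smooth_on S f \<longleftrightarrow> (\<forall>k. higher_differentiable_on S f k)"

definition lie_bracket ::
  "('a::real_normed_vector \<Rightarrow> 'a) \<Rightarrow> ('a \<Rightarrow> 'a) \<Rightarrow> 'a \<Rightarrow> 'a" where
  "lie_bracket X Y x = frechet_derivative Y (at x) (X x) - frechet_derivative X (at x) (Y x)"

section \<open>Smooth manifolds\<close>

type_synonym ('a, 'e) chart = "'a set \<times> ('a \<Rightarrow> 'e)"

record ('a, 'e) manifold =
  mtop :: "'a topology"
  atlas :: "('a, 'e) chart set"

definition chart_inv :: "('a, 'e) chart \<Rightarrow> 'e \<Rightarrow> 'a" where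
  "chart_inv c = inv_into (fst c) (snd c)"

definition is_chart :: "'a topology \<Rightarrow> ('a, 'e::euclidean_space) chart \<Rightarrow> bool" where
  "is_chart T c \<longleftrightarrow>
     openin T (fst c) \<and> open (snd c ` fst c) \<and>
     homeomorphic_map (subtopology T (fst c)) (top_of_set (snd c ` fst c)) (snd c)"

text \<open>The atlas need not be maximal. The dimension of the manifold is \<open>DIM('e)\<close>.\<close>

definition smooth_manifold :: "('a, 'e::euclidean_space) manifold \<Rightarrow> bool" where
  "smooth_manifold M \<longleftrightarrow>
     Hausdorff_space (mtop M) \<and> second_countable (mtop M) \<and>
     (\<forall>c\<in>atlas M. is_chart (mtop M) c) \<and>
     (\<Union>c\<in>atlas M. fst c) = topspace (mtop M) \<and>
     (\<forall>c\<in>atlas M. \<forall>d\<in>atlas M. smooth_on (snd c ` (fst c \<inter> fst d)) (snd d \<circ> chart_inv c))"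

text \<open>
  The tangent space at \<open>p\<close> is the model space \<open>'e\<close>: a vector stands for the tangent vector that
  has it as its coordinate vector in the preferred chart \<open>chart_at M p\<close>. Vector fields and
  distributions are thus functions \<open>'a \<Rightarrow> 'e\<close> and \<open>'a \<Rightarrow> 'e set\<close>. As the preferred chart jumps
  from point to point, smoothness and brackets are always taken in a single chart, via
  \<open>field_in_chart\<close>. Values at points outside the manifold are irrelevant.
\<close>

definition chart_at :: "('a, 'e) manifold \<Rightarrow> 'a \<Rightarrow> ('a, 'e) chart" where
  "chart_at M p = (SOME c. c \<in> atlas M \<and> p \<in> fst c)"

definition tangent_map ::
  "('a, 'e::euclidean_space) manifold \<Rightarrow> ('b, 'f::euclidean_space) manifold \<Rightarrow>
   ('a \<Rightarrow> 'b) \<Rightarrow> 'a \<Rightarrow> 'e \<Rightarrow> 'f" where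
  "tangent_map M N f p =
     frechet_derivative (snd (chart_at N (f p)) \<circ> f \<circ> chart_inv (chart_at M p))
       (at (snd (chart_at M p) p))"

definition vector_in_chart ::
  "('a, 'e::euclidean_space) manifold \<Rightarrow> ('a, 'e) chart \<Rightarrow> 'a \<Rightarrow> 'e \<Rightarrow> 'e" where
  "vector_in_chart M c p =
     frechet_derivative (snd c \<circ> chart_inv (chart_at M p)) (at (snd (chart_at M p) p))"

definition field_in_chart ::
  "('a, 'e::euclidean_space) manifold \<Rightarrow> ('a, 'e) chart \<Rightarrow> ('a \<Rightarrow> 'e) \<Rightarrow> 'e \<Rightarrow> 'e" where
  "field_in_chart M c X x = vector_in_chart M c (chart_inv c x) (X (chart_inv c x))"

definition smooth_vector_field ::
  "('a, 'e::euclidean_space) manifold \<Rightarrow> 'a set \<Rightarrow> ('a \<Rightarrow> 'e) \<Rightarrow> bool" where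
  "smooth_vector_field M W X \<longleftrightarrow>
     openin (mtop M) W \<and>
     (\<forall>c\<in>atlas M. smooth_on (snd c ` (fst c \<inter> W)) (field_in_chart M c X))"

definition field_bracket ::
  "('a, 'e::euclidean_space) manifold \<Rightarrow> ('a \<Rightarrow> 'e) \<Rightarrow> ('a \<Rightarrow> 'e) \<Rightarrow> 'a \<Rightarrow> 'e" where
  "field_bracket M X Y p =
     lie_bracket (field_in_chart M (chart_at M p) X) (field_in_chart M (chart_at M p) Y)
       (snd (chart_at M p) p)"

definition smooth_map ::
  "('a, 'e::euclidean_space) manifold \<Rightarrow> 'a set \<Rightarrow> ('b, 'f::euclidean_space) manifold \<Rightarrow>
   ('a \<Rightarrow> 'b) \<Rightarrow> bool" where
  "smooth_map M U N f \<longleftrightarrow>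
     continuous_map (subtopology (mtop M) U) (mtop N) f \<and>
     (\<forall>c\<in>atlas M. \<forall>d\<in>atlas N.
        smooth_on (snd c ` (fst c \<inter> U \<inter> f -` fst d)) (snd d \<circ> f \<circ> chart_inv c))"

definition diffeomorphism ::
  "('a, 'e::euclidean_space) manifold \<Rightarrow> 'a set \<Rightarrow> ('b, 'f::euclidean_space) manifold \<Rightarrow>
   'b set \<Rightarrow> ('a \<Rightarrow> 'b) \<Rightarrow> bool" where
  "diffeomorphism M U N V f \<longleftrightarrow>
     openin (mtop M) U \<and> openin (mtop N) V \<and> bij_betw f U V \<and>
     smooth_map M U N f \<and> smooth_map N V M (inv_into U f)"

section \<open>Distributions and Goursat structures\<close>

definition distribution ::
  "('a, 'e::euclidean_space) manifold \<Rightarrow> nat \<Rightarrow> ('a \<Rightarrow> 'e set) \<Rightarrow> bool" where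
  "distribution M k D \<longleftrightarrow>
     (\<forall>p\<in>topspace (mtop M).
        subspace (D p) \<and> dim (D p) = k \<and>
        (\<exists>W X. p \<in> W \<and> (\<forall>i<k. smooth_vector_field M W (X i)) \<and>
               (\<forall>q\<in>W. D q = span ((\<lambda>i. X i q) ` {..<k}))))"

definition local_section ::
  "('a, 'e::euclidean_space) manifold \<Rightarrow> ('a \<Rightarrow> 'e set) \<Rightarrow> 'a set \<Rightarrow> ('a \<Rightarrow> 'e) \<Rightarrow> bool" where
  "local_section M D W X \<longleftrightarrow> smooth_vector_field M W X \<and> (\<forall>q\<in>W. X q \<in> D q)"

text \<open>\<open>D + [D, D]\<close>, with \<open>[D, D]\<close> spanned by the brackets of local sections of \<open>D\<close>.\<close>

definition derived ::
  "('a, 'e::euclidean_space) manifold \<Rightarrow> ('a \<Rightarrow> 'e set) \<Rightarrow> 'a \<Rightarrow> 'e set" where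
  "derived M D p =
     span (D p \<union> {field_bracket M X Y p | X Y W.
                    p \<in> W \<and> local_section M D W X \<and> local_section M D W Y})"

definition derived_flag ::
  "('a, 'e::euclidean_space) manifold \<Rightarrow> ('a \<Rightarrow> 'e set) \<Rightarrow> nat \<Rightarrow> 'a \<Rightarrow> 'e set" where
  "derived_flag M D i = (derived M ^^ i) D"

definition goursat_structure ::
  "('a, 'e::euclidean_space) manifold \<Rightarrow> ('a \<Rightarrow> 'e set) \<Rightarrow> bool" where
  "goursat_structure M D \<longleftrightarrow>
     smooth_manifold M \<and> DIM('e) \<ge> 3 \<and> distribution M 2 D \<and>
     (\<forall>i \<le> DIM('e) - 2. \<forall>q\<in>topspace (mtop M). dim (derived_flag M D i q) = i + 2)"

definition locally_equivalent ::
  "('a, 'e::euclidean_space) manifold \<Rightarrow> ('a \<Rightarrow> 'e set) \<Rightarrow> 'a \<Rightarrow>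
   ('b, 'f::euclidean_space) manifold \<Rightarrow> ('b \<Rightarrow> 'f set) \<Rightarrow> 'b \<Rightarrow> bool" where
  "locally_equivalent M D q N E p \<longleftrightarrow>
     (\<exists>U V f. q \<in> U \<and> p \<in> V \<and> diffeomorphism M U N V f \<and> f q = p \<and>
        (\<forall>x\<in>U. tangent_map M N f x ` D x = E (f x)))"

section \<open>The trailer system\<close>

text \<open>
  The circle factors are unit circles in \<open>complex\<close>, so a point of the configuration space is
  \<open>((\<xi>\<^sub>1, \<xi>\<^sub>2), z)\<close> with \<open>z i\<close> the point of the circle at angle \<open>\<theta>\<^sub>i\<close>, for \<open>i \<le> n\<close>.
  The model space is any \<open>'e\<close> with \<open>DIM('e) = n + 3\<close>; its basis vectors, enumerated as
  \<open>axis_vec 0, axis_vec 1, axis_vec (i + 2)\<close>, belong to \<open>\<xi>\<^sub>1, \<xi>\<^sub>2, \<theta>\<^sub>i\<close>.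
\<close>

type_synonym configuration = "(real \<times> real) \<times> (nat \<Rightarrow> complex)"

definition axis_vec :: "nat \<Rightarrow> 'e::euclidean_space" where
  "axis_vec = (SOME b. bij_betw b {..<DIM('e)} Basis)"

definition trailer_top :: "nat \<Rightarrow> configuration topology" where
  "trailer_top n =
     prod_topology euclidean (product_topology (\<lambda>_. top_of_set (sphere 0 1)) {..n})"

definition trailer_coords :: "nat \<Rightarrow> (real \<times> real) \<Rightarrow> (nat \<Rightarrow> real) \<Rightarrow> 'e::euclidean_space" where
  "trailer_coords n \<xi> \<theta> =
     fst \<xi> *\<^sub>R axis_vec 0 + snd \<xi> *\<^sub>R axis_vec 1 + (\<Sum>i\<le>n. \<theta> i *\<^sub>R axis_vec (i + 2))"

text \<open>The chart in which the angle \<open>\<theta>\<^sub>i\<close> ranges over the interval of length \<open>2 * pi\<close> centred at \<open>a i\<close>.\<close>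

definition trailer_chart :: "nat \<Rightarrow> (nat \<Rightarrow> real) \<Rightarrow> (configuration, 'e::euclidean_space) chart" where
  "trailer_chart n a =
     ({p \<in> topspace (trailer_top n). \<forall>i\<le>n. snd p i \<noteq> - cis (a i)},
      \<lambda>(\<xi>, z). trailer_coords n \<xi> (\<lambda>i. a i + Arg (cis (- a i) * z i)))"

definition trailer_manifold :: "nat \<Rightarrow> (configuration, 'e::euclidean_space) manifold" where
  "trailer_manifold n = \<lparr>mtop = trailer_top n, atlas = range (trailer_chart n)\<rparr>"

definition trailer_pi :: "nat \<Rightarrow> (nat \<Rightarrow> real) \<Rightarrow> nat \<Rightarrow> real" where
  "trailer_pi n \<theta> i = (\<Prod>j=i+1..n. cos (\<theta> j - \<theta> (j - 1)))"

text \<open>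
  Transition maps between the charts above are locally translations by multiples of \<open>2 * pi\<close> in
  the angles. Hence the coordinate fields have the same constant components in every chart, in
  particular in the preferred chart at each point, and the coefficients, being \<open>2 * pi\<close>-periodic
  in each angle, may be evaluated at the principal values \<open>Arg (z i)\<close>.
\<close>

definition trailer_field :: "nat \<Rightarrow> configuration \<Rightarrow> 'e::euclidean_space" where
  "trailer_field n = (\<lambda>(\<xi>, z).
     let \<theta> = (\<lambda>i. Arg (z i)) in
       (trailer_pi n \<theta> 0 * cos (\<theta> 0)) *\<^sub>R axis_vec 0 +
       (trailer_pi n \<theta> 0 * sin (\<theta> 0)) *\<^sub>R axis_vec 1 +
       (\<Sum>i<n. (trailer_pi n \<theta> (i + 1) * sin (\<theta> (i + 1) - \<theta> i)) *\<^sub>R axis_vec (i + 2)))"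

definition trailer_distribution :: "nat \<Rightarrow> configuration \<Rightarrow> 'e::euclidean_space set" where
  "trailer_distribution n p = span {axis_vec (n + 2), trailer_field n p}"

end

theory Submission
  imports Defs
begin

text \<open>
  Write \<open>F i\<close> for the \<open>i\<close>-th derived distribution of a Goursat structure in dimension \<open>n + 3\<close>; it has
  rank \<open>i + 2\<close>, so \<open>F (n + 1)\<close> is the whole tangent bundle. The \<open>n\<close>-trailer system satisfies the
  recursion \<open>g k = cos (\<theta> k - \<theta> (k - 1)) g (k - 1) + sin (\<theta> k - \<theta> (k - 1)) \<partial>\<theta> (k - 1)\<close> for its driving field, which
  says that each trailer adds, as a new coordinate, the direction of a line in the plane
  spanned by \<open>g (k - 1)\<close> and \<open>\<partial>\<theta> (k - 1)\<close>. The flag of a Goursat structure produces such lines, and the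
  coordinates are read off from it, from the largest distribution down to the smallest
  (\<open>adapted_0\<close>, \<open>adapted_Suc\<close>, \<open>trailer_coordinates\<close>).

  Suppose that functions \<open>h = (\<xi>1, \<xi>2, \<theta> 0, \<dots>, \<theta> (k - 1))\<close> with independent differentials are found such
  that \<open>F (n + 1 - k)\<close> is the preimage under \<open>dh\<close> of the plane spanned by \<open>A = g (k - 1)\<close> and
  \<open>B = \<partial>\<theta> (k - 1)\<close> (for \<open>k = 0\<close>, by the two axes of the base plane), and \<open>ker dh \<subseteq> F (n - k)\<close>.
  Since \<open>F (n - k)\<close> has corank one in \<open>F (n + 1 - k)\<close>, it is the preimage of a line \<open>\<real> (cos \<psi> A + sin \<psi> B)\<close>; a local choice of the angle \<open>\<psi>\<close> gives
  \<open>\<theta> k = \<psi> + \<theta> (k - 1)\<close>, and \<open>\<theta> 0 = \<psi>\<close> at the start. Modulo \<open>F (n - k)\<close>, the bracket of two sections of \<open>F (n - k)\<close> is a multiple of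
  \<open>\<lambda> \<and> d\<psi>\<close>, where \<open>dh v = \<lambda> v (cos \<psi> A + sin \<psi> B)\<close>. This form is not zero, because the flag grows;
  hence \<open>d\<psi>\<close> does not vanish on \<open>ker dh\<close>, and the enlarged map still has independent differentials.
  The subspace \<open>F (n - k - 1)\<close> is an isotropic hyperplane for \<open>\<lambda> \<and> d\<psi>\<close>, so it contains the kernel of that form,
  which is \<open>ker dh \<inter> ker d\<psi>\<close>. This closes the induction.

  Only the start \<open>k = 0\<close> needs integration: functions \<open>\<xi>1, \<xi>2\<close> with \<open>ker d\<xi>1 \<inter> ker d\<xi>2 \<subseteq> F n\<close>
  (\<open>first_coordinates\<close>). The bracket form of \<open>F n\<close> has an isotropic hyperplane (given by \<open>F (n - 1)\<close>, or by any line
  if \<open>n = 0\<close>), so it has rank two. Its kernel \<open>C\<close> is involutive, and \<open>\<xi>1\<close> is a first integral of \<open>C\<close> with \<open>d\<xi>1\<close> not zero on \<open>F n\<close>. Then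
  \<open>F n \<inter> ker d\<xi>1\<close> is isotropic, hence involutive, and \<open>\<xi>2\<close> is a first integral of it. First integrals come from the
  theorem of Frobenius (\<open>frobenius_first_integral\<close>): an involutive distribution is locally
  spanned by commuting fields (the columns of a projection with constant kernel), and the endpoint
  map of the flows of their linear combinations straightens it (\<open>commuting_flow\<close>). Its smoothness is obtained by
  solving the integral equation in the Banach space of curves (\<open>solution_family\<close>).

  Lie brackets are natural under transition maps, so the derived flag may be computed in one
  chart (\<open>goursat_flag_in_chart\<close>). On the trailer side, the coordinates determine a point of the
  configuration space (\<open>torus_point\<close>), and every chart inverts this map up to a locally constant
  translation (\<open>chart_torus_point_local\<close>).
\<close>

section \<open>Calculus of smooth maps\<close>

abbreviation dd :: "('a::real_normed_vector \<Rightarrow> 'b::real_normed_vector) \<Rightarrow> 'a \<Rightarrow> 'a \<Rightarrow> 'b" where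
  "dd f x v \<equiv> frechet_derivative f (at x) v"

abbreviation Ck where "Ck \<equiv> higher_differentiable_on"

lemma dd_eqI: "(f has_derivative f') (at x) \<Longrightarrow> dd f x v = f' v"
  by (simp add: frechet_derivative_at[symmetric])

lemma dd_has_derivative: "f differentiable (at x) \<Longrightarrow> (f has_derivative dd f x) (at x)"
  by (simp add: frechet_derivative_works)

lemma dd_transform:
  assumes "open S" "x \<in> S" "\<And>y. y \<in> S \<Longrightarrow> f y = g y"
  shows "dd f x = dd g x"
proof -
  have "(f has_derivative f') (at x) \<longleftrightarrow> (g has_derivative f') (at x)" for f'
    using has_derivative_transform_within_open[of f f' x UNIV S g]
      has_derivative_transform_within_open[of g f' x UNIV S f] assms by auto
  then show ?thesis by (simp add: frechet_derivative_def)
qed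

lemma Ck_cong:
  assumes "Ck S f k" "open S" "\<And>x. x \<in> S \<Longrightarrow> f x = g x"
  shows "Ck S g k"
  using assms
proof (induction k arbitrary: f g)
  case 0 then show ?case by (metis continuous_on_cong higher_differentiable_on.simps(1))
next
  case (Suc k)
  have d: "dd f x = dd g x" if "x \<in> S" for x
    using dd_transform[OF Suc.prems(2) that] Suc.prems(3) by blast
  have "g differentiable at x" if "x \<in> S" for x
    using Suc.prems that
    by (metis differentiable_def has_derivative_transform_within_open higher_differentiable_on.simps(2))
  moreover have "Ck S (\<lambda>x. dd g x v) k" for v
    by (rule Suc.IH[of "\<lambda>x. dd f x v"]) (use Suc.prems d in auto)
  ultimately show ?case by simp
qed

text \<open>The recursion step in a form that allows the derivative to be given by a formula.\<close>
lemma Ck_SucI: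
  assumes "open S" "\<And>x. x \<in> S \<Longrightarrow> (f has_derivative f' x) (at x)" "\<And>v. Ck S (\<lambda>x. f' x v) k"
  shows "Ck S f (Suc k)"
proof -
  have "Ck S (\<lambda>x. dd f x v) k" for v
    by (rule Ck_cong[OF assms(3)[of v] assms(1)]) (simp add: dd_eqI[OF assms(2)])
  then show ?thesis using assms(2) by (auto simp: differentiable_def)
qed

lemma Ck_Suc_derivative:
  assumes "Ck S f (Suc k)"
  shows "x \<in> S \<Longrightarrow> (f has_derivative dd f x) (at x)" "Ck S (\<lambda>x. dd f x v) k"
  using assms by (auto simp: dd_has_derivative)

lemma Ck_Suc_le: "Ck S f (Suc k) \<Longrightarrow> Ck S f k"
proof (induction k arbitrary: f)
  case 0 then show ?case
    by (auto intro!: continuous_at_imp_continuous_on differentiable_imp_continuous_within)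
next
  case (Suc k)
  then show ?case by (metis higher_differentiable_on.simps(2))
qed

lemma Ck_subset: "Ck S f k \<Longrightarrow> T \<subseteq> S \<Longrightarrow> Ck T f k"
  by (induction k arbitrary: f) (auto intro: continuous_on_subset)

lemma Ck_local:
  assumes "\<And>x. x \<in> S \<Longrightarrow> \<exists>T. open T \<and> x \<in> T \<and> Ck T f k"
  shows "Ck S f k"
  using assms
proof (induction k arbitrary: f)
  case 0
  show ?case
    using 0 by (auto intro!: continuous_at_imp_continuous_on) (meson continuous_on_eq_continuous_at)
next
  case (Suc k)
  have "f differentiable at x" if "x \<in> S" for x using Suc.prems[OF that] by auto
  moreover have "Ck S (\<lambda>x. dd f x v) k" for v
  proof (rule Suc.IH)
    fix x assume "x \<in> S"
    then obtain T where "open T" "x \<in> T" "Ck T f (Suc k)" using Suc.prems by metis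
    then show "\<exists>T. open T \<and> x \<in> T \<and> Ck T (\<lambda>x. dd f x v) k" by auto
  qed
  ultimately show ?case by simp
qed

lemma Ck_const: "Ck S (\<lambda>x. c) k"
  by (induction k arbitrary: c) auto

lemma Ck_linear:
  assumes "bounded_linear L" shows "Ck S L k"
proof (cases k)
  case 0 then show ?thesis using assms by (simp add: linear_continuous_on)
next
  case (Suc j)
  have "L differentiable at x" "dd L x v = L v" for x v
    using bounded_linear_imp_has_derivative[OF assms, of "at x"] by (auto simp: differentiable_def dd_eqI)
  then show ?thesis using Suc by (auto simp: Ck_const)
qed

lemma Ck_add:
  assumes "open S" "Ck S f k" "Ck S g k" shows "Ck S (\<lambda>x. f x + g x) k"
  using assms(2,3)
proof (induction k arbitrary: f g)
  case 0 then show ?case by (auto intro: continuous_on_add)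
next
  case (Suc k)
  show ?case
    by (rule Ck_SucI[where f' = "\<lambda>x v. dd f x v + dd g x v"])
      (intro assms has_derivative_add Ck_Suc_derivative[OF Suc.prems(1)] Ck_Suc_derivative[OF Suc.prems(2)] Suc.IH | assumption)+
qed

lemma Ck_sum:
  assumes "open S" "\<And>i. i \<in> I \<Longrightarrow> Ck S (f i) k" shows "Ck S (\<lambda>x. \<Sum>i\<in>I. f i x) k"
  using assms(2)
proof (induction I rule: infinite_finite_induct)
  case (insert i I)
  then show ?case using Ck_add[OF assms(1), of "f i" k "\<lambda>x. \<Sum>i\<in>I. f i x"] by auto
qed (auto simp: Ck_const)

lemma Ck_bounded_linear:
  assumes "bounded_linear L" "open S" "Ck S f k" shows "Ck S (\<lambda>x. L (f x)) k"
  using assms(3)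
proof (induction k arbitrary: f)
  case 0 then show ?case using bounded_linear.continuous_on[OF assms(1)] by auto
next
  case (Suc k)
  show ?case
    by (rule Ck_SucI[where f' = "\<lambda>x v. L (dd f x v)"])
      (intro assms bounded_linear.has_derivative[OF assms(1)] Ck_Suc_derivative[OF Suc.prems] Suc.IH | assumption)+
qed

lemma Ck_bilinear:
  assumes "bounded_bilinear p" "open S" "Ck S f k" "Ck S g k"
  shows "Ck S (\<lambda>x. p (f x) (g x)) k"
  using assms(3,4)
proof (induction k arbitrary: f g)
  case 0 then show ?case using bounded_bilinear.continuous_on[OF assms(1)] by auto
next
  case (Suc k)
  show ?case
  proof (rule Ck_SucI[where f' = "\<lambda>x v. p (f x) (dd g x v) + p (dd f x v) (g x)"])
    show "((\<lambda>x. p (f x) (g x)) has_derivative (\<lambda>v. p (f x) (dd g x v) + p (dd f x v) (g x))) (at x)"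
      if "x \<in> S" for x
      by (rule bounded_bilinear.FDERIV[OF assms(1) Ck_Suc_derivative(1)[OF Suc.prems(1) that] Ck_Suc_derivative(1)[OF Suc.prems(2) that]])
    show "Ck S (\<lambda>x. p (f x) (dd g x v) + p (dd f x v) (g x)) k" for v
      by (intro Ck_add assms Suc.IH) (use Suc.prems Ck_Suc_derivative(2) Ck_Suc_le in blast)+
  qed (fact assms)
qed

lemma dd_euclidean:
  fixes f :: "'a::euclidean_space \<Rightarrow> 'b::real_normed_vector"
  assumes "f differentiable (at x)"
  shows "dd f x v = (\<Sum>b\<in>Basis. (v \<bullet> b) *\<^sub>R dd f x b)"
proof -
  have l: "linear (dd f x)" using assms by (simp add: linear_frechet_derivative)
  have "dd f x v = dd f x (\<Sum>b\<in>Basis. (v \<bullet> b) *\<^sub>R b)" by (simp add: euclidean_representation)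
  also have "\<dots> = (\<Sum>b\<in>Basis. (v \<bullet> b) *\<^sub>R dd f x b)" by (simp add: linear_sum[OF l] linear_scale[OF l])
  finally show ?thesis .
qed

text \<open>
  The space in the middle is finite-dimensional, so that the derivative of the composite is a finite
  sum of products of directional derivatives along basis vectors, to which the induction hypothesis
  applies.
\<close>
lemma Ck_compose:
  fixes f :: "'b::euclidean_space \<Rightarrow> 'c::real_normed_vector"
  assumes "open S" "Ck S g k" "Ck T f k" "\<And>x. x \<in> S \<Longrightarrow> g x \<in> T"
  shows "Ck S (\<lambda>x. f (g x)) k"
  using assms(2,3)
proof (induction k arbitrary: f)
  case 0 then show ?case using assms(4) by (auto intro: continuous_on_compose2)
next
  case (Suc k)
  have f: "f differentiable at (g x)" if "x \<in> S" for x using Suc.prems assms(4) that by auto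
  show ?case
  proof (rule Ck_SucI[where f' = "\<lambda>x v. \<Sum>b\<in>Basis. (dd g x v \<bullet> b) *\<^sub>R dd f (g x) b"])
    show "((\<lambda>x. f (g x)) has_derivative (\<lambda>v. \<Sum>b\<in>Basis. (dd g x v \<bullet> b) *\<^sub>R dd f (g x) b)) (at x)"
      if "x \<in> S" for x
      using has_derivative_compose[OF Ck_Suc_derivative(1)[OF Suc.prems(1) that] dd_has_derivative[OF f[OF that]]]
      by (simp add: dd_euclidean[OF f[OF that], symmetric])
    show "Ck S (\<lambda>x. \<Sum>b\<in>Basis. (dd g x v \<bullet> b) *\<^sub>R dd f (g x) b) k" for v
    proof (intro Ck_sum assms(1) Ck_bilinear[OF bounded_bilinear_scaleR])
      fix b :: 'b
      show "Ck S (\<lambda>x. dd g x v \<bullet> b) k"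
        by (intro Ck_bounded_linear[OF bounded_linear_inner_left] assms Ck_Suc_derivative Suc.prems)
      show "Ck S (\<lambda>x. dd f (g x) b) k"
        by (rule Suc.IH) (use Suc.prems Ck_Suc_derivative(2) Ck_Suc_le in blast)+
    qed
  qed (fact assms)
qed

lemma Ck_real_SucI:
  fixes f :: "real \<Rightarrow> real"
  assumes "open T" "\<And>x. x \<in> T \<Longrightarrow> (f has_real_derivative f' x) (at x)" "Ck T f' k"
  shows "Ck T f (Suc k)"
proof (rule Ck_SucI[where f' = "\<lambda>x v. f' x * v"])
  show "(f has_derivative (\<lambda>v. f' x * v)) (at x)" if "x \<in> T" for x
    using assms(2)[OF that] by (simp add: has_field_derivative_def)
  show "Ck T (\<lambda>x. f' x * v) k" for v
    by (intro Ck_bilinear[OF bounded_bilinear_mult] assms Ck_const)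
qed (fact assms)

lemma Ck_inverse: "Ck (- {0}) (inverse :: real \<Rightarrow> real) k"
proof (induction k)
  case 0 then show ?case by (auto intro!: continuous_intros)
next
  case (Suc k)
  show ?case
  proof (rule Ck_real_SucI[where f' = "\<lambda>x. - (inverse x * inverse x)"])
    show "Ck (- {0}) (\<lambda>x::real. - (inverse x * inverse x)) k"
      by (intro Ck_bounded_linear[OF bounded_linear_minus[OF bounded_linear_ident]]
          Ck_bilinear[OF bounded_bilinear_mult] Suc) auto
  qed (auto intro!: derivative_eq_intros)
qed

lemma Ck_sin_cos: "Ck UNIV (sin :: real \<Rightarrow> real) k \<and> Ck UNIV (cos :: real \<Rightarrow> real) k"
proof (induction k)
  case 0 then show ?case by (auto intro!: continuous_intros)
next
  case (Suc k)
  have "Ck UNIV (\<lambda>x::real. - sin x) k"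
    using Suc by (intro Ck_bounded_linear[OF bounded_linear_minus[OF bounded_linear_ident]]) auto
  then show ?case
    using Suc by (intro conjI Ck_real_SucI[where f' = cos] Ck_real_SucI[where f' = "\<lambda>x. - sin x"])
      (auto intro!: derivative_eq_intros)
qed

lemma Ck_arctan: "Ck UNIV (arctan :: real \<Rightarrow> real) k"
proof (cases k)
  case 0 then show ?thesis by (auto intro!: continuous_intros)
next
  case (Suc j)
  have "1 + x * x \<noteq> 0" for x :: real by (metis add.commute add_nonneg_eq_0_iff zero_le_one zero_le_square zero_neq_one)
  then have "Ck UNIV (\<lambda>x::real. inverse (1 + x * x)) j"
    by (intro Ck_compose[OF _ _ Ck_inverse, where S=UNIV and g="\<lambda>x. 1 + x * x"] Ck_add Ck_const
        Ck_bilinear[OF bounded_bilinear_mult] Ck_linear) auto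
  then show ?thesis unfolding Suc
    by (intro Ck_real_SucI[where f' = "\<lambda>x. inverse (1 + x * x)"])
      (auto intro!: derivative_eq_intros simp: power2_eq_square)
qed

lemma Ck_blinfun_componentwise:
  fixes A :: "'x::real_normed_vector \<Rightarrow> ('a::euclidean_space \<Rightarrow>\<^sub>L 'b::real_normed_vector)"
  assumes "open S" "\<And>b. b \<in> Basis \<Longrightarrow> Ck S (\<lambda>x. A x b) k"
  shows "Ck S A k"
proof -
  have "A x = (\<Sum>b\<in>Basis. blinfun_scaleR_left (A x b) o\<^sub>L blinfun_inner_left b)" for x
  proof (rule blinfun_eqI)
    fix v
    have "A x v = A x (\<Sum>b\<in>Basis. (v \<bullet> b) *\<^sub>R b)" by (simp add: euclidean_representation)
    also have "\<dots> = (\<Sum>b\<in>Basis. (v \<bullet> b) *\<^sub>R A x b)"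
      by (simp add: blinfun.sum_right blinfun.scaleR_right)
    finally show "A x v = (\<Sum>b\<in>Basis. blinfun_scaleR_left (A x b) o\<^sub>L blinfun_inner_left b) v"
      by (simp add: blinfun.sum_left blinfun_inner_left.rep_eq)
  qed
  moreover have "Ck S (\<lambda>x. \<Sum>b\<in>Basis. blinfun_scaleR_left (A x b) o\<^sub>L blinfun_inner_left b) k"
    by (intro Ck_sum assms(1) Ck_bilinear[OF bounded_bilinear_blinfun_compose]
        Ck_bounded_linear[OF bounded_linear_blinfun_scaleR_left] Ck_const assms(2))
  ultimately show ?thesis by (metis (no_types, lifting) Ck_cong assms(1))
qed

text \<open>The inverse is bounded near each point, by the resolvent identity \<open>B y - B x = - B y (A y - A x) B x\<close>.\<close>
lemma continuous_on_blinfun_inverse: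
  fixes A :: "'x::real_normed_vector \<Rightarrow> ('a::real_normed_vector \<Rightarrow>\<^sub>L 'b::real_normed_vector)"
  assumes inv: "\<And>x. x \<in> S \<Longrightarrow> B x o\<^sub>L A x = id_blinfun" "\<And>x. x \<in> S \<Longrightarrow> A x o\<^sub>L B x = id_blinfun"
    and A: "continuous_on S A"
  shows "continuous_on S B"
  unfolding continuous_on_def
proof
  fix x assume x: "x \<in> S"
  have Al: "(A \<longlongrightarrow> A x) (at x within S)" using A x by (auto simp: continuous_on_def)
  let ?d = "\<lambda>y. norm (A y - A x)"
  have d0: "(?d \<longlongrightarrow> 0) (at x within S)"
    using tendsto_norm[OF tendsto_diff[OF Al tendsto_const[of "A x"]]] by simp
  have eq: "B y - B x = - (B y o\<^sub>L (A y - A x) o\<^sub>L B x)" if "y \<in> S" for y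
  proof (rule blinfun_eqI)
    fix v
    have "B y (A y (B x v)) = B x v" "A x (B x v) = v"
      using inv(1)[OF that] inv(2)[OF x] by (metis blinfun_apply_blinfun_compose blinfun_apply_id_blinfun)+
    then show "(B y - B x) v = (- (B y o\<^sub>L (A y - A x) o\<^sub>L B x)) v"
      by (simp add: blinfun.diff_left blinfun.diff_right blinfun.minus_left)
  qed
  have b1: "norm (B y - B x) \<le> norm (B y) * ?d y * norm (B x)" if "y \<in> S" for y
    unfolding eq[OF that] norm_minus_cancel
    by (meson mult_right_mono norm_blinfun_compose norm_ge_zero order_trans)
  have ev: "eventually (\<lambda>y. ?d y * norm (B x) < 1/2) (at x within S)"
    by (rule order_tendstoD(2)[OF tendsto_mult_left_zero[OF d0]]) simp
  have b2: "norm (B y) \<le> 2 * norm (B x)" if "y \<in> S" "?d y * norm (B x) < 1/2" for y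
  proof -
    have "norm (B y) \<le> norm (B x) + norm (B y - B x)" by (metis norm_triangle_sub)
    also have "\<dots> \<le> norm (B x) + norm (B y) * (?d y * norm (B x))" using b1[OF that(1)] by (simp add: mult.assoc)
    also have "\<dots> \<le> norm (B x) + norm (B y) * (1/2)" using that(2) by (intro add_left_mono mult_left_mono) auto
    finally show ?thesis by simp
  qed
  have eventually_at_in_S: "eventually (\<lambda>y. y \<in> S) (at x within S)"
    by (simp add: eventually_at_filter)
  have "((\<lambda>y. B y - B x) \<longlongrightarrow> 0) (at x within S)"
  proof (rule Lim_null_comparison)
    show "eventually (\<lambda>y. norm (B y - B x) \<le> 2 * norm (B x) * ?d y * norm (B x)) (at x within S)"
      using ev eventually_at_in_S
    proof eventually_elim
      case (elim y)
      then show ?case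
        using b1[of y] mult_right_mono[OF b2[of y], of "?d y * norm (B x)"] by (simp add: mult.assoc)
    qed
    show "((\<lambda>y. 2 * norm (B x) * ?d y * norm (B x)) \<longlongrightarrow> 0) (at x within S)"
      using tendsto_mult_left_zero[OF tendsto_mult_right_zero[OF d0]] by auto
  qed
  then show "(B \<longlongrightarrow> B x) (at x within S)" by (simp add: LIM_zero_iff)
qed

lemma tendsto_scaled_remainder:
  assumes "(f has_derivative f') (at x)"
  shows "((\<lambda>y. (f y - f x - f' (y - x)) /\<^sub>R norm (y - x)) \<longlongrightarrow> 0) (at x)"
  using assms by (simp add: has_derivative_at_within)

lemma has_derivative_blinfun_inverse:
  fixes A :: "'x::real_normed_vector \<Rightarrow> ('a::real_normed_vector \<Rightarrow>\<^sub>L 'b::real_normed_vector)"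
  assumes S: "open S" "x \<in> S"
    and inv: "\<And>x. x \<in> S \<Longrightarrow> B x o\<^sub>L A x = id_blinfun" "\<And>x. x \<in> S \<Longrightarrow> A x o\<^sub>L B x = id_blinfun"
    and B: "continuous_on S B" and A: "(A has_derivative A') (at x)"
  shows "(B has_derivative (\<lambda>h. - (B x o\<^sub>L A' h o\<^sub>L B x))) (at x)"
  unfolding has_derivative_at_within
proof
  have bA: "bounded_linear A'" using A by (rule has_derivative_bounded_linear)
  show "bounded_linear (\<lambda>h. - (B x o\<^sub>L A' h o\<^sub>L B x))"
    by (intro bounded_linear_minus bounded_linear_compose[OF bounded_bilinear.bounded_linear_left[OF bounded_bilinear_blinfun_compose]]
      bounded_linear_compose[OF bounded_bilinear.bounded_linear_right[OF bounded_bilinear_blinfun_compose]] bA)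
  have Bl: "(B \<longlongrightarrow> B x) (at x)"
    using B S by (simp add: continuous_on_eq_continuous_at isContD)
  let ?R = "\<lambda>y. (A y - A x - A' (y - x)) /\<^sub>R norm (y - x)" and ?Q = "\<lambda>y. A' (y - x) /\<^sub>R norm (y - x)"
  have R: "(?R \<longlongrightarrow> 0) (at x)" by (rule tendsto_scaled_remainder[OF A])
  obtain K where K: "\<And>h. norm (A' h) \<le> norm h * K" using bounded_linear.bounded[OF bA] by blast
  have Q: "norm (?Q y) \<le> \<bar>K\<bar>" for y
  proof (cases "y = x")
    case False
    then show ?thesis using K[of "y - x"] abs_ge_self[of K]
      by (simp add: divide_simps) (metis abs_mult abs_norm_cancel abs_ge_self norm_ge_zero order_trans mult.commute)
  qed (simp add: linear_0[OF bounded_linear.linear[OF bA]])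
  have lim1: "((\<lambda>y. B y o\<^sub>L ?R y o\<^sub>L B x) \<longlongrightarrow> B x o\<^sub>L 0 o\<^sub>L B x) (at x)"
    by (intro bounded_bilinear.tendsto[OF bounded_bilinear_blinfun_compose] Bl R tendsto_const)
  have lim2: "((\<lambda>y. (B y - B x) o\<^sub>L ?Q y o\<^sub>L B x) \<longlongrightarrow> 0) (at x)"
  proof (rule Lim_null_comparison)
    show "eventually (\<lambda>y. norm ((B y - B x) o\<^sub>L ?Q y o\<^sub>L B x) \<le> norm (B y - B x) * \<bar>K\<bar> * norm (B x)) (at x)"
      by (intro always_eventually allI order_trans[OF norm_blinfun_compose] mult_right_mono norm_ge_zero
         order_trans[OF norm_blinfun_compose] mult_left_mono Q)
    have "((\<lambda>y. norm (B y - B x)) \<longlongrightarrow> 0) (at x)"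
      using tendsto_norm[OF tendsto_diff[OF Bl tendsto_const[of "B x"]]] by simp
    then show "((\<lambda>y. norm (B y - B x) * \<bar>K\<bar> * norm (B x)) \<longlongrightarrow> 0) (at x)"
      by (intro tendsto_mult_left_zero)
  qed
  have ev: "eventually (\<lambda>y. y \<in> S) (at x)" using S by (simp add: eventually_at_in_open')
  have "((\<lambda>y. - (B y o\<^sub>L ?R y o\<^sub>L B x) - ((B y - B x) o\<^sub>L ?Q y o\<^sub>L B x)) \<longlongrightarrow> - (B x o\<^sub>L 0 o\<^sub>L B x) - 0) (at x)"
    by (intro tendsto_diff tendsto_minus lim1 lim2)
  then have "((\<lambda>y. - (B y o\<^sub>L ?R y o\<^sub>L B x) - ((B y - B x) o\<^sub>L ?Q y o\<^sub>L B x)) \<longlongrightarrow> 0) (at x)"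
    by simp
  then show "((\<lambda>y. (B y - B x - - (B x o\<^sub>L A' (y - x) o\<^sub>L B x)) /\<^sub>R norm (y - x)) \<longlongrightarrow> 0) (at x)"
  proof (rule Lim_transform_eventually)
    show "eventually (\<lambda>y. - (B y o\<^sub>L ?R y o\<^sub>L B x) - ((B y - B x) o\<^sub>L ?Q y o\<^sub>L B x)
        = (B y - B x - - (B x o\<^sub>L A' (y - x) o\<^sub>L B x)) /\<^sub>R norm (y - x)) (at x)"
      using ev
    proof eventually_elim
      case (elim y)
      have e: "B y (A y u) = u" "A x (B x v) = v" for u v
        using inv(1)[OF elim] inv(2)[OF S(2)] by (metis blinfun_apply_blinfun_compose blinfun_apply_id_blinfun)+
      show ?case
        by (rule blinfun_eqI)
          (simp add: blinfun.diff_left blinfun.diff_right blinfun.minus_left blinfun.scaleR_left blinfun.scaleR_right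
            blinfun.add_left e scaleR_diff_right scaleR_add_right)
    qed
  qed
qed

text \<open>The derivative \<open>- B A' B\<close> of the inverse involves only \<open>B\<close> itself and \<open>A'\<close>, so regularity is inherited step by step.\<close>
lemma Ck_blinfun_inverse:
  fixes A :: "'x::real_normed_vector \<Rightarrow> ('a::real_normed_vector \<Rightarrow>\<^sub>L 'b::real_normed_vector)"
  assumes S: "open S"
    and inv: "\<And>x. x \<in> S \<Longrightarrow> B x o\<^sub>L A x = id_blinfun" "\<And>x. x \<in> S \<Longrightarrow> A x o\<^sub>L B x = id_blinfun"
    and "Ck S A k"
  shows "Ck S B k"
  using assms(4)
proof (induction k)
  case 0 then show ?case using continuous_on_blinfun_inverse[OF inv] by simp
next
  case (Suc k)
  have B: "Ck S B k" using Suc Ck_Suc_le by blast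
  have cB: "continuous_on S B"
    by (rule continuous_on_blinfun_inverse[OF inv])
      (use Suc.prems in \<open>auto intro!: continuous_at_imp_continuous_on differentiable_imp_continuous_within\<close>)
  show ?case
  proof (rule Ck_SucI[OF S])
    show "(B has_derivative (\<lambda>h. - (B x o\<^sub>L dd A x h o\<^sub>L B x))) (at x)" if "x \<in> S" for x
      by (rule has_derivative_blinfun_inverse[OF S that inv cB Ck_Suc_derivative(1)[OF Suc.prems that]])
    show "Ck S (\<lambda>x. - (B x o\<^sub>L dd A x v o\<^sub>L B x)) k" for v
      by (intro Ck_bounded_linear[OF bounded_linear_minus[OF bounded_linear_ident]] S B
        Ck_bilinear[OF bounded_bilinear_blinfun_compose] Ck_Suc_derivative(2)[OF Suc.prems])
  qed
qed

text \<open>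
  The second difference of \<open>f\<close> along \<open>h u\<close> and \<open>h v\<close> equals \<open>h\<^sup>2\<close> times the mixed derivative up to \<open>o(h\<^sup>2)\<close>:
  the mean value theorem is applied to \<open>s \<mapsto> f (x + s u + h v) - f (x + s u)\<close>. The second difference
  is symmetric in \<open>u\<close> and \<open>v\<close>, and this makes the second derivative symmetric.
\<close>
lemma second_difference_bound:
  fixes f :: "'a::real_normed_vector \<Rightarrow> 'b::real_normed_vector"
  assumes S: "open S" "x \<in> S" and f: "\<And>y. y \<in> S \<Longrightarrow> f differentiable (at y)"
    and d: "(\<lambda>y. dd f y u) differentiable (at x)" and e: "0 < e"
  shows "\<exists>\<delta>>0. \<forall>h. 0 < h \<and> h < \<delta> \<longrightarrow>
    norm (f (x + h *\<^sub>R u + h *\<^sub>R v) - f (x + h *\<^sub>R u) - f (x + h *\<^sub>R v) + f x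
          - h\<^sup>2 *\<^sub>R dd (\<lambda>y. dd f y u) x v) \<le> e * h\<^sup>2"
proof -
  let ?g = "\<lambda>y. dd f y u"
  let ?L = "dd ?g x"
  have gd: "(?g has_derivative ?L) (at x)" using d by (rule dd_has_derivative)
  have L: "linear ?L" using gd has_derivative_bounded_linear bounded_linear.linear by blast
  define c where "c = norm u + norm v + 1"
  have c: "c > 0" unfolding c_def by (smt (verit) norm_ge_zero)
  define e' where "e' = e / (3 * c)"
  have e': "e' > 0" using e c by (simp add: e'_def)
  obtain d1 where d1: "d1 > 0" "\<And>y. norm (y - x) < d1 \<Longrightarrow> norm (?g y - ?g x - ?L (y - x)) \<le> e' * norm (y - x)"
    using gd e' unfolding has_derivative_at_alt by blast
  obtain d2 where d2: "d2 > 0" "ball x d2 \<subseteq> S" using S open_contains_ball by blast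
  define \<delta> where "\<delta> = min d1 d2 / (c + 1)"
  have \<delta>: "\<delta> > 0" using d1 d2 c by (simp add: \<delta>_def)
  show ?thesis
  proof (intro exI[of _ \<delta>] conjI allI impI, fact)
    fix h :: real assume h: "0 < h \<and> h < \<delta>"
    have hc: "h * c < d1" "h * c < d2"
    proof -
      have "h * c \<le> h * (c + 1)" using h by simp
      also have "\<dots> < \<delta> * (c + 1)" using h c by (intro mult_strict_right_mono) auto
      also have "\<dots> = min d1 d2" using c by (simp add: \<delta>_def)
      finally show "h * c < d1" "h * c < d2" by auto
    qed
    have nb: "norm (s *\<^sub>R u + t *\<^sub>R v) \<le> h * c" if "\<bar>s\<bar> \<le> h" "\<bar>t\<bar> \<le> h" for s t
    proof -
      have "norm (s *\<^sub>R u + t *\<^sub>R v) \<le> \<bar>s\<bar> * norm u + \<bar>t\<bar> * norm v"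
        by (metis norm_scaleR norm_triangle_ineq)
      also have "\<dots> \<le> h * norm u + h * norm v" by (intro add_mono mult_right_mono that) auto
      also have "\<dots> \<le> h * c" using h by (simp add: c_def algebra_simps)
      finally show ?thesis .
    qed
    have inS: "x + (s *\<^sub>R u + t *\<^sub>R v) \<in> S" if "\<bar>s\<bar> \<le> h" "\<bar>t\<bar> \<le> h" for s t
    proof -
      have "dist x (x + (s *\<^sub>R u + t *\<^sub>R v)) < d2" using nb[OF that] hc
        by (metis add_diff_cancel_left' dist_norm dist_commute order_le_less_trans)
      then show ?thesis using d2 by (metis mem_ball subsetD)
    qed
    have g1: "norm (?g (x + (s *\<^sub>R u + t *\<^sub>R v)) - ?g x - ?L (s *\<^sub>R u + t *\<^sub>R v)) \<le> e' * (h * c)"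
      if "\<bar>s\<bar> \<le> h" "\<bar>t\<bar> \<le> h" for s t
    proof -
      have "norm ((x + (s *\<^sub>R u + t *\<^sub>R v)) - x) < d1" using nb[OF that] hc by simp
      from d1(2)[OF this] show ?thesis using nb[OF that] e' by simp (meson mult_left_mono order_trans less_imp_le)
    qed
    define \<phi> where "\<phi> s = f (x + (s *\<^sub>R u + h *\<^sub>R v)) - f (x + (s *\<^sub>R u + 0 *\<^sub>R v))" for s
    define \<phi>' where "\<phi>' s = ?g (x + (s *\<^sub>R u + h *\<^sub>R v)) - ?g (x + (s *\<^sub>R u + 0 *\<^sub>R v))" for s
    have fs: "((\<lambda>s. f (x + (s *\<^sub>R u + t *\<^sub>R v))) has_vector_derivative ?g (x + (s *\<^sub>R u + t *\<^sub>R v))) (at s within {0..h})"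
      if "s \<in> {0..h}" "\<bar>t\<bar> \<le> h" for s t
    proof -
      have "x + (s *\<^sub>R u + t *\<^sub>R v) \<in> S" using inS[of s t] that by auto
      then have F: "(f has_derivative dd f (x + (s *\<^sub>R u + t *\<^sub>R v))) (at (x + (s *\<^sub>R u + t *\<^sub>R v)))"
        using f dd_has_derivative by blast
      have G: "((\<lambda>s. x + (s *\<^sub>R u + t *\<^sub>R v)) has_derivative (\<lambda>r. r *\<^sub>R u)) (at s within {0..h})"
        by (auto intro!: derivative_eq_intros)
      have l: "linear (dd f (x + (s *\<^sub>R u + t *\<^sub>R v)))" using F has_derivative_bounded_linear bounded_linear.linear by blast
      show ?thesis
        using has_derivative_compose[OF G F] by (simp add: has_vector_derivative_def linear_scale[OF l])
    qed
    have \<phi>d: "(\<phi> has_vector_derivative \<phi>' s) (at s within {0..h})" if "s \<in> {0..h}" for s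
      unfolding \<phi>_def \<phi>'_def
      by (intro has_vector_derivative_diff fs that) (use h in auto)
    have \<psi>d: "((\<lambda>s. \<phi> s - (s * h) *\<^sub>R ?L v) has_derivative (\<lambda>r. r *\<^sub>R (\<phi>' s - h *\<^sub>R ?L v))) (at s within {0..h})"
      if "s \<in> {0..h}" for s
      using \<phi>d[OF that] unfolding has_vector_derivative_def
      by (auto intro!: derivative_eq_intros simp: algebra_simps)
    have bd: "norm (\<phi>' s - h *\<^sub>R ?L v) \<le> 2 * (e' * (h * c))" if "s \<in> {0..h}" for s
    proof -
      have Leq: "h *\<^sub>R ?L v = ?L (s *\<^sub>R u + h *\<^sub>R v) - ?L (s *\<^sub>R u + 0 *\<^sub>R v)"
        by (simp add: linear_add[OF L] linear_scale[OF L])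
      have "\<phi>' s - h *\<^sub>R ?L v = (?g (x + (s *\<^sub>R u + h *\<^sub>R v)) - ?g x - ?L (s *\<^sub>R u + h *\<^sub>R v))
        - (?g (x + (s *\<^sub>R u + 0 *\<^sub>R v)) - ?g x - ?L (s *\<^sub>R u + 0 *\<^sub>R v))"
        unfolding \<phi>'_def Leq by simp
      then show ?thesis
        using g1[of s h] g1[of s 0] that h norm_triangle_ineq4 by (smt (verit, best) atLeastAtMost_iff)
    qed
    have "norm ((\<phi> h - (h * h) *\<^sub>R ?L v) - (\<phi> 0 - (0 * h) *\<^sub>R ?L v)) \<le> 2 * (e' * (h * c)) * norm (h - 0)"
    proof (rule differentiable_bound[of "{0..h}" "\<lambda>s. \<phi> s - (s * h) *\<^sub>R ?L v" "\<lambda>s r. r *\<^sub>R (\<phi>' s - h *\<^sub>R ?L v)"])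
      show "onorm (\<lambda>r. r *\<^sub>R (\<phi>' s - h *\<^sub>R ?L v)) \<le> 2 * (e' * (h * c))" if "s \<in> {0..h}" for s
        using bd[OF that] e' h c
        by (intro onorm_bound) (auto simp: mult.commute[of "\<bar>_\<bar>"] intro!: mult_right_mono)
    qed (use \<psi>d h in auto)
    also have "2 * (e' * (h * c)) * norm (h - 0) \<le> e * h\<^sup>2"
      using h c e by (simp add: e'_def power2_eq_square field_simps)
    finally show "norm (f (x + h *\<^sub>R u + h *\<^sub>R v) - f (x + h *\<^sub>R u) - f (x + h *\<^sub>R v) + f x - h\<^sup>2 *\<^sub>R ?L v) \<le> e * h\<^sup>2"
      by (simp add: \<phi>_def power2_eq_square algebra_simps)
  qed
qed

lemma dd_dd_symmetric:
  fixes f :: "'a::real_normed_vector \<Rightarrow> 'b::real_normed_vector"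
  assumes S: "open S" "x \<in> S" and f: "Ck S f (Suc (Suc 0))"
  shows "dd (\<lambda>y. dd f y u) x v = dd (\<lambda>y. dd f y v) x u"
proof (rule ccontr)
  let ?A = "dd (\<lambda>y. dd f y u) x v" and ?B = "dd (\<lambda>y. dd f y v) x u"
  assume "?A \<noteq> ?B"
  then have n: "norm (?A - ?B) > 0" by simp
  define e where "e = norm (?A - ?B) / 3"
  have e: "e > 0" using n by (simp add: e_def)
  have fd: "\<And>y. y \<in> S \<Longrightarrow> f differentiable at y" and gd: "(\<lambda>y. dd f y w) differentiable at x" for w
    using f S by auto
  obtain d1 where d1: "d1 > 0" "\<And>h. 0 < h \<and> h < d1 \<Longrightarrow> norm (f (x + h *\<^sub>R u + h *\<^sub>R v) - f (x + h *\<^sub>R u) - f (x + h *\<^sub>R v) + f x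
          - h\<^sup>2 *\<^sub>R ?A) \<le> e * h\<^sup>2" using second_difference_bound[OF S fd gd e, of u v] by blast
  obtain d2 where d2: "d2 > 0" "\<And>h. 0 < h \<and> h < d2 \<Longrightarrow> norm (f (x + h *\<^sub>R v + h *\<^sub>R u) - f (x + h *\<^sub>R v) - f (x + h *\<^sub>R u) + f x
          - h\<^sup>2 *\<^sub>R ?B) \<le> e * h\<^sup>2" using second_difference_bound[OF S fd gd e, of v u] by blast
  define h where "h = min d1 d2 / 2"
  have h: "0 < h" "h < d1" "h < d2" using d1(1) d2(1) by (auto simp: h_def)
  let ?Z = "f (x + h *\<^sub>R u + h *\<^sub>R v) - f (x + h *\<^sub>R u) - f (x + h *\<^sub>R v) + f x"
  have z: "norm (?Z - h\<^sup>2 *\<^sub>R ?A) \<le> e * h\<^sup>2" using d1(2)[of h] h by simp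
  have z2: "norm (?Z - h\<^sup>2 *\<^sub>R ?B) \<le> e * h\<^sup>2" using d2(2)[of h] h by (simp add: algebra_simps)
  have "norm (h\<^sup>2 *\<^sub>R (?A - ?B)) = norm ((?Z - h\<^sup>2 *\<^sub>R ?B) - (?Z - h\<^sup>2 *\<^sub>R ?A))" by (simp add: scaleR_diff_right)
  also have "\<dots> \<le> e * h\<^sup>2 + e * h\<^sup>2" using norm_triangle_ineq4 z z2 by (smt (verit))
  finally have "norm (?A - ?B) * h\<^sup>2 \<le> 2 * e * h\<^sup>2" by (simp add: mult.commute)
  then have "norm (?A - ?B) \<le> 2 * e" using h by simp
  then show False using n by (simp add: e_def)
qed

lemma smooth_onI: "(\<And>k. Ck S f k) \<Longrightarrow> smooth_on S f" by (simp add: smooth_on_def)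
lemma smooth_onD: "smooth_on S f \<Longrightarrow> Ck S f k" by (simp add: smooth_on_def)

lemma smooth_has_derivative: "smooth_on S f \<Longrightarrow> x \<in> S \<Longrightarrow> (f has_derivative dd f x) (at x)"
  using Ck_Suc_derivative(1) smooth_onD by blast

lemma smooth_differentiable: "smooth_on S f \<Longrightarrow> x \<in> S \<Longrightarrow> f differentiable (at x)"
  using smooth_has_derivative differentiable_def by blast

lemma smooth_linear_dd: "smooth_on S f \<Longrightarrow> x \<in> S \<Longrightarrow> linear (dd f x)"
  using smooth_has_derivative has_derivative_bounded_linear bounded_linear.linear by blast

lemma smooth_continuous_on: "smooth_on S f \<Longrightarrow> continuous_on S f"
  using smooth_onD[of S f 0] by simp

lemma smooth_cong: "smooth_on S f \<Longrightarrow> open S \<Longrightarrow> (\<And>x. x \<in> S \<Longrightarrow> f x = g x) \<Longrightarrow> smooth_on S g"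
  unfolding smooth_on_def using Ck_cong by blast
lemma smooth_subset: "smooth_on S f \<Longrightarrow> T \<subseteq> S \<Longrightarrow> smooth_on T f"
  unfolding smooth_on_def using Ck_subset by blast
lemma smooth_local: "(\<And>x. x \<in> S \<Longrightarrow> \<exists>T. open T \<and> x \<in> T \<and> smooth_on T f) \<Longrightarrow> smooth_on S f"
  unfolding smooth_on_def by (intro allI Ck_local) blast
lemma smooth_const: "smooth_on S (\<lambda>x. c)" by (simp add: smooth_on_def Ck_const)
lemma smooth_linear: "bounded_linear L \<Longrightarrow> smooth_on S L" by (simp add: smooth_on_def Ck_linear)
lemma smooth_id: "smooth_on S (\<lambda>x. x)" by (rule smooth_linear[OF bounded_linear_ident])
lemma smooth_bounded_linear: "bounded_linear L \<Longrightarrow> open S \<Longrightarrow> smooth_on S f \<Longrightarrow> smooth_on S (\<lambda>x. L (f x))"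
  by (simp add: smooth_on_def Ck_bounded_linear)
lemma smooth_bilinear:
  "bounded_bilinear p \<Longrightarrow> open S \<Longrightarrow> smooth_on S f \<Longrightarrow> smooth_on S g \<Longrightarrow> smooth_on S (\<lambda>x. p (f x) (g x))"
  by (simp add: smooth_on_def Ck_bilinear)
lemma smooth_add: "open S \<Longrightarrow> smooth_on S f \<Longrightarrow> smooth_on S g \<Longrightarrow> smooth_on S (\<lambda>x. f x + g x)"
  by (simp add: smooth_on_def Ck_add)
lemma smooth_minus: "open S \<Longrightarrow> smooth_on S f \<Longrightarrow> smooth_on S (\<lambda>x. - f x)"
  by (rule smooth_bounded_linear[OF bounded_linear_minus[OF bounded_linear_ident]])
lemma smooth_diff: "open S \<Longrightarrow> smooth_on S f \<Longrightarrow> smooth_on S g \<Longrightarrow> smooth_on S (\<lambda>x. f x - g x)"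
  using smooth_add[OF _ _ smooth_minus, of S f g] by simp
lemma smooth_sum: "open S \<Longrightarrow> (\<And>i. i \<in> I \<Longrightarrow> smooth_on S (f i)) \<Longrightarrow> smooth_on S (\<lambda>x. \<Sum>i\<in>I. f i x)"
  by (simp add: smooth_on_def Ck_sum)
lemmas smooth_scaleR = smooth_bilinear[OF bounded_bilinear_scaleR]
lemmas smooth_inner = smooth_bilinear[OF bounded_bilinear_inner]
lemma smooth_mult:
  fixes f g :: "'a::real_normed_vector \<Rightarrow> real"
  shows "open S \<Longrightarrow> smooth_on S f \<Longrightarrow> smooth_on S g \<Longrightarrow> smooth_on S (\<lambda>x. f x * g x)"
  by (rule smooth_bilinear[OF bounded_bilinear_mult])
lemma smooth_compose:
  fixes f :: "'b::euclidean_space \<Rightarrow> 'c::real_normed_vector"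
  shows "open S \<Longrightarrow> smooth_on S g \<Longrightarrow> smooth_on T f \<Longrightarrow> (\<And>x. x \<in> S \<Longrightarrow> g x \<in> T) \<Longrightarrow> smooth_on S (\<lambda>x. f (g x))"
  unfolding smooth_on_def using Ck_compose by blast
lemma smooth_sin: "open S \<Longrightarrow> smooth_on S f \<Longrightarrow> smooth_on S (\<lambda>x. sin (f x :: real))"
  by (rule smooth_compose[where T=UNIV]) (auto simp: smooth_on_def Ck_sin_cos)
lemma smooth_cos: "open S \<Longrightarrow> smooth_on S f \<Longrightarrow> smooth_on S (\<lambda>x. cos (f x :: real))"
  by (rule smooth_compose[where T=UNIV]) (auto simp: smooth_on_def Ck_sin_cos)
lemma smooth_arctan: "open S \<Longrightarrow> smooth_on S f \<Longrightarrow> smooth_on S (\<lambda>x. arctan (f x :: real))"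
  by (rule smooth_compose[where T=UNIV]) (auto simp: smooth_on_def Ck_arctan)
lemma smooth_divide:
  fixes f g :: "'a::real_normed_vector \<Rightarrow> real"
  assumes "open S" "smooth_on S f" "smooth_on S g" "\<And>x. x \<in> S \<Longrightarrow> g x \<noteq> 0"
  shows "smooth_on S (\<lambda>x. f x / g x)"
proof -
  have "smooth_on S (\<lambda>x. inverse (g x))"
    by (rule smooth_compose[where T="- {0}"]) (use assms in \<open>auto simp: smooth_on_def Ck_inverse\<close>)
  then show ?thesis unfolding divide_inverse by (intro smooth_mult assms)
qed
lemma smooth_dd: "smooth_on S f \<Longrightarrow> smooth_on S (\<lambda>x. dd f x v)"
  unfolding smooth_on_def using Ck_Suc_derivative(2) by blast
lemma smooth_dd_field:
  fixes f :: "'a::euclidean_space \<Rightarrow> 'b::real_normed_vector"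
  assumes "open S" "smooth_on S f" "smooth_on S X"
  shows "smooth_on S (\<lambda>x. dd f x (X x))"
proof (rule smooth_cong)
  show "smooth_on S (\<lambda>x. \<Sum>b\<in>Basis. (X x \<bullet> b) *\<^sub>R dd f x b)"
    by (intro smooth_sum smooth_scaleR smooth_inner assms smooth_const smooth_dd)
  show "(\<Sum>b\<in>Basis. (X x \<bullet> b) *\<^sub>R dd f x b) = dd f x (X x)" if "x \<in> S" for x
    using dd_euclidean[OF smooth_differentiable[OF assms(2) that], of "X x"] by simp
qed (fact assms)
lemma smooth_blinfun:
  fixes A :: "'x::real_normed_vector \<Rightarrow> ('a::euclidean_space \<Rightarrow>\<^sub>L 'b::real_normed_vector)"
  shows "open S \<Longrightarrow> (\<And>b. b \<in> Basis \<Longrightarrow> smooth_on S (\<lambda>x. A x b)) \<Longrightarrow> smooth_on S A"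
  unfolding smooth_on_def using Ck_blinfun_componentwise by blast
lemma smooth_blinfun_inverse:
  fixes A :: "'x::real_normed_vector \<Rightarrow> ('a::real_normed_vector \<Rightarrow>\<^sub>L 'b::real_normed_vector)"
  shows "open S \<Longrightarrow> (\<And>x. x \<in> S \<Longrightarrow> B x o\<^sub>L A x = id_blinfun) \<Longrightarrow> (\<And>x. x \<in> S \<Longrightarrow> A x o\<^sub>L B x = id_blinfun) \<Longrightarrow>
    smooth_on S A \<Longrightarrow> smooth_on S B"
  unfolding smooth_on_def using Ck_blinfun_inverse by blast

lemmas smooth_intros = smooth_add smooth_diff smooth_minus smooth_sum smooth_scaleR smooth_inner smooth_mult
  smooth_sin smooth_cos smooth_arctan smooth_const smooth_id

text \<open>The derivative of the inverse at \<open>y\<close> is the inverse operator at \<open>g y\<close>; if \<open>g\<close> is \<open>k\<close> times differentiable, then so is that.\<close>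
theorem smooth_inverse_function:
  fixes f :: "'a::euclidean_space \<Rightarrow> 'a"
  assumes U: "open U" "x0 \<in> U" and f: "smooth_on U f" and inj: "inj (dd f x0)"
  obtains U' V g where "open U'" "U' \<subseteq> U" "x0 \<in> U'" "open V" "f x0 \<in> V" "homeomorphism U' V f g"
    "smooth_on V g" "\<And>x. x \<in> U' \<Longrightarrow> bij (dd f x)"
proof -
  define f' where "f' x = Blinfun (dd f x)" for x
  have f': "blinfun_apply (f' x) = dd f x" if "x \<in> U" for x
    unfolding f'_def
    by (rule bounded_linear_Blinfun_apply[OF has_derivative_bounded_linear[OF smooth_has_derivative[OF f that]]])
  have sf': "smooth_on U f'"
    by (rule smooth_blinfun[OF U(1)]) (rule smooth_cong[OF smooth_dd[OF f] U(1)], simp add: f')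
  have lin: "linear (dd f x0)" using smooth_linear_dd[OF f U(2)] .
  obtain h where h: "linear h" "\<And>v. h (dd f x0 v) = v"
    using linear_injective_left_inverse[OF lin inj] by (auto simp: fun_eq_iff)
  have invf: "Blinfun h o\<^sub>L f' x0 = id_blinfun"
    by (rule blinfun_eqI) (simp add: f' U h bounded_linear_Blinfun_apply linear_conv_bounded_linear[symmetric])
  have der: "(f has_derivative blinfun_apply (f' x)) (at x)" if "x \<in> U" for x
    using smooth_has_derivative[OF f that] f'[OF that] by simp
  obtain U' V g g' where *: "open U'" "U' \<subseteq> U" "x0 \<in> U'" "open V" "f x0 \<in> V" "homeomorphism U' V f g"
    "\<And>y. y \<in> V \<Longrightarrow> (g has_derivative (g' y)) (at y)"
    "\<And>y. y \<in> V \<Longrightarrow> g' y = inv (blinfun_apply (f'(g y)))"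
    "\<And>y. y \<in> V \<Longrightarrow> bij (blinfun_apply (f'(g y)))"
    by (rule inverse_function_theorem[OF U(1) der smooth_continuous_on[OF sf'] U(2) invf]) (assumption, rule that)
  have gV: "g y \<in> U'" if "y \<in> V" for y using *(6) that by (auto simp: homeomorphism_def)
  define B where "B y = Blinfun (g' y)" for y
  have B: "blinfun_apply (B y) = g' y" if "y \<in> V" for y
    unfolding B_def using *(7)[OF that] has_derivative_bounded_linear bounded_linear_Blinfun_apply by blast
  have inv: "B y o\<^sub>L f' (g y) = id_blinfun" "f' (g y) o\<^sub>L B y = id_blinfun" if "y \<in> V" for y
  proof -
    have "B y (f' (g y) v) = v" for v
      unfolding B[OF that] *(8)[OF that] by (rule inv_f_f[OF bij_is_inj[OF *(9)[OF that]]])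
    then show "B y o\<^sub>L f' (g y) = id_blinfun" by (intro blinfun_eqI) simp
    have "f' (g y) (B y v) = v" for v
      unfolding B[OF that] *(8)[OF that] by (rule surj_f_inv_f[OF bij_is_surj[OF *(9)[OF that]]])
    then show "f' (g y) o\<^sub>L B y = id_blinfun" by (intro blinfun_eqI) simp
  qed
  have "Ck V g k" for k
  proof (induction k)
    case 0 show ?case using *(6) by (simp add: homeomorphism_def)
  next
    case (Suc k)
    have "Ck V (\<lambda>y. f' (g y)) k"
      by (rule Ck_compose[OF *(4) Suc smooth_onD[OF sf']]) (use gV *(2) in auto)
    then have BC: "Ck V B k" using Ck_blinfun_inverse[OF *(4), of B "\<lambda>y. f' (g y)"] inv by blast
    show ?case
    proof (rule Ck_SucI[OF *(4)])
      show "(g has_derivative blinfun_apply (B y)) (at y)" if "y \<in> V" for y using *(7) B that by simp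
      show "Ck V (\<lambda>y. B y v) k" for v
        by (rule Ck_bounded_linear[OF blinfun.bounded_linear_left *(4) BC])
    qed
  qed
  moreover have "bij (dd f x)" if "x \<in> U'" for x
  proof -
    have "f x \<in> V" "g (f x) = x" using *(6) that by (auto simp: homeomorphism_def)
    then show ?thesis using *(9)[of "f x"] f'[of x] *(2) that by auto
  qed
  ultimately show ?thesis using that[OF *(1-6)] by (simp add: smooth_on_def)
qed

section \<open>Superposition operators on curves\<close>
lemma has_derivative_quadratic:
  assumes "bounded_linear f'" "d > 0" "\<And>y. norm (y - x) < d \<Longrightarrow> norm (f y - f x - f' (y - x)) \<le> C * (norm (y - x))\<^sup>2"
  shows "(f has_derivative f') (at x)"
  unfolding has_derivative_at_alt
proof (intro conjI allI impI assms(1))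
  fix e :: real assume e: "0 < e"
  define d' where "d' = min d (e / (\<bar>C\<bar> + 1))"
  have "d' > 0" using e assms(2) by (simp add: d'_def)
  moreover have "norm (f y - f x - f' (y - x)) \<le> e * norm (y - x)" if y: "norm (y - x) < d'" for y
  proof -
    have "norm (f y - f x - f' (y - x)) \<le> C * norm (y - x) * norm (y - x)"
      using assms(3)[of y] y by (simp add: d'_def power2_eq_square mult.assoc)
    also have "\<dots> \<le> e * norm (y - x)"
    proof (rule mult_right_mono)
      have "C * norm (y - x) \<le> (\<bar>C\<bar> + 1) * norm (y - x)" by (intro mult_right_mono) auto
      also have "\<dots> \<le> (\<bar>C\<bar> + 1) * (e / (\<bar>C\<bar> + 1))" using y by (intro mult_left_mono) (auto simp: d'_def)
      also have "\<dots> = e" by (simp add: add_nonneg_eq_0_iff)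
      finally show "C * norm (y - x) \<le> e" .
    qed simp
    finally show ?thesis .
  qed
  ultimately show "\<exists>d>0. \<forall>y. norm (y - x) < d \<longrightarrow> norm (f y - f x - f' (y - x)) \<le> e * norm (y - x)" by blast
qed

lemma smooth_compact_bounds:
  fixes g :: "'e::euclidean_space \<Rightarrow> 'f::real_normed_vector"
  assumes "open S" "smooth_on S g" "compact K" "K \<subseteq> S"
  obtains C where "C \<ge> 0" "\<And>x. x \<in> K \<Longrightarrow> norm (g x) \<le> C" "\<And>x. x \<in> K \<Longrightarrow> onorm (dd g x) \<le> C"
proof -
  have b: "\<exists>C. \<forall>x\<in>K. norm (h x) \<le> C" if "smooth_on S h" for h :: "'e \<Rightarrow> 'f"
  proof -
    have "compact (h ` K)"
      by (intro compact_continuous_image assms continuous_on_subset[OF smooth_continuous_on[OF that]])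
    then show ?thesis using compact_imp_bounded bounded_iff by (metis imageI)
  qed
  obtain C0 where C0: "\<And>x. x \<in> K \<Longrightarrow> norm (g x) \<le> C0" using b[OF assms(2)] by blast
  obtain C1 where C1: "\<And>b x. x \<in> K \<Longrightarrow> norm (dd g x b) \<le> C1 b" using b[OF smooth_dd[OF assms(2)]] by metis
  have "onorm (dd g x) \<le> (\<Sum>b\<in>Basis. C1 b)" if "x \<in> K" for x
  proof -
    have "onorm (dd g x) \<le> (\<Sum>b\<in>Basis. norm (dd g x b))"
      by (intro onorm_componentwise has_derivative_bounded_linear[OF smooth_has_derivative[OF assms(2)]]) (use assms that in auto)
    also have "\<dots> \<le> (\<Sum>b\<in>Basis. C1 b)" by (intro sum_mono C1 that)
    finally show ?thesis .
  qed
  with C0 show ?thesis using that[of "max 0 (max C0 (\<Sum>b\<in>Basis. C1 b))"] by (simp add: le_max_iff_disj)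
qed

lemma smooth_lipschitz:
  fixes g :: "'e::euclidean_space \<Rightarrow> 'f::real_normed_vector"
  assumes "open S" "smooth_on S g" "convex K" "K \<subseteq> S" "\<And>x. x \<in> K \<Longrightarrow> onorm (dd g x) \<le> C" "x \<in> K" "y \<in> K"
  shows "norm (g y - g x) \<le> C * norm (y - x)"
  by (rule differentiable_bound[of K g "\<lambda>x. dd g x"])
    (use assms in \<open>auto intro: has_derivative_at_withinI smooth_has_derivative\<close>)

text \<open>The first Taylor remainder is quadratic, uniformly on compact convex sets.\<close>
lemma smooth_quadratic:
  fixes g :: "'e::euclidean_space \<Rightarrow> 'f::real_normed_vector"
  assumes S: "open S" and g: "smooth_on S g" and K: "compact K" "convex K" "K \<subseteq> S"
  obtains C where "C \<ge> 0" "\<And>x y. x \<in> K \<Longrightarrow> y \<in> K \<Longrightarrow> norm (g y - g x - dd g x (y - x)) \<le> C * (norm (y - x))\<^sup>2"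
proof -
  have "\<exists>C. C \<ge> 0 \<and> (\<forall>x\<in>K. onorm (dd (\<lambda>x. dd g x b) x) \<le> C)" for b
    using smooth_compact_bounds[OF S smooth_dd[OF g] K(1,3)] by metis
  then obtain C where C: "\<And>b. C b \<ge> 0" "\<And>b x. x \<in> K \<Longrightarrow> onorm (dd (\<lambda>x. dd g x b) x) \<le> C b" by metis
  let ?C = "\<Sum>b\<in>Basis. C b"
  have "norm (g y - g x - dd g x (y - x)) \<le> ?C * (norm (y - x))\<^sup>2" if xy: "x \<in> K" "y \<in> K" for x y
  proof -
    have seg: "closed_segment x y \<subseteq> K" using K xy by (simp add: closed_segment_subset)
    have bl: "bounded_linear (dd g z)" if "z \<in> K" for z
      using has_derivative_bounded_linear smooth_has_derivative[OF g] K that by blast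
    have "norm (g y - g x - dd g x (y - x)) \<le> norm (y - x) * (?C * norm (y - x))"
    proof (rule differentiable_bound_linearization[where S = "closed_segment x y" and f' = "\<lambda>x. dd g x" and ?x0.0 = x])
      show "x + t *\<^sub>R (y - x) \<in> closed_segment x y" if "t \<in> {0..1}" for t
        using that by (auto simp: in_segment algebra_simps intro!: exI[of _ t])
      show "(g has_derivative dd g z) (at z within closed_segment x y)" if "z \<in> closed_segment x y" for z
        using that seg K smooth_has_derivative[OF g] has_derivative_at_withinI by blast
      show "onorm (dd g z - dd g x) \<le> ?C * norm (y - x)" if z: "z \<in> closed_segment x y" for z
      proof -
        have zK: "z \<in> K" using z seg by blast
        have "bounded_linear (\<lambda>v. dd g z v - dd g x v)" by (intro bounded_linear_sub bl zK xy)
        then have "onorm (\<lambda>v. dd g z v - dd g x v) \<le> (\<Sum>b\<in>Basis. norm (dd g z b - dd g x b))"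
          by (rule onorm_componentwise)
        also have "\<dots> \<le> (\<Sum>b\<in>Basis. C b * norm (y - x))"
        proof (rule sum_mono)
          fix b
          have "norm (dd g z b - dd g x b) \<le> C b * norm (z - x)"
            by (rule smooth_lipschitz[OF S smooth_dd[OF g] K(2,3) C(2) xy(1) zK])
          also have "\<dots> \<le> C b * norm (y - x)"
            using C(1) segment_bound1[OF z] by (intro mult_left_mono) auto
          finally show "norm (dd g z b - dd g x b) \<le> C b * norm (y - x)" .
        qed
        finally show ?thesis by (simp add: sum_distrib_right fun_diff_def)
      qed
    qed auto
    then show ?thesis by (simp add: power2_eq_square algebra_simps)
  qed
  then show ?thesis using that[of ?C] C(1) by (simp add: sum_nonneg)
qed

text \<open>The pointwise product of two curves; it inherits bilinearity and boundedness from \<open>p\<close>.\<close>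
definition bc_map2 ::
  "('a::real_normed_vector \<Rightarrow> 'b::real_normed_vector \<Rightarrow> 'c::real_normed_vector) \<Rightarrow> (real \<Rightarrow>\<^sub>C 'a) \<Rightarrow> (real \<Rightarrow>\<^sub>C 'b) \<Rightarrow> (real \<Rightarrow>\<^sub>C 'c)"
  where "bc_map2 p f g = Bcontfun (\<lambda>t. p (apply_bcontfun f t) (apply_bcontfun g t))"

lemma bc_map2_apply:
  assumes "bounded_bilinear p"
  shows "apply_bcontfun (bc_map2 p f g) t = p (apply_bcontfun f t) (apply_bcontfun g t)"
proof -
  obtain K where K: "\<And>a b. norm (p a b) \<le> norm a * norm b * K" "K \<ge> 0"
    using bounded_bilinear.nonneg_bounded[OF assms] by blast
  have "(\<lambda>t. p (apply_bcontfun f t) (apply_bcontfun g t)) \<in> bcontfun"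
  proof (rule bcontfun_normI)
    show "norm (p (apply_bcontfun f t) (apply_bcontfun g t)) \<le> norm f * norm g * K" for t
      by (rule order_trans[OF K(1)]) (intro mult_right_mono mult_mono norm_bounded norm_ge_zero K(2))
  qed (intro bounded_bilinear.continuous_on[OF assms] continuous_on_apply_bcontfun)
  then show ?thesis by (simp add: bc_map2_def Bcontfun_inverse)
qed

lemma bounded_bilinear_bc_map2:
  assumes "bounded_bilinear p" shows "bounded_bilinear (bc_map2 p)"
proof -
  obtain K where K: "\<And>a b. norm (p a b) \<le> norm a * norm b * K" "K \<ge> 0"
    using bounded_bilinear.nonneg_bounded[OF assms] by blast
  interpret p: bounded_bilinear p by fact
  show ?thesis
  proof
    show "\<exists>K. \<forall>a b. norm (bc_map2 p a b) \<le> norm a * norm b * K"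
    proof (intro exI[of _ K] allI norm_bound)
      show "norm (apply_bcontfun (bc_map2 p f g) t) \<le> norm f * norm g * K" for f g t
        unfolding bc_map2_apply[OF assms]
        by (rule order_trans[OF K(1)]) (intro mult_right_mono mult_mono norm_bounded norm_ge_zero K(2))
    qed
  qed (auto intro!: bcontfun_eqI simp: bc_map2_apply[OF assms] p.add_left p.add_right p.scaleR_left p.scaleR_right)
qed

definition unit_clamp :: "real \<Rightarrow> real" where "unit_clamp t = max 0 (min 1 t)"

lemma unit_clamp: "0 \<le> unit_clamp t" "unit_clamp t \<le> 1" "t \<in> {0..1} \<Longrightarrow> unit_clamp t = t"
  "unit_clamp (unit_clamp t) = unit_clamp t"
  by (auto simp: unit_clamp_def)

text \<open>
  Curves live on the whole line, where bounded continuous functions form a Banach space, but only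
  their values on the unit interval matter; the upper limit is clamped to it.
\<close>
definition antiderivative :: "(real \<Rightarrow>\<^sub>C 'e::euclidean_space) \<Rightarrow> (real \<Rightarrow>\<^sub>C 'e)" where
  "antiderivative f = Bcontfun (\<lambda>t. integral {0..unit_clamp t} (apply_bcontfun f))"

lemma bcontfun_integrable: "apply_bcontfun (f :: real \<Rightarrow>\<^sub>C 'e::euclidean_space) integrable_on {a..b}"
  by (intro integrable_continuous_interval continuous_on_apply_bcontfun)

lemma norm_integral_bcontfun:
  fixes f :: "real \<Rightarrow>\<^sub>C 'e::euclidean_space"
  shows "norm (integral {0..unit_clamp t} (apply_bcontfun f)) \<le> norm f"
proof -
  have "norm (integral {0..unit_clamp t} (apply_bcontfun f)) \<le> norm f * (unit_clamp t - 0)"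
    by (rule integral_bound) (auto simp: unit_clamp norm_bounded)
  also have "\<dots> \<le> norm f" using unit_clamp[of t] by (simp add: mult_left_le)
  finally show ?thesis .
qed

lemma antiderivative_apply:
  fixes f :: "real \<Rightarrow>\<^sub>C 'e::euclidean_space"
  shows "apply_bcontfun (antiderivative f) t = integral {0..unit_clamp t} (apply_bcontfun f)"
proof -
  have "(\<lambda>t. integral {0..unit_clamp t} (apply_bcontfun f)) \<in> bcontfun"
  proof (rule bcontfun_normI[OF _ norm_integral_bcontfun])
    have "continuous_on {0..1} (\<lambda>x. integral {0..x} (apply_bcontfun f))"
      by (rule indefinite_integral_continuous_1[OF bcontfun_integrable])
    moreover have "continuous_on UNIV unit_clamp" unfolding unit_clamp_def by (intro continuous_intros)
    ultimately show "continuous_on UNIV (\<lambda>t. integral {0..unit_clamp t} (apply_bcontfun f))"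
      by (rule continuous_on_compose2) (auto simp: unit_clamp)
  qed
  then show ?thesis by (simp add: antiderivative_def Bcontfun_inverse)
qed

lemma bounded_linear_antiderivative: "bounded_linear (antiderivative :: (real \<Rightarrow>\<^sub>C 'e::euclidean_space) \<Rightarrow> _)"
proof (rule bounded_linear_intro[where K = 1])
  show "antiderivative (f + g) = antiderivative f + antiderivative g" for f g :: "real \<Rightarrow>\<^sub>C 'e"
    by (intro bcontfun_eqI) (simp add: antiderivative_apply integral_add[OF bcontfun_integrable bcontfun_integrable, symmetric])
  show "antiderivative (c *\<^sub>R f) = c *\<^sub>R antiderivative f" for c and f :: "real \<Rightarrow>\<^sub>C 'e"
    by (intro bcontfun_eqI) (simp add: antiderivative_apply)
  show "norm (antiderivative f) \<le> norm f * 1" for f :: "real \<Rightarrow>\<^sub>C 'e"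
    by (intro norm_bound) (simp add: antiderivative_apply norm_integral_bcontfun)
qed

lemma norm_antiderivative_le: "norm (antiderivative f) \<le> norm f"
  by (intro norm_bound) (simp add: antiderivative_apply norm_integral_bcontfun)

lemma bounded_linear_const_bcontfun:
  "bounded_linear (const_bcontfun :: 'e::euclidean_space \<Rightarrow> (real \<Rightarrow>\<^sub>C 'e))"
  by (rule bounded_linear_intro[where K = 1])
    (auto intro!: bcontfun_eqI norm_bound simp: const_bcontfun.rep_eq)

lemma bounded_linear_eval_bcontfun: "bounded_linear (\<lambda>f :: real \<Rightarrow>\<^sub>C 'e::euclidean_space. apply_bcontfun f t)"
  by (rule bounded_linear_intro[where K = 1]) (auto simp: norm_bounded)

definition superpose :: "('e::euclidean_space \<Rightarrow> 'f::euclidean_space) \<Rightarrow> (real \<Rightarrow>\<^sub>C 'e) \<Rightarrow> (real \<Rightarrow>\<^sub>C 'f)" where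
  "superpose g f = Bcontfun (\<lambda>t. g (apply_bcontfun f t))"

lemma cball_bcontfunD: "f \<in> cball (const_bcontfun x) r \<Longrightarrow> apply_bcontfun f t \<in> cball x r"
  using dist_bounded[of "const_bcontfun x" t f] by (simp add: const_bcontfun.rep_eq)

lemma superpose_apply:
  fixes g :: "'e::euclidean_space \<Rightarrow> 'f::euclidean_space"
  assumes g: "continuous_on (cball x r) g" and f: "f \<in> cball (const_bcontfun x) r"
  shows "apply_bcontfun (superpose g f) t = g (apply_bcontfun f t)"
proof -
  have "bounded (g ` cball x r)"
    by (intro compact_imp_bounded compact_continuous_image g compact_cball)
  then obtain C where C: "\<And>y. y \<in> cball x r \<Longrightarrow> norm (g y) \<le> C" by (metis bounded_iff imageI)
  have "(\<lambda>t. g (apply_bcontfun f t)) \<in> bcontfun"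
    by (rule bcontfun_normI[where b = C])
      (use cball_bcontfunD[OF f] C in \<open>auto intro!: continuous_on_compose2[OF g]\<close>)
  then show ?thesis by (simp add: superpose_def Bcontfun_inverse)
qed

lemma bounded_bilinear_coord: "bounded_bilinear (\<lambda>(x::'e::euclidean_space) (y::'f::euclidean_space). (x \<bullet> b) *\<^sub>R y)"
proof -
  have "bounded_linear (\<lambda>x. x \<bullet> b)" by (rule bounded_linear_inner_left)
  then show ?thesis
    using bounded_bilinear.comp1[OF bounded_bilinear_scaleR] by blast
qed

abbreviation coord_mult :: "'e::euclidean_space \<Rightarrow> (real \<Rightarrow>\<^sub>C 'e) \<Rightarrow> (real \<Rightarrow>\<^sub>C 'f::euclidean_space) \<Rightarrow> (real \<Rightarrow>\<^sub>C 'f)" where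
  "coord_mult b \<equiv> bc_map2 (\<lambda>x y. (x \<bullet> b) *\<^sub>R y)"

lemmas coord_mult_apply = bc_map2_apply[OF bounded_bilinear_coord]
lemmas bounded_bilinear_coord_mult = bounded_bilinear_bc_map2[OF bounded_bilinear_coord]

lemma sum_bcontfun_apply:
  "apply_bcontfun (\<Sum>i\<in>I. f i) t = (\<Sum>i\<in>I. apply_bcontfun (f i :: real \<Rightarrow>\<^sub>C 'e::euclidean_space) t)"
  by (induction I rule: infinite_finite_induct) auto

lemma superpose_derivative_apply:
  fixes g :: "'e::euclidean_space \<Rightarrow> 'f::euclidean_space"
  assumes S: "open S" "cball x r \<subseteq> S" and g: "smooth_on S g" and f: "f \<in> cball (const_bcontfun x) r"
  shows "apply_bcontfun (\<Sum>b\<in>Basis. coord_mult b h (superpose (\<lambda>x. dd g x b) f)) t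
    = dd g (apply_bcontfun f t) (apply_bcontfun h t)"
proof -
  have c: "continuous_on (cball x r) (\<lambda>x. dd g x b)" for b
    using continuous_on_subset[OF smooth_continuous_on[OF smooth_dd[OF g]] S(2)] .
  have "g differentiable at (apply_bcontfun f t)"
    using smooth_differentiable[OF g] cball_bcontfunD[OF f] S(2) by blast
  from dd_euclidean[OF this, of "apply_bcontfun h t"] show ?thesis
    by (simp add: sum_bcontfun_apply coord_mult_apply superpose_apply[OF c f])
qed

text \<open>
  The superposition operator \<open>f \<mapsto> g \<circ> f\<close> is differentiable for the uniform norm, because the remainder
  bound for \<open>g\<close> is uniform on the ball in which the curves lie.
\<close>
lemma superpose_quadratic:
  fixes g :: "'e::euclidean_space \<Rightarrow> 'f::euclidean_space"
  assumes S: "open S" "cball x r \<subseteq> S" and g: "smooth_on S g"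
  obtains C where "C \<ge> 0" "\<And>f f'. f \<in> cball (const_bcontfun x) r \<Longrightarrow> f' \<in> cball (const_bcontfun x) r \<Longrightarrow>
    norm (superpose g f' - superpose g f - (\<Sum>b\<in>Basis. coord_mult b (f' - f) (superpose (\<lambda>x. dd g x b) f))) \<le> C * (norm (f' - f))\<^sup>2"
proof -
  have c: "continuous_on (cball x r) g"
    using continuous_on_subset[OF smooth_continuous_on[OF g] S(2)] .
  obtain C where C: "C \<ge> 0" "\<And>y z. y \<in> cball x r \<Longrightarrow> z \<in> cball x r \<Longrightarrow> norm (g z - g y - dd g y (z - y)) \<le> C * (norm (z - y))\<^sup>2"
    using smooth_quadratic[OF S(1) g compact_cball convex_cball S(2)] by blast
  have "norm (superpose g f' - superpose g f - (\<Sum>b\<in>Basis. coord_mult b (f' - f) (superpose (\<lambda>x. dd g x b) f))) \<le> C * (norm (f' - f))\<^sup>2"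
    if f: "f \<in> cball (const_bcontfun x) r" "f' \<in> cball (const_bcontfun x) r" for f f'
  proof (rule norm_bound)
    fix t
    have "norm (apply_bcontfun f' t - apply_bcontfun f t) \<le> norm (f' - f)" using norm_bounded[of "f' - f" t] by simp
    then have "C * (norm (apply_bcontfun f' t - apply_bcontfun f t))\<^sup>2 \<le> C * (norm (f' - f))\<^sup>2"
      using C(1) by (intro mult_left_mono power_mono) auto
    with C(2)[OF cball_bcontfunD[OF f(1), of t] cball_bcontfunD[OF f(2), of t]]
    show "norm (apply_bcontfun (superpose g f' - superpose g f - (\<Sum>b\<in>Basis. coord_mult b (f' - f) (superpose (\<lambda>x. dd g x b) f))) t) \<le> C * (norm (f' - f))\<^sup>2"
      by (simp add: superpose_derivative_apply[OF S g f(1)] superpose_apply[OF c f(1)] superpose_apply[OF c f(2)])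
  qed
  with C(1) show ?thesis using that by blast
qed

lemma superpose_has_derivative:
  fixes g :: "'e::euclidean_space \<Rightarrow> 'f::euclidean_space"
  assumes S: "open S" "cball x r \<subseteq> S" and g: "smooth_on S g" and f: "f \<in> ball (const_bcontfun x) r"
  shows "(superpose g has_derivative (\<lambda>h. \<Sum>b\<in>Basis. coord_mult b h (superpose (\<lambda>x. dd g x b) f))) (at f)"
proof -
  obtain C where C: "\<And>f f'. f \<in> cball (const_bcontfun x) r \<Longrightarrow> f' \<in> cball (const_bcontfun x) r \<Longrightarrow>
    norm (superpose g f' - superpose g f - (\<Sum>b\<in>Basis. coord_mult b (f' - f) (superpose (\<lambda>x. dd g x b) f))) \<le> C * (norm (f' - f))\<^sup>2"
    using superpose_quadratic[OF S g] by blast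
  obtain d where d: "d > 0" "ball f d \<subseteq> ball (const_bcontfun x) r" using f open_contains_ball open_ball by blast
  show ?thesis
  proof (rule has_derivative_quadratic[OF _ d(1), where C = C])
    show "bounded_linear (\<lambda>h. \<Sum>b\<in>Basis. coord_mult b h (superpose (\<lambda>x. dd g x b) f))"
      by (intro bounded_linear_sum bounded_bilinear.bounded_linear_left[OF bounded_bilinear_coord_mult])
    fix f' assume "norm (f' - f) < d"
    then have "f' \<in> ball f d" by (simp add: dist_norm norm_minus_commute)
    then have "f' \<in> cball (const_bcontfun x) r" "f \<in> cball (const_bcontfun x) r" using d f by auto
    then show "norm (superpose g f' - superpose g f - (\<Sum>b\<in>Basis. coord_mult b (f' - f) (superpose (\<lambda>x. dd g x b) f))) \<le> C * (norm (f' - f))\<^sup>2"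
      using C by blast
  qed
qed

text \<open>
  The derivative of \<open>w \<mapsto> g \<circ> \<phi> w\<close> consists of products of the derivative of \<open>\<phi>\<close> with superpositions of the
  partial derivatives of \<open>g\<close>, so the induction runs over all \<open>g\<close> at once.
\<close>
lemma Ck_superpose:
  fixes g :: "'e::euclidean_space \<Rightarrow> 'f::euclidean_space" and \<phi> :: "'w::real_normed_vector \<Rightarrow> _"
  assumes S: "open S" "cball x r \<subseteq> S" and W: "open W" and \<phi>: "\<And>w. w \<in> W \<Longrightarrow> \<phi> w \<in> ball (const_bcontfun x) r"
    and "Ck W \<phi> k" "smooth_on S g"
  shows "Ck W (\<lambda>w. superpose g (\<phi> w)) k"
  using assms(5,6)
proof (induction k arbitrary: g)
  case 0
  have "isCont (superpose g) (\<phi> w)" if "w \<in> W" for w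
    using has_derivative_continuous[OF superpose_has_derivative[OF S 0(2) \<phi>[OF that]]] .
  then have "continuous_on (\<phi> ` W) (superpose g)" by (auto intro: continuous_at_imp_continuous_on)
  then show ?case using 0 by (auto intro: continuous_on_compose2)
next
  case (Suc k)
  show ?case
  proof (rule Ck_SucI[OF W])
    show "((\<lambda>w. superpose g (\<phi> w)) has_derivative (\<lambda>v. \<Sum>b\<in>Basis. coord_mult b (dd \<phi> w v) (superpose (\<lambda>x. dd g x b) (\<phi> w)))) (at w)"
      if "w \<in> W" for w
      by (rule has_derivative_compose[OF Ck_Suc_derivative(1)[OF Suc.prems(1) that] superpose_has_derivative[OF S Suc.prems(2) \<phi>[OF that]]])
    show "Ck W (\<lambda>w. \<Sum>b\<in>Basis. coord_mult b (dd \<phi> w v) (superpose (\<lambda>x. dd g x b) (\<phi> w))) k" for v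
      by (intro Ck_sum W Ck_bilinear[OF bounded_bilinear_coord_mult] Ck_Suc_derivative(2)[OF Suc.prems(1)] Suc.IH
          Ck_Suc_le[OF Suc.prems(1)] smooth_dd Suc.prems)
  qed
qed

text \<open>
  The equation \<open>x = y + K x\<close> has a unique solution by contraction; this defines the inverse of \<open>1 - K\<close>.
\<close>
lemma neumann_inverse:
  fixes K :: "'a::{real_normed_vector, complete_space} \<Rightarrow>\<^sub>L 'a"
  assumes K: "\<And>x. norm (K x) \<le> 1/2 * norm x"
  obtains R where "R o\<^sub>L (id_blinfun - K) = id_blinfun" "(id_blinfun - K) o\<^sub>L R = id_blinfun" "\<And>y. norm (blinfun_apply R y) \<le> 2 * norm y"
proof -
  have "\<exists>!x. y + K x = x" for y
  proof (rule banach_fix_type[of "1/2"])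
    show "\<forall>x z. dist (y + K x) (y + K z) \<le> 1/2 * dist x z"
      using K by (auto simp: dist_norm blinfun.diff_right[symmetric])
  qed auto
  then obtain R where R: "\<And>y. y + K (R y) = R y" "\<And>x y. y + K x = x \<Longrightarrow> x = R y" by metis
  have b: "norm (R y) \<le> 2 * norm y" for y
    using norm_triangle_ineq[of y "K (R y)"] K[of "R y"] R(1)[of y] by (simp; linarith)
  have "bounded_linear R"
  proof (rule bounded_linear_intro[where K = 2])
    show "R (y + z) = R y + R z" for y z
      by (rule R(2)[symmetric]) (metis R(1) blinfun.add_right add.assoc add.left_commute)
    show "R (c *\<^sub>R y) = c *\<^sub>R R y" for c y
      by (rule R(2)[symmetric]) (metis R(1) blinfun.scaleR_right scaleR_add_right)
  qed (use b in \<open>auto simp: mult.commute\<close>)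
  then have B: "blinfun_apply (Blinfun R) = R" by (rule bounded_linear_Blinfun_apply)
  show ?thesis
  proof (rule that[of "Blinfun R"])
    show "Blinfun R o\<^sub>L (id_blinfun - K) = id_blinfun"
      by (rule blinfun_eqI) (simp add: B blinfun.diff_left R(2)[symmetric])
    show "(id_blinfun - K) o\<^sub>L Blinfun R = id_blinfun"
      by (rule blinfun_eqI) (metis B R(1) add_diff_cancel_right' blinfun.diff_left blinfun_apply_blinfun_compose blinfun_apply_id_blinfun)
    show "norm (Blinfun R y) \<le> 2 * norm y" for y using B b by simp
  qed
qed

section \<open>Smooth dependence of flows on parameters\<close>

text \<open>
  The control system \<open>c' = (\<Sum>j. (w \<bullet> j) B j c)\<close> with \<open>c 0 = x0 + l w\<close>, where the constant control \<open>w\<close> also moves the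
  initial point. For small \<open>w\<close> its solution exists on the unit interval and stays in the ball of
  radius \<open>r\<close>.
\<close>
locale control_system =
  fixes S :: "'e::euclidean_space set" and x0 :: 'e and r :: real and B :: "'e \<Rightarrow> 'e \<Rightarrow> 'e" and l :: "'e \<Rightarrow> 'e"
  assumes S: "open S" "cball x0 r \<subseteq> S" and r: "r > 0"
    and smooth_B: "\<And>j. j \<in> Basis \<Longrightarrow> smooth_on S (B j)" and l: "bounded_linear l"
begin

definition field :: "'e \<Rightarrow> 'e \<Rightarrow> 'e" where "field w x = (\<Sum>j\<in>Basis. (w \<bullet> j) *\<^sub>R B j x)"

abbreviation tube where "tube \<equiv> cball (const_bcontfun x0) r :: (real \<Rightarrow>\<^sub>C 'e) set"

definition lin :: "'e \<Rightarrow> (real \<Rightarrow>\<^sub>C 'e) \<Rightarrow> (real \<Rightarrow>\<^sub>C 'e) \<Rightarrow> (real \<Rightarrow>\<^sub>C 'e)" where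
  "lin w \<phi> h = (\<Sum>b\<in>Basis. coord_mult b h (superpose (\<lambda>x. dd (field w) x b) \<phi>))"

lemma smooth_field: "smooth_on S (field w)"
  unfolding field_def by (intro smooth_sum smooth_scaleR smooth_const S smooth_B)

lemma cont_B: "j \<in> Basis \<Longrightarrow> continuous_on (cball x0 r) (B j)"
  using continuous_on_subset[OF smooth_continuous_on[OF smooth_B] S(2)] .

lemma cont_field: "continuous_on (cball x0 r) (field w)"
  using continuous_on_subset[OF smooth_continuous_on[OF smooth_field] S(2)] .

lemma dd_field: "x \<in> S \<Longrightarrow> dd (field w) x v = (\<Sum>j\<in>Basis. (w \<bullet> j) *\<^sub>R dd (B j) x v)"
  unfolding field_def
  by (rule dd_eqI) (intro has_derivative_sum has_derivative_scaleR_right smooth_has_derivative[OF smooth_B])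

lemma superpose_field_apply: "\<phi> \<in> tube \<Longrightarrow> apply_bcontfun (superpose (field w) \<phi>) t = field w (apply_bcontfun \<phi> t)"
  by (rule superpose_apply[OF cont_field])

lemma lin_apply: "\<phi> \<in> tube \<Longrightarrow> apply_bcontfun (lin w \<phi> h) t = dd (field w) (apply_bcontfun \<phi> t) (apply_bcontfun h t)"
  unfolding lin_def by (rule superpose_derivative_apply[OF S smooth_field])

lemma superpose_field:
  assumes "\<phi> \<in> tube"
  shows "superpose (field w) \<phi> = (\<Sum>j\<in>Basis. (w \<bullet> j) *\<^sub>R superpose (B j) \<phi>)"
  by (rule bcontfun_eqI)
    (simp add: superpose_field_apply[OF assms] sum_bcontfun_apply superpose_apply[OF cont_B assms] field_def)

lemma lin_sum:
  assumes "\<phi> \<in> tube"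
  shows "lin w \<phi> h = (\<Sum>j\<in>Basis. \<Sum>b\<in>Basis. (w \<bullet> j) *\<^sub>R coord_mult b h (superpose (\<lambda>x. dd (B j) x b) \<phi>))"
proof (rule bcontfun_eqI)
  fix t
  have x: "apply_bcontfun \<phi> t \<in> S" using cball_bcontfunD[OF assms] S by blast
  show "apply_bcontfun (lin w \<phi> h) t = apply_bcontfun (\<Sum>j\<in>Basis. \<Sum>b\<in>Basis. (w \<bullet> j) *\<^sub>R coord_mult b h (superpose (\<lambda>x. dd (B j) x b) \<phi>)) t"
    using superpose_derivative_apply[OF S smooth_B assms, of _ h t]
    by (simp add: lin_apply[OF assms] dd_field[OF x] sum_bcontfun_apply scaleR_sum_right[symmetric])
qed

lemma field_add: "field (v + w) x = field v x + field w x"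
  by (simp add: field_def inner_add_left scaleR_add_left sum.distrib)

lemma sum_coord_bound:
  assumes "\<And>j. j \<in> Basis \<Longrightarrow> norm (a j) \<le> c j" "\<And>j. j \<in> Basis \<Longrightarrow> 0 \<le> c j"
  shows "norm (\<Sum>j\<in>Basis. (w \<bullet> j) *\<^sub>R a j :: 'f::real_normed_vector) \<le> (\<Sum>j\<in>Basis. c j) * norm (w::'e)"
proof -
  have "norm (\<Sum>j\<in>Basis. (w \<bullet> j) *\<^sub>R a j) \<le> (\<Sum>j\<in>Basis. norm ((w \<bullet> j) *\<^sub>R a j))" by (rule norm_sum)
  also have "\<dots> \<le> (\<Sum>j\<in>Basis. norm w * c j)"
    by (intro sum_mono) (auto intro!: mult_mono assms Basis_le_norm)
  finally show ?thesis by (simp add: sum_distrib_left mult.commute)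
qed

text \<open>
  One constant serves for the size, the linearization, the Lipschitz bound and the quadratic remainder,
  each with the factor \<open>norm w\<close>; this factor is what makes the Picard operator a contraction for small \<open>w\<close>.
\<close>
lemma bounds:
  obtains C where "C \<ge> 0"
    "\<And>w \<phi>. \<phi> \<in> tube \<Longrightarrow> norm (superpose (field w) \<phi>) \<le> C * norm w"
    "\<And>w \<phi> h. \<phi> \<in> tube \<Longrightarrow> norm (lin w \<phi> h) \<le> C * norm w * norm h"
    "\<And>w \<phi> \<phi>'. \<phi> \<in> tube \<Longrightarrow> \<phi>' \<in> tube \<Longrightarrow> norm (superpose (field w) \<phi>' - superpose (field w) \<phi>) \<le> C * norm w * norm (\<phi>' - \<phi>)"
    "\<And>w \<phi> \<phi>'. \<phi> \<in> tube \<Longrightarrow> \<phi>' \<in> tube \<Longrightarrow> norm (superpose (field w) \<phi>' - superpose (field w) \<phi> - lin w \<phi> (\<phi>' - \<phi>)) \<le> C * norm w * (norm (\<phi>' - \<phi>))\<^sup>2"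
proof -
  have "\<forall>j\<in>Basis. \<exists>C. C \<ge> 0 \<and> (\<forall>x\<in>cball x0 r. norm (B j x) \<le> C) \<and> (\<forall>x\<in>cball x0 r. onorm (dd (B j) x) \<le> C)"
  proof
    fix j :: 'e assume j: "j \<in> Basis"
    obtain C where "C \<ge> 0" "\<And>x. x \<in> cball x0 r \<Longrightarrow> norm (B j x) \<le> C" "\<And>x. x \<in> cball x0 r \<Longrightarrow> onorm (dd (B j) x) \<le> C"
      by (rule smooth_compact_bounds[OF S(1) smooth_B[OF j] compact_cball S(2)]) (rule that)
    then show "\<exists>C. C \<ge> 0 \<and> (\<forall>x\<in>cball x0 r. norm (B j x) \<le> C) \<and> (\<forall>x\<in>cball x0 r. onorm (dd (B j) x) \<le> C)"
      by (intro exI[of _ C]) simp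
  qed
  from bchoice[OF this] obtain C1 where C1': "\<forall>j\<in>Basis. C1 j \<ge> 0 \<and> (\<forall>x\<in>cball x0 r. norm (B j x) \<le> C1 j) \<and> (\<forall>x\<in>cball x0 r. onorm (dd (B j) x) \<le> C1 j)" ..
  then have C1: "\<And>j. j \<in> Basis \<Longrightarrow> C1 j \<ge> 0"
    "\<And>j x. j \<in> Basis \<Longrightarrow> x \<in> cball x0 r \<Longrightarrow> norm (B j x) \<le> C1 j"
    "\<And>j x. j \<in> Basis \<Longrightarrow> x \<in> cball x0 r \<Longrightarrow> onorm (dd (B j) x) \<le> C1 j" by simp_all
  let ?lin = "\<lambda>j f h. \<Sum>b\<in>Basis. coord_mult b h (superpose (\<lambda>x. dd (B j) x b) f)"
  have "\<forall>j\<in>Basis. \<exists>C. C \<ge> 0 \<and> (\<forall>f\<in>tube. \<forall>f'\<in>tube. norm (superpose (B j) f' - superpose (B j) f - ?lin j f (f' - f)) \<le> C * (norm (f' - f))\<^sup>2)"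
  proof
    fix j :: 'e assume j: "j \<in> Basis"
    obtain C where "C \<ge> 0" "\<And>f f'. f \<in> tube \<Longrightarrow> f' \<in> tube \<Longrightarrow> norm (superpose (B j) f' - superpose (B j) f - ?lin j f (f' - f)) \<le> C * (norm (f' - f))\<^sup>2"
      by (rule superpose_quadratic[OF S smooth_B[OF j]]) (rule that)
    then show "\<exists>C. C \<ge> 0 \<and> (\<forall>f\<in>tube. \<forall>f'\<in>tube. norm (superpose (B j) f' - superpose (B j) f - ?lin j f (f' - f)) \<le> C * (norm (f' - f))\<^sup>2)"
      by (intro exI[of _ C]) simp
  qed
  from bchoice[OF this] obtain C2 where C2': "\<forall>j\<in>Basis. C2 j \<ge> 0 \<and> (\<forall>f\<in>tube. \<forall>f'\<in>tube. norm (superpose (B j) f' - superpose (B j) f - ?lin j f (f' - f)) \<le> C2 j * (norm (f' - f))\<^sup>2)" ..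
  have C2: "\<And>j. j \<in> Basis \<Longrightarrow> C2 j \<ge> 0"
    "\<And>j f f'. j \<in> Basis \<Longrightarrow> f \<in> tube \<Longrightarrow> f' \<in> tube \<Longrightarrow> norm (superpose (B j) f' - superpose (B j) f - ?lin j f (f' - f)) \<le> C2 j * (norm (f' - f))\<^sup>2"
    using C2' by blast+
  define C where "C = (\<Sum>j\<in>Basis. C1 j) + (\<Sum>j\<in>Basis. C2 j)"
  have le1: "(\<Sum>j\<in>Basis. C1 j) \<le> C" and le2: "(\<Sum>j\<in>Basis. C2 j) \<le> C" and C0: "C \<ge> 0"
    using C1(1) C2(1) by (auto simp: C_def sum_nonneg)
  have b1: "norm (field w x) \<le> C * norm w" if "x \<in> cball x0 r" for w x
    unfolding field_def using C1 le1 that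
    by (intro order_trans[OF sum_coord_bound[of _ C1]] mult_right_mono) auto
  have b2: "norm (dd (field w) x v) \<le> C * norm w * norm v" if x: "x \<in> cball x0 r" for w x v
  proof -
    have xS: "x \<in> S" using x S by blast
    have n: "norm (dd (B j) x v) \<le> C1 j * norm v" if "j \<in> Basis" for j
    proof -
      have "bounded_linear (dd (B j) x)" using has_derivative_bounded_linear[OF smooth_has_derivative[OF smooth_B[OF that] xS]] .
      from onorm[OF this, of v] show ?thesis
        using mult_right_mono[OF C1(3)[OF that x], of "norm v"] by simp
    qed
    have "norm (dd (field w) x v) \<le> (\<Sum>j\<in>Basis. C1 j * norm v) * norm w"
      unfolding dd_field[OF xS] by (rule sum_coord_bound[OF n]) (auto simp: C1)
    also have "\<dots> = (\<Sum>j\<in>Basis. C1 j) * norm w * norm v" by (simp add: sum_distrib_right[symmetric] mult_ac)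
    also have "\<dots> \<le> C * norm w * norm v" by (intro mult_right_mono le1) auto
    finally show ?thesis .
  qed
  show ?thesis
  proof (rule that[OF C0])
    fix w \<phi> \<phi>' h assume t: "\<phi> \<in> tube"
    note c = cball_bcontfunD[OF t]
    show "norm (superpose (field w) \<phi>) \<le> C * norm w"
      by (rule norm_bound) (simp add: superpose_field_apply[OF t] b1[OF c])
    show "norm (lin w \<phi> h) \<le> C * norm w * norm h"
    proof (rule norm_bound)
      fix s
      have "norm (dd (field w) (apply_bcontfun \<phi> s) (apply_bcontfun h s)) \<le> C * norm w * norm (apply_bcontfun h s)"
        by (rule b2[OF c])
      also have "\<dots> \<le> C * norm w * norm h" using C0 by (intro mult_left_mono norm_bounded) auto
      finally show "norm (apply_bcontfun (lin w \<phi> h) s) \<le> C * norm w * norm h" by (simp add: lin_apply[OF t])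
    qed
    assume t': "\<phi>' \<in> tube"
    note c' = cball_bcontfunD[OF t']
    show "norm (superpose (field w) \<phi>' - superpose (field w) \<phi>) \<le> C * norm w * norm (\<phi>' - \<phi>)"
    proof (rule norm_bound)
      fix s
      have "norm (field w (apply_bcontfun \<phi>' s) - field w (apply_bcontfun \<phi> s)) \<le> C * norm w * norm (apply_bcontfun \<phi>' s - apply_bcontfun \<phi> s)"
        by (rule smooth_lipschitz[OF S(1) smooth_field convex_cball S(2) _ c c'])
          (use C0 b2 in \<open>auto intro!: onorm_bound\<close>)
      also have "\<dots> \<le> C * norm w * norm (\<phi>' - \<phi>)" using C0 norm_bounded[of "\<phi>' - \<phi>" s] by (intro mult_left_mono) auto
      finally show "norm (apply_bcontfun (superpose (field w) \<phi>' - superpose (field w) \<phi>) s) \<le> C * norm w * norm (\<phi>' - \<phi>)"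
        by (simp add: superpose_field_apply[OF t] superpose_field_apply[OF t'])
    qed
    have "superpose (field w) \<phi>' - superpose (field w) \<phi> - lin w \<phi> (\<phi>' - \<phi>)
      = (\<Sum>j\<in>Basis. (w \<bullet> j) *\<^sub>R (superpose (B j) \<phi>' - superpose (B j) \<phi> - (\<Sum>b\<in>Basis. coord_mult b (\<phi>' - \<phi>) (superpose (\<lambda>x. dd (B j) x b) \<phi>))))"
      by (simp add: superpose_field[OF t] superpose_field[OF t'] lin_sum[OF t] sum_subtractf scaleR_diff_right scaleR_sum_right)
    also have "norm \<dots> \<le> (\<Sum>j\<in>Basis. C2 j * (norm (\<phi>' - \<phi>))\<^sup>2) * norm w"
      by (rule sum_coord_bound) (use C2 t t' in auto)
    also have "\<dots> = (\<Sum>j\<in>Basis. C2 j) * norm w * (norm (\<phi>' - \<phi>))\<^sup>2" by (simp add: sum_distrib_right[symmetric] mult_ac)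
    also have "\<dots> \<le> C * norm w * (norm (\<phi>' - \<phi>))\<^sup>2" by (intro mult_right_mono le2) auto
    finally show "norm (superpose (field w) \<phi>' - superpose (field w) \<phi> - lin w \<phi> (\<phi>' - \<phi>)) \<le> C * norm w * (norm (\<phi>' - \<phi>))\<^sup>2" .
  qed
qed

definition picard :: "'e \<Rightarrow> (real \<Rightarrow>\<^sub>C 'e) \<Rightarrow> (real \<Rightarrow>\<^sub>C 'e)" where
  "picard w \<phi> = const_bcontfun (x0 + l w) + antiderivative (superpose (field w) \<phi>)"

text \<open>The derivative of the Picard operator in the direction \<open>v\<close> of the parameter, for a fixed curve.\<close>
definition source :: "(real \<Rightarrow>\<^sub>C 'e) \<Rightarrow> 'e \<Rightarrow> (real \<Rightarrow>\<^sub>C 'e)" where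
  "source \<phi> v = const_bcontfun (l v) + antiderivative (superpose (field v) \<phi>)"

lemma source_eq:
  assumes "\<phi> \<in> tube"
  shows "source \<phi> v = const_bcontfun (l v) + (\<Sum>j\<in>Basis. (v \<bullet> j) *\<^sub>R antiderivative (superpose (B j) \<phi>))"
  unfolding source_def superpose_field[OF assms]
  by (simp add: linear_sum[OF bounded_linear.linear[OF bounded_linear_antiderivative]] linear_scale[OF bounded_linear.linear[OF bounded_linear_antiderivative]])

text \<open>
  The solution \<open>\<phi> w\<close> is the fixed point of the Picard operator. Differentiating the fixed point equation
  gives \<open>(1 - K w) (d\<phi> v) = source (\<phi> w) v\<close>, where \<open>K w\<close> is the linearized integral operator, of norm at
  most one half; \<open>R w\<close> denotes the inverse of \<open>1 - K w\<close>. Both \<open>K\<close> and the source are made of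
  superpositions along \<open>\<phi>\<close>, so they are as often differentiable as \<open>\<phi>\<close>, and \<open>\<phi>\<close> gains one derivative.
\<close>
lemma solution_family:
  obtains \<delta> \<phi> R where "\<delta> > 0" "\<And>w. w \<in> ball 0 \<delta> \<Longrightarrow> \<phi> w \<in> ball (const_bcontfun x0) r"
    "\<And>w. w \<in> ball 0 \<delta> \<Longrightarrow> \<phi> w = picard w (\<phi> w)"
    "\<And>w. w \<in> ball 0 \<delta> \<Longrightarrow> (\<phi> has_derivative (\<lambda>v. blinfun_apply (R w) (source (\<phi> w) v))) (at w)"
    "\<And>k. Ck (ball 0 \<delta>) \<phi> k"
    "\<And>w h. w \<in> ball 0 \<delta> \<Longrightarrow> blinfun_apply (R w) (h - antiderivative (lin w (\<phi> w) h)) = h"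
proof -
  obtain C where C: "C \<ge> 0"
    "\<And>w \<phi>. \<phi> \<in> tube \<Longrightarrow> norm (superpose (field w) \<phi>) \<le> C * norm w"
    "\<And>w \<phi> h. \<phi> \<in> tube \<Longrightarrow> norm (lin w \<phi> h) \<le> C * norm w * norm h"
    "\<And>w \<phi> \<phi>'. \<phi> \<in> tube \<Longrightarrow> \<phi>' \<in> tube \<Longrightarrow> norm (superpose (field w) \<phi>' - superpose (field w) \<phi>) \<le> C * norm w * norm (\<phi>' - \<phi>)"
    "\<And>w \<phi> \<phi>'. \<phi> \<in> tube \<Longrightarrow> \<phi>' \<in> tube \<Longrightarrow> norm (superpose (field w) \<phi>' - superpose (field w) \<phi> - lin w \<phi> (\<phi>' - \<phi>)) \<le> C * norm w * (norm (\<phi>' - \<phi>))\<^sup>2"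
    by (rule bounds) (rule that)
  obtain L where L: "L \<ge> 0" "\<And>w. norm (l w) \<le> L * norm w"
    using bounded_linear.nonneg_bounded[OF l] by (metis mult.commute)
  interpret l: bounded_linear l by (rule l)
  have int: "bounded_linear (antiderivative :: (real \<Rightarrow>\<^sub>C 'e) \<Rightarrow> _)" by (rule bounded_linear_antiderivative)
  have intl: "linear (antiderivative :: (real \<Rightarrow>\<^sub>C 'e) \<Rightarrow> _)" using int bounded_linear.linear by blast
  have cl: "linear (const_bcontfun :: 'e \<Rightarrow> (real \<Rightarrow>\<^sub>C 'e))" using bounded_linear_const_bcontfun bounded_linear.linear by blast
  have nc: "norm (const_bcontfun x :: real \<Rightarrow>\<^sub>C 'e) \<le> norm x" for x by (rule norm_bound) (simp add: const_bcontfun.rep_eq)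
  \<comment> \<open>The first bound makes the Picard operator contract by one half, the second keeps its values in the ball of radius \<open>r / 2\<close>.\<close>
  define \<delta> where "\<delta> = min (1 / (2 * (C + 1))) (r / (2 * (L + C + 1)))"
  have \<delta>: "\<delta> > 0" using C(1) L(1) r by (auto simp: \<delta>_def)
  have half: "C * norm w \<le> 1/2" and small: "(L + C) * norm w \<le> r / 2" if "w \<in> ball 0 \<delta>" for w
  proof -
    have n: "norm w \<le> \<delta>" using that by simp
    have "C * norm w \<le> (C + 1) * (1 / (2 * (C + 1)))"
      using n C(1) by (intro mult_mono) (auto simp: \<delta>_def)
    also have "\<dots> = 1/2" using C(1) by (simp add: divide_simps)
    finally show "C * norm w \<le> 1/2" .
    have "(L + C) * norm w \<le> (L + C + 1) * (r / (2 * (L + C + 1)))"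
      using n C(1) L(1) r by (intro mult_mono) (auto simp: \<delta>_def)
    also have "\<dots> = r / 2" using C(1) L(1) by (simp add: divide_simps)
    finally show "(L + C) * norm w \<le> r / 2" .
  qed
  let ?T = "cball (const_bcontfun x0) (r/2) :: (real \<Rightarrow>\<^sub>C 'e) set"
  have T: "?T \<subseteq> tube" "?T \<subseteq> ball (const_bcontfun x0) r" using r by auto
  have "\<exists>!\<phi>. \<phi> \<in> ?T \<and> picard w \<phi> = \<phi>" if w: "w \<in> ball 0 \<delta>" for w
  proof (rule Banach_fix[of ?T "1/2"])
    show "complete ?T" by (simp add: complete_eq_closed)
    show "?T \<noteq> {}" using r by auto
    show "picard w ` ?T \<subseteq> ?T"
    proof safe
      fix \<phi> assume "\<phi> \<in> ?T"
      then have t: "\<phi> \<in> tube" using T by blast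
      have "picard w \<phi> - const_bcontfun x0 = const_bcontfun (l w) + antiderivative (superpose (field w) \<phi>)"
        by (simp add: picard_def linear_add[OF cl])
      then have "norm (picard w \<phi> - const_bcontfun x0) \<le> norm (const_bcontfun (l w) :: real \<Rightarrow>\<^sub>C 'e) + norm (antiderivative (superpose (field w) \<phi>))"
        using norm_triangle_ineq by metis
      also have "\<dots> \<le> L * norm w + C * norm w"
        by (intro add_mono order_trans[OF nc] L order_trans[OF norm_antiderivative_le] C t)
      also have "\<dots> \<le> r / 2" using small[OF w] by (simp add: algebra_simps)
      finally show "picard w \<phi> \<in> ?T" by (simp add: dist_norm norm_minus_commute)
    qed
    show "dist (picard w f) (picard w g) \<le> 1/2 * dist f g" if "f \<in> ?T" "g \<in> ?T" for f g
    proof -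
      have t: "f \<in> tube" "g \<in> tube" using that T by auto
      have "picard w f - picard w g = antiderivative (superpose (field w) f - superpose (field w) g)"
        by (simp add: picard_def linear_diff[OF intl])
      then have "norm (picard w f - picard w g) \<le> C * norm w * norm (f - g)"
        using order_trans[OF norm_antiderivative_le C(4)[OF t(2,1)]] by simp
      also have "\<dots> \<le> 1/2 * norm (f - g)" using half[OF w] by (intro mult_right_mono) auto
      finally show ?thesis by (simp add: dist_norm)
    qed
  qed auto
  then have "\<forall>w\<in>ball 0 \<delta>. \<exists>\<phi>. \<phi> \<in> ?T \<and> picard w \<phi> = \<phi>" by (intro ballI ex1_implies_ex)
  from bchoice[OF this] obtain \<phi> where \<phi>': "\<forall>w\<in>ball 0 \<delta>. \<phi> w \<in> ?T \<and> picard w (\<phi> w) = \<phi> w" ..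
  have \<phi>: "\<And>w. w \<in> ball 0 \<delta> \<Longrightarrow> \<phi> w \<in> ?T" "\<And>w. w \<in> ball 0 \<delta> \<Longrightarrow> picard w (\<phi> w) = \<phi> w"
    using bspec[OF \<phi>'] by simp_all
  have t: "\<phi> w \<in> tube" if "w \<in> ball 0 \<delta>" for w using \<phi>(1)[OF that] T by blast
  have tb: "\<phi> w \<in> ball (const_bcontfun x0) r" if "w \<in> ball 0 \<delta>" for w using \<phi>(1)[OF that] T by blast
  define K where "K w = (\<Sum>j\<in>Basis. \<Sum>b\<in>Basis. (w \<bullet> j) *\<^sub>R
     (Blinfun antiderivative o\<^sub>L bounded_bilinear.prod_left (coord_mult b) (superpose (\<lambda>x. dd (B j) x b) (\<phi> w))))" for w
  have K: "blinfun_apply (K w) h = antiderivative (lin w (\<phi> w) h)" if "w \<in> ball 0 \<delta>" for w h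
    unfolding K_def lin_sum[OF t[OF that]]
    by (simp add: blinfun.sum_left blinfun.scaleR_left bounded_linear_Blinfun_apply[OF int]
        bounded_bilinear.prod_left.rep_eq[OF bounded_bilinear_coord_mult]
        linear_sum[OF intl] linear_scale[OF intl])
  have "\<forall>w\<in>ball 0 \<delta>. \<exists>R. R o\<^sub>L (id_blinfun - K w) = id_blinfun \<and> (id_blinfun - K w) o\<^sub>L R = id_blinfun \<and> (\<forall>y. norm (blinfun_apply R y) \<le> 2 * norm y)"
  proof
    fix w :: 'e assume w: "w \<in> ball 0 \<delta>"
    have "norm (K w h) \<le> 1/2 * norm h" for h
      using order_trans[OF norm_antiderivative_le C(3)[OF t[OF w], of w h]] mult_right_mono[OF half[OF w], of "norm h"]
      by (simp add: K[OF w])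
    note half_K = this
    obtain R where "R o\<^sub>L (id_blinfun - K w) = id_blinfun" "(id_blinfun - K w) o\<^sub>L R = id_blinfun" "\<And>y. norm (blinfun_apply R y) \<le> 2 * norm y"
      by (rule neumann_inverse[of "K w", OF half_K]) (rule that)
    then show "\<exists>R. R o\<^sub>L (id_blinfun - K w) = id_blinfun \<and> (id_blinfun - K w) o\<^sub>L R = id_blinfun \<and> (\<forall>y. norm (blinfun_apply R y) \<le> 2 * norm y)"
      by (intro exI[of _ R]) simp
  qed
  from bchoice[OF this] obtain R where R': "\<forall>w\<in>ball 0 \<delta>. R w o\<^sub>L (id_blinfun - K w) = id_blinfun \<and> (id_blinfun - K w) o\<^sub>L R w = id_blinfun \<and> (\<forall>y. norm (blinfun_apply (R w) y) \<le> 2 * norm y)" ..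
  have R: "\<And>w. w \<in> ball 0 \<delta> \<Longrightarrow> R w o\<^sub>L (id_blinfun - K w) = id_blinfun"
    "\<And>w. w \<in> ball 0 \<delta> \<Longrightarrow> (id_blinfun - K w) o\<^sub>L R w = id_blinfun"
    "\<And>w y. w \<in> ball 0 \<delta> \<Longrightarrow> norm (R w y) \<le> 2 * norm y"
    using bspec[OF R'] by simp_all
  have RK: "R w (h - antiderivative (lin w (\<phi> w) h)) = h" if "w \<in> ball 0 \<delta>" for w h
  proof -
    have "R w ((id_blinfun - K w) h) = h" using R(1)[OF that] by (metis blinfun_apply_blinfun_compose blinfun_apply_id_blinfun)
    then show ?thesis by (simp add: blinfun.diff_left K[OF that])
  qed
  have lin_source: "bounded_linear (source (\<phi> w))" if "w \<in> ball 0 \<delta>" for w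
    unfolding source_eq[OF t[OF that]]
    by (intro bounded_linear_add bounded_linear_sum bounded_linear_compose[OF bounded_linear_const_bcontfun l]
        bounded_linear_scaleR_const bounded_linear_inner_left)
  have der: "(\<phi> has_derivative (\<lambda>v. R w (source (\<phi> w) v))) (at w)" if w: "w \<in> ball 0 \<delta>" for w
  proof -
    obtain d where d: "d > 0" "ball w d \<subseteq> ball 0 \<delta>" using w open_contains_ball open_ball by blast
    let ?M = "2 * (L + C)"
    let ?Q = "2 * (C * ?M + C * norm w * ?M\<^sup>2)"
    show ?thesis
    proof (rule has_derivative_quadratic[OF _ d(1), where C = ?Q])
      show "bounded_linear (\<lambda>v. R w (source (\<phi> w) v))"
        by (rule bounded_linear_compose[OF blinfun.bounded_linear_right lin_source[OF w]])
      fix w' assume "norm (w' - w) < d"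
      then have "w' \<in> ball w d" by (simp add: dist_norm norm_minus_commute)
      then have w': "w' \<in> ball 0 \<delta>" using d by blast
      define v where "v = w' - w"
      define \<Delta> where "\<Delta> = \<phi> w' - \<phi> w"
      have fe: "superpose (field w') (\<phi> w') = superpose (field v) (\<phi> w') + superpose (field w) (\<phi> w')"
        by (rule bcontfun_eqI) (simp add: superpose_field_apply[OF t[OF w']] field_add[symmetric] v_def)
      have \<Delta>: "\<Delta> = const_bcontfun (l v) + antiderivative (superpose (field v) (\<phi> w')) + antiderivative (superpose (field w) (\<phi> w') - superpose (field w) (\<phi> w))"
      proof -
        have "\<Delta> = picard w' (\<phi> w') - picard w (\<phi> w)" using \<phi>(2) w w' by (simp add: \<Delta>_def)
        also have "\<dots> = const_bcontfun (l v) + antiderivative (superpose (field v) (\<phi> w')) + antiderivative (superpose (field w) (\<phi> w') - superpose (field w) (\<phi> w))"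
          by (simp add: picard_def fe linear_add[OF intl] linear_diff[OF intl] linear_add[OF cl] linear_diff[OF cl] v_def l.diff)
        finally show ?thesis .
      qed
      have \<Delta>b: "norm \<Delta> \<le> ?M * norm v"
      proof -
        have "norm \<Delta> \<le> norm (const_bcontfun (l v) :: real \<Rightarrow>\<^sub>C 'e) + norm (antiderivative (superpose (field v) (\<phi> w'))) + norm (antiderivative (superpose (field w) (\<phi> w') - superpose (field w) (\<phi> w)))"
          unfolding \<Delta> by (intro norm_triangle_le add_mono) auto
        also have "\<dots> \<le> L * norm v + C * norm v + C * norm w * norm \<Delta>"
          unfolding \<Delta>_def
          by (intro add_mono order_trans[OF nc] L order_trans[OF norm_antiderivative_le] C t w w')
        also have "C * norm w * norm \<Delta> \<le> 1/2 * norm \<Delta>" using half[OF w] by (intro mult_right_mono) auto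
        finally show ?thesis by (simp add: algebra_simps)
      qed
      \<comment> \<open>The linearized equation holds for the difference of two solutions up to a quadratic error.\<close>
      have "\<Delta> - antiderivative (lin w (\<phi> w) \<Delta>) - source (\<phi> w) v =
         antiderivative (superpose (field v) (\<phi> w') - superpose (field v) (\<phi> w)) + antiderivative (superpose (field w) (\<phi> w') - superpose (field w) (\<phi> w) - lin w (\<phi> w) \<Delta>)"
        by (subst (1) \<Delta>) (simp add: source_def linear_diff[OF intl])
      then have "norm (\<Delta> - antiderivative (lin w (\<phi> w) \<Delta>) - source (\<phi> w) v) \<le>
        norm (antiderivative (superpose (field v) (\<phi> w') - superpose (field v) (\<phi> w))) + norm (antiderivative (superpose (field w) (\<phi> w') - superpose (field w) (\<phi> w) - lin w (\<phi> w) \<Delta>))"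
        using norm_triangle_ineq by metis
      also have "\<dots> \<le> C * norm v * norm \<Delta> + C * norm w * (norm \<Delta>)\<^sup>2"
        unfolding \<Delta>_def by (intro add_mono order_trans[OF norm_antiderivative_le] C t w w')
      also have "\<dots> \<le> C * norm v * (?M * norm v) + C * norm w * (?M * norm v)\<^sup>2"
        using \<Delta>b C(1) by (intro add_mono mult_left_mono power_mono) auto
      also have "\<dots> = (C * ?M + C * norm w * ?M\<^sup>2) * (norm v)\<^sup>2" by (simp add: power2_eq_square algebra_simps)
      finally have e: "norm (\<Delta> - antiderivative (lin w (\<phi> w) \<Delta>) - source (\<phi> w) v) \<le> (C * ?M + C * norm w * ?M\<^sup>2) * (norm v)\<^sup>2" .
      have "\<Delta> - R w (source (\<phi> w) v) = R w (\<Delta> - antiderivative (lin w (\<phi> w) \<Delta>) - source (\<phi> w) v)"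
        by (simp only: blinfun.diff_right[of "R w" "\<Delta> - antiderivative (lin w (\<phi> w) \<Delta>)"] RK[OF w])
      then have "norm (\<Delta> - R w (source (\<phi> w) v)) \<le> 2 * norm (\<Delta> - antiderivative (lin w (\<phi> w) \<Delta>) - source (\<phi> w) v)"
        using R(3)[OF w] by metis
      also have "\<dots> \<le> 2 * ((C * ?M + C * norm w * ?M\<^sup>2) * (norm v)\<^sup>2)" by (intro mult_left_mono e) simp
      also have "\<dots> = ?Q * (norm v)\<^sup>2" by (simp only: mult.assoc)
      finally show "norm (\<phi> w' - \<phi> w - R w (source (\<phi> w) (w' - w))) \<le> ?Q * (norm (w' - w))\<^sup>2"
        by (simp only: \<Delta>_def v_def)
    qed
  qed
  have o: "open (ball (0::'e) \<delta>)" by simp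
  have "Ck (ball 0 \<delta>) \<phi> k" for k
  proof (induction k)
    case 0
    show ?case using der by (auto intro!: continuous_at_imp_continuous_on has_derivative_continuous)
  next
    case (Suc k)
    have sup: "Ck (ball 0 \<delta>) (\<lambda>w. superpose g (\<phi> w)) k" if "smooth_on S g" for g :: "'e \<Rightarrow> 'e"
      by (rule Ck_superpose[OF S o tb Suc that])
    have KC: "Ck (ball 0 \<delta>) K k"
      unfolding K_def
      by (intro Ck_sum Ck_bilinear[OF bounded_bilinear_scaleR] Ck_bilinear[OF bounded_bilinear_blinfun_compose] Ck_const o
        Ck_linear[OF bounded_linear_inner_left] Ck_bounded_linear[OF bounded_bilinear.bounded_linear_prod_left[OF bounded_bilinear_coord_mult]]
        sup smooth_dd smooth_B)
    have "Ck (ball 0 \<delta>) (\<lambda>w. id_blinfun + - K w) k"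
      by (intro Ck_add o Ck_const Ck_bounded_linear[OF bounded_linear_minus[OF bounded_linear_ident]] KC)
    then have RC: "Ck (ball 0 \<delta>) R k"
      by (intro Ck_blinfun_inverse[OF o R(1,2)]) auto
    show ?case
    proof (rule Ck_SucI[OF o der])
      fix v
      have "Ck (ball 0 \<delta>) (\<lambda>w. const_bcontfun (l v) + (\<Sum>j\<in>Basis. (v \<bullet> j) *\<^sub>R antiderivative (superpose (B j) (\<phi> w)))) k"
        by (intro Ck_add o Ck_const Ck_sum Ck_bilinear[OF bounded_bilinear_scaleR] Ck_bounded_linear[OF int] sup smooth_B)
      then have "Ck (ball 0 \<delta>) (\<lambda>w. source (\<phi> w) v) k"
        by (rule Ck_cong) (use source_eq[OF t] in auto)
      then show "Ck (ball 0 \<delta>) (\<lambda>w. R w (source (\<phi> w) v)) k"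
        by (intro Ck_bilinear[OF bounded_bilinear_blinfun_apply] o RC)
    qed
  qed
  then show ?thesis using that[OF \<delta> tb \<phi>(2)[symmetric] der _ RK] by blast
qed

text \<open>
  If the fields commute, then along a solution the variation caused by a change \<open>v\<close> of the control
  that does not move the initial point is \<open>t\<close> times the field of \<open>v\<close>: this curve solves the linearized equation,
  which has only one solution. Hence the endpoint map carries such directions to the fields.
\<close>
lemma commuting_flow:
  assumes comm: "\<And>i j x. i \<in> Basis \<Longrightarrow> j \<in> Basis \<Longrightarrow> x \<in> S \<Longrightarrow> lie_bracket (B i) (B j) x = 0"
  obtains \<delta> \<Psi> where "\<delta> > 0" "smooth_on (ball 0 \<delta>) \<Psi>" "\<Psi> ` ball 0 \<delta> \<subseteq> S" "\<Psi> 0 = x0"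
    "\<And>v. dd \<Psi> 0 v = l v + field v x0"
    "\<And>w v. w \<in> ball 0 \<delta> \<Longrightarrow> l v = 0 \<Longrightarrow> dd \<Psi> w v = field v (\<Psi> w)"
proof -
  obtain \<delta> \<phi> R where \<delta>: "\<delta> > 0" and tb: "\<And>w. w \<in> ball 0 \<delta> \<Longrightarrow> \<phi> w \<in> ball (const_bcontfun x0) r"
    and fp: "\<And>w. w \<in> ball 0 \<delta> \<Longrightarrow> \<phi> w = picard w (\<phi> w)"
    and der: "\<And>w. w \<in> ball 0 \<delta> \<Longrightarrow> (\<phi> has_derivative (\<lambda>v. blinfun_apply (R w) (source (\<phi> w) v))) (at w)"
    and CkP: "\<And>k. Ck (ball 0 \<delta>) \<phi> k"
    and RK: "\<And>w h. w \<in> ball 0 \<delta> \<Longrightarrow> blinfun_apply (R w) (h - antiderivative (lin w (\<phi> w) h)) = h"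
    by (rule solution_family) (rule that)
  interpret l: bounded_linear l by (rule l)
  have o: "open (ball (0::'e) \<delta>)" by simp
  have t: "\<phi> w \<in> tube" if "w \<in> ball 0 \<delta>" for w using tb[OF that] by auto
  have inS: "apply_bcontfun (\<phi> w) s \<in> S" if "w \<in> ball 0 \<delta>" for w s using cball_bcontfunD[OF t[OF that]] S by blast
  have \<phi>t: "apply_bcontfun (\<phi> w) s = x0 + l w + integral {0..unit_clamp s} (\<lambda>s. field w (apply_bcontfun (\<phi> w) s))"
    if "w \<in> ball 0 \<delta>" for w s
    by (subst fp[OF that]) (simp add: picard_def const_bcontfun.rep_eq antiderivative_apply superpose_field_apply[OF t[OF that], abs_def])
  define \<Psi> where "\<Psi> w = apply_bcontfun (\<phi> w) 1" for w
  have ddP: "(\<Psi> has_derivative (\<lambda>v. apply_bcontfun (R w (source (\<phi> w) v)) 1)) (at w)" if "w \<in> ball 0 \<delta>" for w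
    unfolding \<Psi>_def by (rule bounded_linear.has_derivative[OF bounded_linear_eval_bcontfun der[OF that]])
  have key: "R w (source (\<phi> w) v) = h" if "w \<in> ball 0 \<delta>" "source (\<phi> w) v = h - antiderivative (lin w (\<phi> w) h)" for w v h
    unfolding that(2) by (rule RK[OF that(1)])
  show ?thesis
  proof (rule that[of \<delta> \<Psi>])
    show "smooth_on (ball 0 \<delta>) \<Psi>"
      unfolding \<Psi>_def by (intro smooth_onI Ck_bounded_linear[OF bounded_linear_eval_bcontfun] o CkP)
    show "\<Psi> ` ball 0 \<delta> \<subseteq> S" using inS by (auto simp: \<Psi>_def)
    have z: "0 \<in> ball (0::'e) \<delta>" using \<delta> by simp
    have f0: "field 0 x = 0" for x by (simp add: field_def)
    have p0: "apply_bcontfun (\<phi> 0) s = x0" for s using \<phi>t[OF z, of s] by (simp add: f0 l.zero)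
    then show "\<Psi> 0 = x0" by (simp add: \<Psi>_def)
    show "dd \<Psi> 0 v = l v + field v x0" for v
    proof -
      have "lin 0 (\<phi> 0) h = 0" for h
        by (rule bcontfun_eqI) (simp add: lin_apply[OF t[OF z]] dd_field[OF inS[OF z]])
      then have "R 0 (source (\<phi> 0) v) = source (\<phi> 0) v"
        by (intro key[OF z]) (simp add: linear_0[OF bounded_linear.linear[OF bounded_linear_antiderivative]])
      then have "dd \<Psi> 0 v = apply_bcontfun (source (\<phi> 0) v) 1"
        using dd_eqI[OF ddP[OF z]] by simp
      also have "\<dots> = l v + integral {0..1} (\<lambda>s::real. field v x0)"
        by (simp add: source_def const_bcontfun.rep_eq antiderivative_apply superpose_field_apply[OF t[OF z], abs_def] p0 unit_clamp)
      also have "integral {0..1} (\<lambda>s::real. field v x0) = field v x0"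
      proof (rule integral_unique)
        show "((\<lambda>s::real. field v x0) has_integral field v x0) {0..1}"
          using has_integral_const_real[of "field v x0" 0 1] by simp
      qed
      finally show ?thesis .
    qed
    fix w v :: 'e assume w: "w \<in> ball 0 \<delta>" and lv: "l v = 0"
    let ?p = "apply_bcontfun (\<phi> w)"
    have "unit_clamp \<in> bcontfun"
      by (rule bcontfun_normI[where b = 1]) (auto simp: unit_clamp_def intro!: continuous_intros)
    define cl where "cl = Bcontfun unit_clamp"
    have cl: "apply_bcontfun cl = unit_clamp" unfolding cl_def by (rule Bcontfun_inverse) fact
    define \<theta> where "\<theta> = bc_map2 (\<lambda>x y. x *\<^sub>R y) cl (superpose (field v) (\<phi> w))"
    have \<theta>: "apply_bcontfun \<theta> s = unit_clamp s *\<^sub>R field v (?p s)" for s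
      by (simp add: \<theta>_def bc_map2_apply[OF bounded_bilinear_scaleR] cl superpose_field_apply[OF t[OF w]])
    have commute: "dd (field v) x (field w x) = dd (field w) x (field v x)" if x: "x \<in> S" for x
    proof -
      have l1: "linear (dd (B j) x)" if "j \<in> Basis" for j using smooth_linear_dd[OF smooth_B[OF that] x] .
      have exp: "dd (field a) x (field b x) = (\<Sum>j\<in>Basis. \<Sum>i\<in>Basis. ((a \<bullet> j) * (b \<bullet> i)) *\<^sub>R dd (B j) x (B i x))" for a b
        unfolding dd_field[OF x] field_def[of b]
        by (simp add: linear_sum[OF l1] linear_scale[OF l1] scaleR_sum_right)
      have c: "dd (B j) x (B i x) = dd (B i) x (B j x)" if "i \<in> Basis" "j \<in> Basis" for i j
        using comm[OF that x] by (simp add: lie_bracket_def)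
      have "dd (field v) x (field w x) = (\<Sum>j\<in>Basis. \<Sum>i\<in>Basis. ((v \<bullet> j) * (w \<bullet> i)) *\<^sub>R dd (B i) x (B j x))"
        unfolding exp by (intro sum.cong refl) (simp add: c)
      also have "\<dots> = dd (field w) x (field v x)" unfolding exp by (subst sum.swap) (simp add: mult.commute)
      finally show ?thesis .
    qed
    have cf: "continuous_on A (\<lambda>s. field u (?p s))" for u A
      by (rule continuous_on_compose2[OF cont_field[of u] continuous_on_apply_bcontfun]) (use cball_bcontfunD[OF t[OF w]] in auto)
    have pder: "(?p has_vector_derivative field w (?p s)) (at s within {0..1})" if "s \<in> {0..1}" for s
    proof (rule has_vector_derivative_transform[OF that])
      show "((\<lambda>s. x0 + l w + integral {0..s} (\<lambda>s. field w (?p s))) has_vector_derivative field w (?p s)) (at s within {0..1})"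
        using integral_has_vector_derivative[OF cf that] by (auto intro!: derivative_eq_intros)
      show "?p y = x0 + l w + integral {0..y} (\<lambda>s. field w (?p s))" if "y \<in> {0..1}" for y
        using \<phi>t[OF w, of y] that by (simp add: unit_clamp)
    qed
    have F: "((\<lambda>s. s *\<^sub>R field v (?p s)) has_vector_derivative (field v (?p s) + dd (field w) (?p s) (apply_bcontfun \<theta> s))) (at s within {0..\<tau>})"
      if s: "s \<in> {0..\<tau>}" "\<tau> \<le> 1" for s \<tau>
    proof -
      have s1: "s \<in> {0..1}" using s by auto
      have "((\<lambda>s. field v (?p s)) has_derivative (\<lambda>h. dd (field v) (?p s) (h *\<^sub>R field w (?p s)))) (at s within {0..1})"
        using has_derivative_compose[OF pder[OF s1, unfolded has_vector_derivative_def] smooth_has_derivative[OF smooth_field inS[OF w]]] .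
      then have "((\<lambda>s. field v (?p s)) has_vector_derivative dd (field v) (?p s) (field w (?p s))) (at s within {0..1})"
        by (simp add: has_vector_derivative_def linear_scale[OF smooth_linear_dd[OF smooth_field inS[OF w]]])
      from has_vector_derivative_scaleR[OF DERIV_ident this]
      have "((\<lambda>s. s *\<^sub>R field v (?p s)) has_vector_derivative (s *\<^sub>R dd (field v) (?p s) (field w (?p s)) + 1 *\<^sub>R field v (?p s))) (at s within {0..1})" .
      then have "((\<lambda>s. s *\<^sub>R field v (?p s)) has_vector_derivative (field v (?p s) + dd (field w) (?p s) (apply_bcontfun \<theta> s))) (at s within {0..1})"
        using s1 by (simp add: commute[OF inS[OF w]] \<theta> unit_clamp linear_scale[OF smooth_linear_dd[OF smooth_field inS[OF w]]] add.commute)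
      then show ?thesis by (rule has_vector_derivative_within_subset) (use s in auto)
    qed
    \<comment> \<open>By the computation above, the fundamental theorem of calculus is the linearized integral equation for \<open>\<theta>\<close>.\<close>
    have "R w (source (\<phi> w) v) = \<theta>"
    proof (rule key[OF w], rule bcontfun_eqI)
      fix s
      let ?\<tau> = "unit_clamp s"
      have ps: "?p s = ?p ?\<tau>" by (simp add: \<phi>t[OF w, of s] \<phi>t[OF w, of ?\<tau>] unit_clamp)
      have "((\<lambda>s. field v (?p s) + dd (field w) (?p s) (apply_bcontfun \<theta> s)) has_integral (?\<tau> *\<^sub>R field v (?p ?\<tau>) - 0 *\<^sub>R field v (?p 0))) {0..?\<tau>}"
        by (rule fundamental_theorem_of_calculus[OF _ F]) (auto simp: unit_clamp)
      then have "?\<tau> *\<^sub>R field v (?p ?\<tau>) = integral {0..?\<tau>} (\<lambda>s. apply_bcontfun (superpose (field v) (\<phi> w)) s + apply_bcontfun (lin w (\<phi> w) \<theta>) s)"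
        by (simp add: superpose_field_apply[OF t[OF w]] lin_apply[OF t[OF w]] integral_unique)
      also have "\<dots> = apply_bcontfun (antiderivative (superpose (field v) (\<phi> w))) s + apply_bcontfun (antiderivative (lin w (\<phi> w) \<theta>)) s"
        by (simp add: antiderivative_apply integral_add[OF bcontfun_integrable bcontfun_integrable])
      finally show "apply_bcontfun (source (\<phi> w) v) s = apply_bcontfun (\<theta> - antiderivative (lin w (\<phi> w) \<theta>)) s"
        by (simp add: \<theta> ps source_def const_bcontfun.rep_eq lv)
    qed
    then have "dd \<Psi> w v = apply_bcontfun \<theta> 1" using dd_eqI[OF ddP[OF w]] by simp
    then show "dd \<Psi> w v = field v (\<Psi> w)" by (simp add: \<theta> \<Psi>_def unit_clamp)
  qed (fact \<delta>)
qed

end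

section \<open>Lie brackets and the theorem of Frobenius\<close>
lemma smooth_lie_bracket:
  fixes X Y :: "'e::euclidean_space \<Rightarrow> 'e"
  shows "open S \<Longrightarrow> smooth_on S X \<Longrightarrow> smooth_on S Y \<Longrightarrow> smooth_on S (lie_bracket X Y)"
  unfolding lie_bracket_def[abs_def] by (intro smooth_diff smooth_dd_field)

lemma dd_dd_field:
  fixes f :: "'e::euclidean_space \<Rightarrow> 'b::real_normed_vector"
  assumes S: "open S" "x \<in> S" and f: "smooth_on S f" and Y: "smooth_on S Y"
  shows "dd (\<lambda>y. dd f y (Y y)) x v = dd f x (dd Y x v) + (\<Sum>b\<in>Basis. (Y x \<bullet> b) *\<^sub>R dd (\<lambda>y. dd f y b) x v)"
proof -
  have "dd (\<lambda>y. dd f y (Y y)) x v = dd (\<lambda>y. \<Sum>b\<in>Basis. (Y y \<bullet> b) *\<^sub>R dd f y b) x v"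
    by (rule fun_cong[OF dd_transform[OF S]]) (rule dd_euclidean[OF smooth_differentiable[OF f]])
  also have "\<dots> = (\<Sum>b\<in>Basis. (Y x \<bullet> b) *\<^sub>R dd (\<lambda>y. dd f y b) x v + (dd Y x v \<bullet> b) *\<^sub>R dd f x b)"
    by (rule dd_eqI)
      (intro has_derivative_sum has_derivative_scaleR has_derivative_inner_left
        smooth_has_derivative[OF smooth_dd[OF f]] smooth_has_derivative[OF Y] S)
  finally have "dd (\<lambda>y. dd f y (Y y)) x v
    = (\<Sum>b\<in>Basis. (Y x \<bullet> b) *\<^sub>R dd (\<lambda>y. dd f y b) x v) + (\<Sum>b\<in>Basis. (dd Y x v \<bullet> b) *\<^sub>R dd f x b)"
    by (simp only: sum.distrib)
  also have "(\<Sum>b\<in>Basis. (dd Y x v \<bullet> b) *\<^sub>R dd f x b) = dd f x (dd Y x v)"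
    by (rule dd_euclidean[OF smooth_differentiable[OF f S(2)], symmetric])
  finally show ?thesis by (simp only: add.commute)
qed

text \<open>
  The second derivatives of \<open>f\<close> cancel by symmetry. The identity says that the bracket acts on functions
  as the commutator of derivations, and the Jacobi identity and naturality follow from it.
\<close>
lemma dd_lie_bracket:
  fixes f :: "'e::euclidean_space \<Rightarrow> 'b::real_normed_vector"
  assumes S: "open S" "x \<in> S" and f: "smooth_on S f" and X: "smooth_on S X" and Y: "smooth_on S Y"
  shows "dd f x (lie_bracket X Y x) = dd (\<lambda>y. dd f y (Y y)) x (X x) - dd (\<lambda>y. dd f y (X y)) x (Y x)"
proof -
  have exp: "(\<Sum>b\<in>Basis. (u \<bullet> b) *\<^sub>R dd (\<lambda>y. dd f y b) x v) = (\<Sum>b\<in>Basis. \<Sum>c\<in>Basis. ((u \<bullet> b) * (v \<bullet> c)) *\<^sub>R dd (\<lambda>y. dd f y b) x c)" for u v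
    by (subst dd_euclidean[OF smooth_differentiable[OF smooth_dd[OF f] S(2)], of _ v]) (simp add: scaleR_sum_right)
  have sym: "dd (\<lambda>y. dd f y b) x c = dd (\<lambda>y. dd f y c) x b" for b c
    by (rule dd_dd_symmetric[OF S smooth_onD[OF f]])
  have "(\<Sum>b\<in>Basis. (Y x \<bullet> b) *\<^sub>R dd (\<lambda>y. dd f y b) x (X x)) = (\<Sum>b\<in>Basis. (X x \<bullet> b) *\<^sub>R dd (\<lambda>y. dd f y b) x (Y x))"
    unfolding exp by (subst sum.swap) (simp add: sym mult.commute)
  then show ?thesis
    by (simp add: dd_dd_field[OF S f X] dd_dd_field[OF S f Y] lie_bracket_def linear_diff[OF smooth_linear_dd[OF f S(2)]])
qed

lemma lie_bracket_jacobi: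
  fixes X Y Z :: "'e::euclidean_space \<Rightarrow> 'e"
  assumes S: "open S" "x \<in> S" and X: "smooth_on S X" and Y: "smooth_on S Y" and Z: "smooth_on S Z"
  shows "lie_bracket (lie_bracket X Y) Z x = lie_bracket X (lie_bracket Y Z) x - lie_bracket Y (lie_bracket X Z) x"
proof -
  have D: "dd (lie_bracket U V) x w = dd (\<lambda>y. dd V y (U y)) x w - dd (\<lambda>y. dd U y (V y)) x w"
    if "smooth_on S U" "smooth_on S V" for U V w
    unfolding lie_bracket_def[abs_def]
    by (rule dd_eqI) (intro has_derivative_diff smooth_has_derivative[OF smooth_dd_field[OF S(1) that(2,1)] S(2)]
      smooth_has_derivative[OF smooth_dd_field[OF S(1) that] S(2)])
  show ?thesis
    unfolding lie_bracket_def[of "lie_bracket X Y"] lie_bracket_def[of X "lie_bracket Y Z"] lie_bracket_def[of Y "lie_bracket X Z"]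
      dd_lie_bracket[OF S Z X Y] dd_lie_bracket[OF S X Y Z] dd_lie_bracket[OF S Y X Z]
      D[OF X Y] D[OF Y Z] D[OF X Z] by simp
qed

lemma lie_bracket_cong:
  assumes "open S" "x \<in> S" "\<And>y. y \<in> S \<Longrightarrow> X y = X' y" "\<And>y. y \<in> S \<Longrightarrow> Y y = Y' y"
  shows "lie_bracket X Y x = lie_bracket X' Y' x"
  using assms(2-4) dd_transform[OF assms(1,2), of X X'] dd_transform[OF assms(1,2), of Y Y']
  by (simp add: lie_bracket_def)

text \<open>
  Modulo the kernel of \<open>a\<close>, the bracket of two sections of that kernel depends only on their values at
  the point, through minus the exterior derivative of the covector field \<open>a\<close>.
\<close>
lemma lie_bracket_annihilator:
  fixes a X Y :: "'e::euclidean_space \<Rightarrow> 'e"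
  assumes S: "open S" "x \<in> S" and sm: "smooth_on S a" "smooth_on S X" "smooth_on S Y"
    and z: "\<And>y. y \<in> S \<Longrightarrow> a y \<bullet> X y = 0" "\<And>y. y \<in> S \<Longrightarrow> a y \<bullet> Y y = 0"
  shows "a x \<bullet> lie_bracket X Y x = dd a x (Y x) \<bullet> X x - dd a x (X x) \<bullet> Y x"
proof -
  have "a x \<bullet> dd Z x v + dd a x v \<bullet> Z x = 0" if Z: "smooth_on S Z" "\<And>y. y \<in> S \<Longrightarrow> a y \<bullet> Z y = 0" for Z v
  proof -
    have "a x \<bullet> dd Z x v + dd a x v \<bullet> Z x = dd (\<lambda>y. a y \<bullet> Z y) x v"
      by (rule dd_eqI[symmetric])
        (intro has_derivative_inner smooth_has_derivative[OF sm(1)] smooth_has_derivative[OF Z(1)] S)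
    also have "\<dots> = dd (\<lambda>y. 0) x v" using dd_transform[OF S, of "\<lambda>y. a y \<bullet> Z y" "\<lambda>y. 0"] Z(2) by simp
    finally show ?thesis by simp
  qed
  from this[OF sm(2) z(1), of "Y x"] this[OF sm(3) z(2), of "X x"]
  show ?thesis by (simp add: lie_bracket_def inner_diff_right)
qed

definition section_on :: "('e::euclidean_space \<Rightarrow> 'e set) \<Rightarrow> 'e set \<Rightarrow> ('e \<Rightarrow> 'e) \<Rightarrow> bool" where
  "section_on K W X \<longleftrightarrow> open W \<and> smooth_on W X \<and> (\<forall>y\<in>W. X y \<in> K y)"

text \<open>
  Smoothness is expressed by extending each vector to a local section. For constant rank this gives
  local frames, and it passes to derived distributions without any choice of a frame.
\<close>
definition smooth_distribution :: "'e::euclidean_space set \<Rightarrow> ('e \<Rightarrow> 'e set) \<Rightarrow> bool" where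
  "smooth_distribution S K \<longleftrightarrow> open S \<and>
     (\<forall>x\<in>S. subspace (K x) \<and> (\<forall>v\<in>K x. \<exists>W X. x \<in> W \<and> W \<subseteq> S \<and> section_on K W X \<and> X x = v))"

lemma smooth_distributionD:
  assumes "smooth_distribution S K" "x \<in> S"
  shows "subspace (K x)" "v \<in> K x \<Longrightarrow> \<exists>W X. x \<in> W \<and> W \<subseteq> S \<and> section_on K W X \<and> X x = v"
  using assms unfolding smooth_distribution_def by auto

lemma section_subset: "section_on K W X \<Longrightarrow> open V \<Longrightarrow> V \<subseteq> W \<Longrightarrow> section_on K V X"
  unfolding section_on_def using smooth_subset by blast

lemma smooth_distribution_subset:
  assumes "smooth_distribution S K" "open T" "T \<subseteq> S"
  shows "smooth_distribution T K"
  unfolding smooth_distribution_def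
proof (intro conjI ballI assms(2))
  fix x assume x: "x \<in> T"
  show "subspace (K x)" using smooth_distributionD(1)[OF assms(1)] x assms(3) by blast
  fix v assume "v \<in> K x"
  then obtain W X where "x \<in> W" "W \<subseteq> S" "section_on K W X" "X x = v"
    using smooth_distributionD(2)[OF assms(1)] x assms(3) by blast
  then show "\<exists>W X. x \<in> W \<and> W \<subseteq> T \<and> section_on K W X \<and> X x = v"
    using x assms(2) by (intro exI[of _ "W \<inter> T"] exI[of _ X]) (auto intro: smooth_subset simp: section_on_def)
qed

lemma dim_kernel_functional:
  fixes K :: "'e::euclidean_space set"
  assumes K: "subspace K" and w: "w \<in> K" "c \<bullet> w \<noteq> 0"
  shows "dim {v \<in> K. c \<bullet> v = 0} + 1 = dim K" "subspace {v \<in> K. c \<bullet> v = 0}"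
proof -
  let ?N = "{v \<in> K. c \<bullet> v = 0}"
  show N: "subspace ?N"
    using K by (auto simp: subspace_def inner_add_right)
  have KN: "K = span (insert w ?N)"
  proof
    show "span (insert w ?N) \<subseteq> K" using K w by (intro span_minimal) auto
    show "K \<subseteq> span (insert w ?N)"
    proof
      fix v assume v: "v \<in> K"
      let ?k = "(c \<bullet> v) / (c \<bullet> w)"
      have "v - ?k *\<^sub>R w \<in> K" using K v w by (intro subspace_diff subspace_scale)
      moreover have "c \<bullet> (v - ?k *\<^sub>R w) = 0" using w by (simp add: inner_diff_right)
      ultimately have "v - ?k *\<^sub>R w \<in> ?N" by simp
      then have "v - ?k *\<^sub>R w \<in> span ?N" by (rule span_base)
      then show "v \<in> span (insert w ?N)" by (auto simp: span_insert)
    qed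
  qed
  have e: "span ?N = ?N" by (rule span_eq_iff[THEN iffD2, OF N])
  have "w \<notin> span ?N" unfolding e using w(2) by simp
  then have "dim (insert w ?N) = dim ?N + 1" using dim_insert[of w ?N] by simp
  moreover have "dim K = dim (insert w ?N)" using arg_cong[OF KN, of dim] by (simp only: dim_span)
  ultimately show "dim ?N + 1 = dim K" by simp
qed

text \<open>A section is corrected by a multiple of a section \<open>Z\<close> with \<open>a \<bullet> Z \<noteq> 0\<close>.\<close>
lemma smooth_distribution_kernel:
  fixes K :: "'e::euclidean_space \<Rightarrow> 'e set"
  assumes K: "smooth_distribution S K" and a: "smooth_on S a" and x0: "x0 \<in> S" and w: "w \<in> K x0" "a x0 \<bullet> w \<noteq> 0"
  obtains W where "open W" "x0 \<in> W" "W \<subseteq> S" "smooth_distribution W (\<lambda>x. {v \<in> K x. a x \<bullet> v = 0})"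
    "\<And>x. x \<in> W \<Longrightarrow> dim {v \<in> K x. a x \<bullet> v = 0} + 1 = dim (K x)"
proof -
  obtain W0 Z where W0: "x0 \<in> W0" "W0 \<subseteq> S" "section_on K W0 Z" "Z x0 = w"
    using smooth_distributionD(2)[OF K x0 w(1)] by blast
  have o: "open W0" and Z: "smooth_on W0 Z" "\<And>y. y \<in> W0 \<Longrightarrow> Z y \<in> K y" using W0 by (auto simp: section_on_def)
  have az: "smooth_on W0 (\<lambda>y. a y \<bullet> Z y)" by (intro smooth_inner o Z smooth_subset[OF a W0(2)])
  define W where "W = {y \<in> W0. a y \<bullet> Z y \<noteq> 0}"
  have "W = W0 \<inter> (\<lambda>y. a y \<bullet> Z y) -` (- {0})" by (auto simp: W_def)
  then have W: "open W"
    using continuous_open_preimage[OF smooth_continuous_on[OF az] o, of "- {0}"] by auto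
  have WS: "W \<subseteq> S" "W \<subseteq> W0" using W0 by (auto simp: W_def)
  note dk = dim_kernel_functional[OF smooth_distributionD(1)[OF K]]
  show ?thesis
  proof (rule that[OF W])
    show "x0 \<in> W" using W0 w by (simp add: W_def)
    show "W \<subseteq> S" by fact
    show "dim {v \<in> K x. a x \<bullet> v = 0} + 1 = dim (K x)" if "x \<in> W" for x
      using dk(1)[of x "Z x" "a x"] that Z(2) WS by (auto simp: W_def)
    show "smooth_distribution W (\<lambda>x. {v \<in> K x. a x \<bullet> v = 0})"
      unfolding smooth_distribution_def
    proof (intro conjI ballI W)
      fix x assume x: "x \<in> W"
      show "subspace {v \<in> K x. a x \<bullet> v = 0}"
        using dk(2)[of x "Z x" "a x"] x Z(2) WS by (auto simp: W_def)
      fix v assume v: "v \<in> {v \<in> K x. a x \<bullet> v = 0}"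
      then obtain W1 X where W1: "x \<in> W1" "W1 \<subseteq> S" "section_on K W1 X" "X x = v"
        using smooth_distributionD(2)[OF K, of x v] x WS by blast
      then have o1: "open (W \<inter> W1)" and X: "smooth_on W1 X" "\<And>y. y \<in> W1 \<Longrightarrow> X y \<in> K y" using W by (auto simp: section_on_def)
      let ?X = "\<lambda>y. X y - ((a y \<bullet> X y) / (a y \<bullet> Z y)) *\<^sub>R Z y"
      have "smooth_on (W \<inter> W1) ?X"
      proof (intro smooth_diff smooth_scaleR smooth_divide smooth_inner o1)
        show "smooth_on (W \<inter> W1) X" by (rule smooth_subset[OF X(1)]) auto
        then show "smooth_on (W \<inter> W1) X" .
        show "smooth_on (W \<inter> W1) a" by (rule smooth_subset[OF a]) (use WS in auto)
        then show "smooth_on (W \<inter> W1) a" .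
        show "smooth_on (W \<inter> W1) Z" by (rule smooth_subset[OF Z(1)]) (use WS in auto)
        then show "smooth_on (W \<inter> W1) Z" .
      qed (auto simp: W_def)
      moreover have "?X y \<in> {v \<in> K y. a y \<bullet> v = 0}" if "y \<in> W \<inter> W1" for y
        using that X(2)[of y] Z(2)[of y] smooth_distributionD(1)[OF K, of y] WS
        by (auto simp: W_def inner_diff_right intro!: subspace_diff subspace_scale)
      ultimately have "section_on (\<lambda>x. {v \<in> K x. a x \<bullet> v = 0}) (W \<inter> W1) ?X" using o1 by (simp add: section_on_def)
      moreover have "?X x = v" using v W1 by simp
      ultimately show "\<exists>W' X. x \<in> W' \<and> W' \<subseteq> W \<and> section_on (\<lambda>x. {v \<in> K x. a x \<bullet> v = 0}) W' X \<and> X x = v"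
        using x W1 by (intro exI[of _ "W \<inter> W1"] exI[of _ ?X]) auto
    qed
  qed
qed

text \<open>
  Near \<open>x0\<close> the distribution is a graph over \<open>K x0\<close>. The operator \<open>B x\<close> is the projection onto \<open>K x\<close> along the
  orthogonal complement of \<open>K x0\<close>; its kernel does not depend on \<open>x\<close>, and therefore the fields
  \<open>B x v\<close> have constant image under the orthogonal projection \<open>P\<close> onto \<open>K x0\<close>.
\<close>
lemma smooth_distribution_projection:
  fixes K :: "'e::euclidean_space \<Rightarrow> 'e set"
  assumes K: "smooth_distribution S K" and dim: "\<And>x. x \<in> S \<Longrightarrow> dim (K x) = r" and x0: "x0 \<in> S"
  obtains W B P where "open W" "x0 \<in> W" "W \<subseteq> S" "\<And>v. smooth_on W (\<lambda>x. B x v)" "\<And>x. x \<in> W \<Longrightarrow> linear (B x)"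
    "\<And>x. x \<in> W \<Longrightarrow> range (B x) = K x" "\<And>x v. x \<in> W \<Longrightarrow> v \<in> K x \<Longrightarrow> B x v = v"
    "linear P" "range P = K x0" "\<And>v. P (P v) = P v" "\<And>x v. x \<in> W \<Longrightarrow> P (B x v) = P v" "\<And>x v. x \<in> W \<Longrightarrow> B x (P v) = B x v"
proof -
  obtain E where E: "E \<subseteq> K x0" "pairwise orthogonal E" "\<And>e. e \<in> E \<Longrightarrow> norm e = 1" "independent E" "span E = K x0"
    using orthonormal_basis_subspace[OF smooth_distributionD(1)[OF K x0]] by metis
  have fin: "finite E" using E(4) independent_imp_finite by blast
  have ee: "e \<bullet> e' = (if e = e' then 1 else 0)" if "e \<in> E" "e' \<in> E" for e e'
    using E(2,3) that by (auto simp: pairwise_def orthogonal_def dot_square_norm)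
  have "\<forall>e\<in>E. \<exists>WX. x0 \<in> fst WX \<and> fst WX \<subseteq> S \<and> section_on K (fst WX) (snd WX) \<and> snd WX x0 = e"
    using smooth_distributionD(2)[OF K x0] E(1) by fastforce
  from bchoice[OF this] obtain WX where WX: "\<forall>e\<in>E. x0 \<in> fst (WX e) \<and> fst (WX e) \<subseteq> S \<and> section_on K (fst (WX e)) (snd (WX e)) \<and> snd (WX e) x0 = e" ..
  define X where "X e = snd (WX e)" for e
  define W0 where "W0 = S \<inter> (\<Inter>e\<in>E. fst (WX e))"
  have W0: "open W0" "x0 \<in> W0" "W0 \<subseteq> S"
    using WX K x0 fin by (auto simp: W0_def section_on_def smooth_distribution_def)
  have X: "smooth_on W0 (X e)" "\<And>y. y \<in> W0 \<Longrightarrow> X e y \<in> K y" "X e x0 = e" if "e \<in> E" for e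
  proof -
    have "W0 \<subseteq> fst (WX e)" using that by (auto simp: W0_def)
    then show "smooth_on W0 (X e)" "\<And>y. y \<in> W0 \<Longrightarrow> X e y \<in> K y" "X e x0 = e"
      using WX that smooth_subset unfolding X_def section_on_def by blast+
  qed
  define P where "P v = (\<Sum>e\<in>E. (v \<bullet> e) *\<^sub>R e)" for v :: 'e
  have linP: "linear P"
    by (auto intro!: linearI simp: P_def inner_add_left scaleR_add_left sum.distrib scaleR_sum_right)
  have blP: "bounded_linear P" using linP linear_conv_bounded_linear by blast
  have Pe: "P e = e" if "e \<in> E" for e
  proof -
    have "P e = (\<Sum>e'\<in>E. if e' = e then e else 0)" unfolding P_def by (rule sum.cong) (auto simp: ee that)
    then show ?thesis using that fin by simp
  qed
  have PP: "P (P v) = P v" for v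
    by (subst (2) P_def, subst (2) P_def) (simp add: linear_sum[OF linP] linear_scale[OF linP] Pe)
  have rP: "range P = K x0"
  proof
    show "range P \<subseteq> K x0"
      unfolding E(5)[symmetric] P_def by (intro image_subsetI span_sum span_scale span_base)
    have "E \<subseteq> range P" using Pe by (metis rangeI subsetI)
    then have "span E \<subseteq> range P"
      by (rule span_minimal[OF _ linear_subspace_image[OF linP subspace_UNIV]])
    then show "K x0 \<subseteq> range P" using E(5) by simp
  qed
  \<comment> \<open>\<open>1 - N x\<close> maps the frame at \<open>x0\<close> to the projected frame \<open>P (X e x)\<close>; inverting it turns the sections into the graph frame.\<close>
  define N where "N x = (\<Sum>e\<in>E. blinfun_scaleR_left (P (e - X e x)) o\<^sub>L blinfun_inner_left e)" for x
  have N: "blinfun_apply (N x) v = (\<Sum>e\<in>E. (v \<bullet> e) *\<^sub>R P (e - X e x))" for x v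
    by (simp add: N_def blinfun.sum_left blinfun_inner_left.rep_eq)
  have sN: "smooth_on W0 N"
    unfolding N_def
    by (intro smooth_sum W0 smooth_bilinear[OF bounded_bilinear_blinfun_compose] smooth_const
        smooth_bounded_linear[OF bounded_linear_blinfun_scaleR_left] smooth_bounded_linear[OF blP] smooth_diff X)
  have N0: "N x0 = 0" by (rule blinfun_eqI) (simp add: N X linear_0[OF linP])
  define W where "W = {x \<in> W0. N x \<in> ball 0 (1/2)}"
  have "W = W0 \<inter> N -` ball 0 (1/2)" by (auto simp: W_def)
  then have "open W"
    using continuous_open_preimage[OF smooth_continuous_on[OF sN] W0(1) open_ball[of 0 "1/2"]] by simp
  then have W: "open W" "x0 \<in> W" "W \<subseteq> W0" using W0 N0 by (auto simp: W_def)
  have "\<forall>x\<in>W. \<exists>R. R o\<^sub>L (id_blinfun - N x) = id_blinfun \<and> (id_blinfun - N x) o\<^sub>L R = id_blinfun"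
  proof
    fix x assume "x \<in> W"
    then have n: "norm (N x) \<le> 1/2" by (simp add: W_def)
    have n2: "norm (N x v) \<le> 1/2 * norm v" for v
      using order_trans[OF norm_blinfun mult_right_mono[OF n]] by auto
    obtain R where "R o\<^sub>L (id_blinfun - N x) = id_blinfun" "(id_blinfun - N x) o\<^sub>L R = id_blinfun"
      by (rule neumann_inverse[of "N x", OF n2]) (rule that)
    then show "\<exists>R. R o\<^sub>L (id_blinfun - N x) = id_blinfun \<and> (id_blinfun - N x) o\<^sub>L R = id_blinfun" by blast
  qed
  from bchoice[OF this] obtain R where R: "\<forall>x\<in>W. R x o\<^sub>L (id_blinfun - N x) = id_blinfun \<and> (id_blinfun - N x) o\<^sub>L R x = id_blinfun" ..
  have sR: "smooth_on W R"
    by (rule smooth_blinfun_inverse[OF W(1), where A = "\<lambda>x. id_blinfun - N x"])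
      (use R in \<open>auto intro!: smooth_diff smooth_const smooth_subset[OF sN] W\<close>)
  have Req: "R x v = v + N x (R x v)" if "x \<in> W" for x v
  proof -
    have "(id_blinfun - N x) (R x v) = v" using R that by (metis blinfun_apply_blinfun_compose blinfun_apply_id_blinfun)
    then show ?thesis by (simp add: blinfun.diff_left algebra_simps)
  qed
  define B where "B x v = (\<Sum>e\<in>E. (R x (P v) \<bullet> e) *\<^sub>R X e x)" for x v
  have linB: "linear (B x)" for x
    by (auto intro!: linearI simp: B_def linear_add[OF linP] linear_scale[OF linP] blinfun.add_right blinfun.scaleR_right
       inner_add_left scaleR_add_left sum.distrib scaleR_sum_right)
  have WS: "W \<subseteq> S" using W W0 by auto
  have PB: "P (B x v) = P v" if x: "x \<in> W" for x v
  proof -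
    let ?u = "R x (P v)"
    have "P (N x ?u) = N x ?u" by (simp add: N linear_sum[OF linP] linear_scale[OF linP] PP)
    then have Pu: "P ?u = ?u" using Req[OF x, of "P v"] by (metis PP linear_add[OF linP])
    have "N x ?u = P ?u - P (B x v)"
      unfolding N B_def by (subst (3) P_def)
        (simp add: linear_sum[OF linP] linear_scale[OF linP] linear_diff[OF linP] Pe scaleR_diff_right sum_subtractf PP)
    then show ?thesis using Req[OF x, of "P v"] Pu by (metis add_right_cancel diff_add_cancel add.commute)
  qed
  have BK: "B x v \<in> K x" if "x \<in> W" for x v
    unfolding B_def using that WS W(3) X(2)
    by (intro subspace_sum subspace_scale smooth_distributionD(1)[OF K]) auto
  have rB: "range (B x) = K x" if x: "x \<in> W" for x
  proof (rule subspace_dim_equal)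
    show "subspace (range (B x))" by (rule linear_subspace_image[OF linB subspace_UNIV])
    show "subspace (K x)" using smooth_distributionD(1)[OF K] x WS by blast
    show "range (B x) \<subseteq> K x" using BK[OF x] by blast
    have "K x0 = P ` range (B x)" using rP PB[OF x] by (auto simp: image_iff) (metis PP rangeE)+
    then have "dim (K x0) \<le> dim (range (B x))" by (simp add: dim_image_le linP)
    then show "dim (range (B x)) \<ge> dim (K x)" using dim x x0 WS by auto
  qed
  have BP: "B x (P v) = B x v" for x v by (simp add: B_def PP)
  show ?thesis
  proof (rule that[of W B P, OF W(1,2) WS _ linB rB _ linP rP PP PB BP])
    show "smooth_on W (\<lambda>x. B x v)" for v
      unfolding B_def
      by (intro smooth_sum smooth_scaleR smooth_inner W smooth_const smooth_bilinear[OF bounded_bilinear_blinfun_apply] sR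
          smooth_subset[OF X(1)])
    show "B x v = v" if xW: "x \<in> W" and vK: "v \<in> K x" for x v
    proof -
      obtain u where "v = B x u" using rB[OF xW] vK by blast
      then show ?thesis by (metis BP PB xW)
    qed
  qed
qed

text \<open>
  The fields \<open>B x v\<close> of the previous lemma commute when the distribution is involutive: their bracket lies in
  \<open>K x\<close>, and \<open>P\<close> annihilates it because \<open>P (B x v)\<close> is constant, while \<open>P\<close> is injective on \<open>K x\<close>. The endpoint
  map \<open>\<Psi>\<close> of their flows has derivative \<open>1\<close> at the origin and carries \<open>K x0\<close> to \<open>K x\<close>, so the components of its
  inverse transversal to \<open>K x0\<close> are constant along the distribution.
\<close>
theorem frobenius_first_integral:
  fixes K :: "'e::euclidean_space \<Rightarrow> 'e set"
  assumes K: "smooth_distribution S K" and dim: "\<And>x. x \<in> S \<Longrightarrow> dim (K x) = r" and x0: "x0 \<in> S"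
    and inv: "\<And>x W X Y. x \<in> W \<Longrightarrow> W \<subseteq> S \<Longrightarrow> section_on K W X \<Longrightarrow> section_on K W Y \<Longrightarrow> lie_bracket X Y x \<in> K x"
    and \<beta>: "\<And>v. v \<in> K x0 \<Longrightarrow> \<beta> \<bullet> v = 0"
  obtains W f where "open W" "x0 \<in> W" "W \<subseteq> S" "smooth_on W (f :: 'e \<Rightarrow> real)"
    "\<And>x v. x \<in> W \<Longrightarrow> v \<in> K x \<Longrightarrow> dd f x v = 0" "\<And>v. dd f x0 v = \<beta> \<bullet> v"
proof -
  obtain W B P where W: "open W" "x0 \<in> W" "W \<subseteq> S" and sB: "\<And>v. smooth_on W (\<lambda>x. B x v)" and lB: "\<And>x. x \<in> W \<Longrightarrow> linear (B x)"
    and rB: "\<And>x. x \<in> W \<Longrightarrow> range (B x) = K x" and Bv: "\<And>x v. x \<in> W \<Longrightarrow> v \<in> K x \<Longrightarrow> B x v = v"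
    and lP: "linear P" and rP: "range P = K x0" and PP: "\<And>v. P (P v) = P v"
    and PB: "\<And>x v. x \<in> W \<Longrightarrow> P (B x v) = P v" and BP: "\<And>x v. x \<in> W \<Longrightarrow> B x (P v) = B x v"
    by (rule smooth_distribution_projection[OF K dim x0]) (assumption, rule that)
  obtain r where r: "r > 0" "cball x0 r \<subseteq> W" using W open_contains_cball by blast
  have bP: "bounded_linear P" using lP linear_conv_bounded_linear by blast
  have bl: "bounded_linear (\<lambda>v. v - P v)" by (intro bounded_linear_sub bounded_linear_ident bP)
  interpret control_system W x0 r "\<lambda>j x. B x j" "\<lambda>v. v - P v"
    by (rule control_system.intro[OF W(1) r(2) r(1) sB bl])
  have fB: "field v x = B x v" if "x \<in> W" for v x
  proof -
    have "B x v = B x (\<Sum>b\<in>Basis. (v \<bullet> b) *\<^sub>R b)" by (simp add: euclidean_representation)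
    then show ?thesis by (simp add: field_def linear_sum[OF lB[OF that]] linear_scale[OF lB[OF that]])
  qed
  have comm: "lie_bracket (\<lambda>x. B x i) (\<lambda>x. B x j) x = 0" if x: "x \<in> W" for i j x
  proof -
    let ?u = "lie_bracket (\<lambda>x. B x i) (\<lambda>x. B x j) x"
    have "section_on K W (\<lambda>x. B x v)" for v
      unfolding section_on_def using sB W(1) rB rangeI by blast
    then have uK: "?u \<in> K x" using inv[OF x W(3)] by blast
    have "P (dd (\<lambda>x. B x v) x w) = 0" for v w
    proof -
      have "P (dd (\<lambda>x. B x v) x w) = dd (\<lambda>x. P (B x v)) x w"
        by (rule dd_eqI[symmetric]) (intro bounded_linear.has_derivative[OF bP] smooth_has_derivative[OF sB] x)
      also have "\<dots> = dd (\<lambda>x. P v) x w" using dd_transform[OF W(1) x, of "\<lambda>x. P (B x v)" "\<lambda>x. P v"] PB by simp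
      finally show ?thesis by simp
    qed
    then have "P ?u = 0" by (simp add: lie_bracket_def linear_diff[OF lP])
    then show ?thesis using Bv[OF x uK] BP[OF x, of ?u] linear_0[OF lB[OF x]] by simp
  qed
  obtain \<delta> \<Psi> where \<delta>: "\<delta> > 0" and \<Psi>: "smooth_on (ball 0 \<delta>) \<Psi>" "\<Psi> ` ball 0 \<delta> \<subseteq> W" "\<Psi> 0 = x0"
    and \<Psi>0: "\<And>v. dd \<Psi> 0 v = v - P v + field v x0"
    and \<Psi>w: "\<And>w v. w \<in> ball 0 \<delta> \<Longrightarrow> v - P v = 0 \<Longrightarrow> dd \<Psi> w v = field v (\<Psi> w)"
    by (rule commuting_flow[OF comm]) (assumption, rule that)
  have \<Psi>0: "dd \<Psi> 0 v = v" for v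
  proof -
    have "B x0 v \<in> K x0" using rB[OF W(2)] by blast
    then obtain u where "B x0 v = P u" using rP by blast
    then have "B x0 v = P v" by (metis PB PP W(2))
    then show ?thesis by (simp add: \<Psi>0 fB[OF W(2)])
  qed
  have z: "0 \<in> ball (0::'e) \<delta>" using \<delta> by simp
  have inj: "inj (dd \<Psi> 0)" by (rule injI) (simp add: \<Psi>0)
  obtain U V g where UV: "open U" "U \<subseteq> ball 0 \<delta>" "0 \<in> U" "open V" "\<Psi> 0 \<in> V" "homeomorphism U V \<Psi> g" "smooth_on V g"
    by (rule smooth_inverse_function[OF open_ball z \<Psi>(1) inj]) (rule that)
  have hom: "\<And>w. w \<in> U \<Longrightarrow> \<Psi> w \<in> V" "\<And>w. w \<in> U \<Longrightarrow> g (\<Psi> w) = w" "\<And>y. y \<in> V \<Longrightarrow> g y \<in> U" "\<And>y. y \<in> V \<Longrightarrow> \<Psi> (g y) = y"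
    using UV(6) by (auto simp: homeomorphism_def)
  have gd: "dd g (\<Psi> w) (dd \<Psi> w v) = v" if w: "w \<in> U" for w v
  proof -
    have "((\<lambda>w. g (\<Psi> w)) has_derivative (\<lambda>v. dd g (\<Psi> w) (dd \<Psi> w v))) (at w)"
      by (rule has_derivative_compose[OF smooth_has_derivative[OF \<Psi>(1)] smooth_has_derivative[OF UV(7)]]) (use w UV hom in auto)
    then have "dd g (\<Psi> w) (dd \<Psi> w v) = dd (\<lambda>w. g (\<Psi> w)) w v" by (rule dd_eqI[symmetric])
    also have "\<dots> = dd (\<lambda>w. w) w v" using dd_transform[OF UV(1) w, of "\<lambda>w. g (\<Psi> w)" "\<lambda>w. w"] hom(2) by simp
    finally show ?thesis by simp
  qed
  have VW: "V \<subseteq> W"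
  proof
    fix y assume "y \<in> V"
    then have "g y \<in> ball 0 \<delta>" "\<Psi> (g y) = y" using hom UV(2) by blast+
    then show "y \<in> W" using \<Psi>(2) by (metis image_subset_iff)
  qed
  have df: "dd (\<lambda>x. \<beta> \<bullet> g x) x v = \<beta> \<bullet> dd g x v" if "x \<in> V" for x v
    by (rule dd_eqI) (intro has_derivative_inner_right smooth_has_derivative[OF UV(7)] that)
  show ?thesis
  proof (rule that[of V "\<lambda>x. \<beta> \<bullet> g x"])
    show "open V" "x0 \<in> V" "V \<subseteq> S" using UV \<Psi>(3) VW W by auto
    show "smooth_on V (\<lambda>x. \<beta> \<bullet> g x)" by (intro smooth_inner UV smooth_const)
    show "dd (\<lambda>x. \<beta> \<bullet> g x) x v = 0" if x: "x \<in> V" and v: "v \<in> K x" for x v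
    proof -
      have xW: "x \<in> W" and w: "g x \<in> U" "\<Psi> (g x) = x" using x VW hom by auto
      have "v = B x (P v)" using Bv[OF xW v] BP[OF xW] by simp
      also have "\<dots> = dd \<Psi> (g x) (P v)" using \<Psi>w[of "g x" "P v"] w UV(2) PP fB[OF xW] by auto
      finally have "dd g x v = P v" using gd[OF w(1), of "P v"] w(2) by simp
      moreover have "P v \<in> K x0" using rP by blast
      ultimately show ?thesis using df[OF x] \<beta> by simp
    qed
    show "dd (\<lambda>x. \<beta> \<bullet> g x) x0 v = \<beta> \<bullet> v" for v
      using gd[OF UV(3), of v] df[of x0 v] \<Psi>0 \<Psi>(3) UV(5) by simp
  qed
qed

section \<open>The first two coordinates\<close>
definition gradient :: "('e::euclidean_space \<Rightarrow> real) \<Rightarrow> 'e \<Rightarrow> 'e" where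
  "gradient f x = (\<Sum>b\<in>Basis. dd f x b *\<^sub>R b)"

lemma inner_covector:
  assumes "linear f" shows "(\<Sum>b\<in>Basis. f b *\<^sub>R b) \<bullet> (v::'e::euclidean_space) = (f v :: real)"
proof -
  have "f v = f (\<Sum>b\<in>Basis. (v \<bullet> b) *\<^sub>R b)" by (simp add: euclidean_representation)
  also have "\<dots> = (\<Sum>b\<in>Basis. (v \<bullet> b) * f b)" by (simp add: linear_sum[OF assms] linear_scale[OF assms])
  finally show ?thesis by (simp add: inner_sum_left inner_commute[of v] mult.commute)
qed

lemma gradient: "smooth_on S f \<Longrightarrow> x \<in> S \<Longrightarrow> gradient f x \<bullet> v = dd f x v"
  unfolding gradient_def by (rule inner_covector[OF smooth_linear_dd])

lemma smooth_gradient: "open S \<Longrightarrow> smooth_on S f \<Longrightarrow> smooth_on S (gradient f)"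
  unfolding gradient_def[abs_def] by (intro smooth_sum smooth_scaleR smooth_dd smooth_const)

lemma open_nonzero:
  fixes f :: "'e::euclidean_space \<Rightarrow> real"
  assumes "open W" "smooth_on W f" shows "open {x \<in> W. f x \<noteq> 0}"
proof -
  have "{x \<in> W. f x \<noteq> 0} = W \<inter> f -` (- {0})" by auto
  then show ?thesis using continuous_open_preimage[OF smooth_continuous_on[OF assms(2)] assms(1), of "- {0}"] by auto
qed

lemma hyperplane_decompose:
  fixes F :: "'e::euclidean_space set"
  assumes "subspace F" "subspace H" "F \<subseteq> H" "dim H = dim F + 1" "t \<in> H" "t \<notin> F" "v \<in> H"
  obtains k where "v - k *\<^sub>R t \<in> F"
proof -
  have sF: "span F = F" using assms(1) by (simp add: span_eq_iff)
  have "dim (insert t F) = dim H" using dim_insert[of t F] assms(4,6) sF by simp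
  then have "span (insert t F) = H"
    using assms span_minimal[of "insert t F" H] by (intro subspace_dim_equal) (auto simp: subspace_span)
  then obtain k where "v - k *\<^sub>R t \<in> span F" using assms(7) by (auto simp: span_insert)
  then show ?thesis using that sF by simp
qed

lemma hyperplane_complement:
  fixes F :: "'e::euclidean_space set"
  assumes "dim H = dim F + 1" obtains t where "t \<in> H" "t \<notin> F"
proof -
  have "\<not> H \<subseteq> F" using assms dim_subset[of H F] by auto
  then show ?thesis using that by blast
qed

text \<open>
  A skew form with an isotropic hyperplane is a wedge product of two functionals, one of
  them being the functional that defines the hyperplane. The conclusion is the Pluecker relation, which says the same without naming the factors.
\<close>
lemma skew_decomposable:
  fixes F :: "'e::euclidean_space set" and \<Omega> :: "'e \<Rightarrow> 'e \<Rightarrow> real"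
  assumes F: "subspace F" "subspace H" "F \<subseteq> H" "dim H = dim F + 1"
    and skew: "\<And>v w. \<Omega> v w = - \<Omega> w v" and lin: "\<And>w. linear (\<lambda>v. \<Omega> v w)"
    and iso: "\<And>v w. v \<in> F \<Longrightarrow> w \<in> F \<Longrightarrow> \<Omega> v w = 0"
    and mem: "v \<in> H" "w \<in> H" "a \<in> H" "b \<in> H"
  shows "\<Omega> v w * \<Omega> a b - \<Omega> v a * \<Omega> w b + \<Omega> v b * \<Omega> w a = 0"
proof -
  obtain t where t: "t \<in> H" "t \<notin> F" using hyperplane_complement[OF F(4)] .
  have "\<exists>k. v - k *\<^sub>R t \<in> F" if "v \<in> H" for v by (rule hyperplane_decompose[OF F t that]) blast
  then have "\<forall>v\<in>H. \<exists>k. v - k *\<^sub>R t \<in> F" by blast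
  from bchoice[OF this] obtain l where l': "\<forall>v\<in>H. v - l v *\<^sub>R t \<in> F" ..
  have l: "\<And>v. v \<in> H \<Longrightarrow> v - l v *\<^sub>R t \<in> F" using l' by blast
  have tt: "\<Omega> t t = 0" using skew[of t t] by simp
  have e: "\<Omega> x y = l y * \<Omega> x t - l x * \<Omega> y t" if "x \<in> H" "y \<in> H" for x y
  proof -
    have sub: "\<Omega> (p - c *\<^sub>R q) r = \<Omega> p r - c * \<Omega> q r" for p q r c
      using linear_diff[OF lin[of r], of p "c *\<^sub>R q"] linear_scale[OF lin[of r], of c q] by simp
    have "0 = \<Omega> (x - l x *\<^sub>R t) (y - l y *\<^sub>R t)" using iso l that by simp
    also have "\<dots> = \<Omega> x (y - l y *\<^sub>R t) - l x * \<Omega> t (y - l y *\<^sub>R t)" by (rule sub)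
    also have "\<Omega> x (y - l y *\<^sub>R t) = - (\<Omega> y x - l y * \<Omega> t x)" by (subst skew) (simp add: sub)
    also have "\<Omega> t (y - l y *\<^sub>R t) = - (\<Omega> y t - l y * \<Omega> t t)" by (subst skew) (simp add: sub)
    also have "\<Omega> y x = - \<Omega> x y" by (rule skew)
    also have "\<Omega> t x = - \<Omega> x t" by (rule skew)
    finally show ?thesis using tt by (simp add: algebra_simps)
  qed
  show ?thesis
    unfolding e[OF mem(1,2)] e[OF mem(3,4)] e[OF mem(1,3)] e[OF mem(2,4)] e[OF mem(1,4)] e[OF mem(2,3)]
    by (simp add: algebra_simps)
qed

lemma dim_two_functionals:
  fixes p q :: "'e::euclidean_space"
  assumes det: "(p \<bullet> u) * (q \<bullet> v) - (p \<bullet> v) * (q \<bullet> u) \<noteq> 0"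
  shows "dim {x. p \<bullet> x = 0 \<and> q \<bullet> x = 0} + 2 = DIM('e)" "subspace {x. p \<bullet> x = 0 \<and> q \<bullet> x = 0}"
proof -
  let ?K = "{x \<in> UNIV. p \<bullet> x = 0}" let ?w = "(p \<bullet> v) *\<^sub>R u - (p \<bullet> u) *\<^sub>R v"
  have "p \<bullet> u \<noteq> 0 \<or> p \<bullet> v \<noteq> 0" using det by auto
  then have K: "dim ?K + 1 = DIM('e)" "subspace ?K"
    using dim_kernel_functional[OF subspace_UNIV, of _ p] by (auto simp: dim_UNIV)
  have w: "?w \<in> ?K" "q \<bullet> ?w \<noteq> 0" using det by (auto simp: inner_diff_right mult.commute)
  have e: "{x \<in> ?K. q \<bullet> x = 0} = {x. p \<bullet> x = 0 \<and> q \<bullet> x = 0}" by auto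
  show "dim {x. p \<bullet> x = 0 \<and> q \<bullet> x = 0} + 2 = DIM('e)" "subspace {x. p \<bullet> x = 0 \<and> q \<bullet> x = 0}"
    using dim_kernel_functional[OF K(2) w] K(1) unfolding e by auto
qed

text \<open>
  The derived flag of a Goursat structure, seen in an open subset of the model space. The bracket conditions
  are the two consequences of \<open>F (Suc i) = F i + [F i, F i]\<close> that the construction uses: brackets of sections of
  \<open>F i\<close> lie in \<open>F (Suc i)\<close>, and at every point some bracket leaves \<open>F i\<close>.
\<close>
locale goursat_flag =
  fixes S :: "'e::euclidean_space set" and n :: nat and F :: "nat \<Rightarrow> 'e \<Rightarrow> 'e set"
  assumes DIM: "DIM('e) = n + 3"
    and F_smooth: "i \<le> n + 1 \<Longrightarrow> smooth_distribution S (F i)"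
    and F_dim: "i \<le> n + 1 \<Longrightarrow> x \<in> S \<Longrightarrow> dim (F i x) = i + 2"
    and F_mono: "i \<le> n \<Longrightarrow> x \<in> S \<Longrightarrow> F i x \<subseteq> F (Suc i) x"
    and F_bracket: "i \<le> n \<Longrightarrow> x \<in> W \<Longrightarrow> W \<subseteq> S \<Longrightarrow> section_on (F i) W X \<Longrightarrow> section_on (F i) W Y \<Longrightarrow>
      lie_bracket X Y x \<in> F (Suc i) x"
    and F_nonintegrable: "i \<le> n \<Longrightarrow> x \<in> S \<Longrightarrow> \<exists>W X Y. x \<in> W \<and> W \<subseteq> S \<and> section_on (F i) W X \<and> section_on (F i) W Y \<and>
      lie_bracket X Y x \<notin> F i x"
begin

lemma F_subspace: "i \<le> n + 1 \<Longrightarrow> x \<in> S \<Longrightarrow> subspace (F i x)"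
  using smooth_distributionD(1)[OF F_smooth] by blast

text \<open>
  If \<open>\<alpha>\<close> is normal to \<open>F n x0\<close> and \<open>B x\<close> projects onto \<open>F n x\<close>, the covector \<open>v \<mapsto> \<alpha> \<bullet> (v - B x v)\<close> vanishes on \<open>F n x\<close>.
  It is not zero near \<open>x0\<close>, and so its kernel has the dimension of \<open>F n x\<close>.
\<close>
lemma annihilator:
  assumes x0: "x0 \<in> S"
  obtains W a where "open W" "x0 \<in> W" "W \<subseteq> S" "smooth_on W a" "\<And>x v. x \<in> W \<Longrightarrow> a x \<bullet> v = 0 \<longleftrightarrow> v \<in> F n x"
proof -
  have Fn: "smooth_distribution S (F n)" using F_smooth[of n] by simp
  have dFn: "dim (F n x) = n + 2" if "x \<in> S" for x using F_dim[of n] that by auto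
  obtain W B P where W: "open W" "x0 \<in> W" "W \<subseteq> S" and sB: "\<And>v. smooth_on W (\<lambda>x. B x v)" and lB: "\<And>x. x \<in> W \<Longrightarrow> linear (B x)"
    and rB: "\<And>x. x \<in> W \<Longrightarrow> range (B x) = F n x" and Bv: "\<And>x v. x \<in> W \<Longrightarrow> v \<in> F n x \<Longrightarrow> B x v = v"
    by (rule smooth_distribution_projection[OF Fn dFn x0]) (assumption, rule that)
  have "dim (F n x0) < DIM('e)" using F_dim[of n x0] x0 DIM by simp
  then obtain \<alpha> where \<alpha>: "\<alpha> \<noteq> 0" "\<And>y. y \<in> span (F n x0) \<Longrightarrow> orthogonal \<alpha> y" by (rule orthogonal_to_subspace_exists) (rule that)
  define a where "a x = (\<Sum>b\<in>Basis. (\<alpha> \<bullet> (b - B x b)) *\<^sub>R b)" for x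
  have a: "a x \<bullet> v = \<alpha> \<bullet> (v - B x v)" if "x \<in> W" for x v
    unfolding a_def
    by (rule inner_covector)
      (auto intro!: linearI simp: linear_add[OF lB[OF that]] linear_scale[OF lB[OF that]] inner_add_right inner_diff_right algebra_simps)
  have sa: "smooth_on W a"
    unfolding a_def[abs_def] by (intro smooth_sum smooth_scaleR smooth_inner smooth_diff smooth_const sB W)
  define W' where "W' = {x \<in> W. a x \<bullet> \<alpha> \<noteq> 0}"
  show ?thesis
  proof (rule that[of W' a])
    show "open W'" unfolding W'_def by (intro open_nonzero W smooth_inner sa smooth_const)
    have "B x0 \<alpha> \<in> span (F n x0)" using rB[OF W(2)] by (auto intro: span_base)
    then have "\<alpha> \<bullet> B x0 \<alpha> = 0" using \<alpha>(2) by (simp add: orthogonal_def)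
    then show "x0 \<in> W'" using \<alpha>(1) W by (simp add: W'_def a inner_diff_right)
    show "W' \<subseteq> S" using W by (auto simp: W'_def)
    show "smooth_on W' a" by (rule smooth_subset[OF sa]) (auto simp: W'_def)
    fix x v assume x: "x \<in> W'"
    then have xW: "x \<in> W" "x \<in> S" using W by (auto simp: W'_def)
    have k: "dim {v \<in> UNIV. a x \<bullet> v = 0} + 1 = dim (UNIV :: 'e set)" "subspace {v \<in> UNIV. a x \<bullet> v = 0}"
      using dim_kernel_functional[OF subspace_UNIV, of \<alpha> "a x"] x by (auto simp: W'_def)
    have "F n x = {v \<in> UNIV. a x \<bullet> v = 0}"
    proof (rule subspace_dim_equal[OF F_subspace k(2)])
      show "F n x \<subseteq> {v \<in> UNIV. a x \<bullet> v = 0}" using Bv xW by (auto simp: a)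
      show "dim (F n x) \<ge> dim {v \<in> UNIV. a x \<bullet> v = 0}" using k(1) F_dim[of n x] xW DIM by (simp add: dim_UNIV)
    qed (use xW in auto)
    then show "a x \<bullet> v = 0 \<longleftrightarrow> v \<in> F n x" by auto
  qed
qed

text \<open>
  With \<open>a\<close> an annihilator of \<open>F n\<close>, the form \<open>\<Omega> (X, Y) = a \<bullet> [X, Y]\<close> on \<open>F n\<close> is decomposable, so its kernel \<open>C\<close> is
  cut out of \<open>F n\<close> by the two equations \<open>\<Omega> (v, Y1) = 0\<close> and \<open>\<Omega> (v, Y2) = 0\<close> for sections with
  \<open>\<Omega> (Y1, Y2) \<noteq> 0\<close>. By the Jacobi identity, \<open>C\<close> is involutive. A first integral \<open>\<xi>1\<close> of \<open>C\<close> whose differential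
  is not proportional to \<open>a\<close> cuts out \<open>C' = F n \<inter> ker d\<xi>1\<close>, which contains \<open>C\<close> as a hyperplane; so \<open>\<Omega>\<close>
  vanishes on \<open>C'\<close>, and \<open>C'\<close> is involutive. A first integral \<open>\<xi>2\<close> of \<open>C'\<close> with differential \<open>a\<close> at \<open>x0\<close> completes the pair.
\<close>
theorem first_coordinates:
  assumes x0: "x0 \<in> S"
  obtains W \<xi>1 \<xi>2 where "open W" "x0 \<in> W" "W \<subseteq> S" "smooth_on W (\<xi>1 :: 'e \<Rightarrow> real)" "smooth_on W (\<xi>2 :: 'e \<Rightarrow> real)"
    "\<And>x. x \<in> W \<Longrightarrow> dim {v. dd \<xi>1 x v = 0 \<and> dd \<xi>2 x v = 0} = n + 1"
    "\<And>x. x \<in> W \<Longrightarrow> {v. dd \<xi>1 x v = 0 \<and> dd \<xi>2 x v = 0} \<subseteq> F n x"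
proof -
  let ?H = "F n"
  obtain W1 a where W1: "open W1" "x0 \<in> W1" "W1 \<subseteq> S" and sa: "smooth_on W1 a"
    and a: "\<And>x v. x \<in> W1 \<Longrightarrow> a x \<bullet> v = 0 \<longleftrightarrow> v \<in> ?H x"
    by (rule annihilator[OF x0]) (rule that)
  have H1: "smooth_distribution W1 ?H" by (rule smooth_distribution_subset[OF F_smooth W1(1,3)]) simp
  have subH: "subspace (?H x)" and dimH: "dim (?H x) = n + 2" if "x \<in> W1" for x
    using F_subspace[of n x] F_dim[of n x] that W1 by auto
  define \<Omega> where "\<Omega> x v w = dd a x w \<bullet> v - dd a x v \<bullet> w" for x v w
  have skew: "\<Omega> x v w = - \<Omega> x w v" for x v w by (simp add: \<Omega>_def)
  have lin: "linear (\<lambda>v. \<Omega> x v w)" if "x \<in> W1" for x w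
    unfolding \<Omega>_def using smooth_linear_dd[OF sa that]
    by (auto intro!: linearI simp: linear_add linear_scale inner_add_right inner_add_left algebra_simps)
  have \<Omega>b: "a x \<bullet> lie_bracket X Y x = \<Omega> x (X x) (Y x)"
    if "x \<in> W" "W \<subseteq> W1" "section_on ?H W X" "section_on ?H W Y" for x W X Y
    unfolding \<Omega>_def
    by (rule lie_bracket_annihilator[of W])
      (use that a in \<open>auto simp: section_on_def intro: smooth_subset[OF sa]\<close>)
  have sub1: "section_on K (W \<inter> W1) X" if "section_on K W X" for K W X
    using that W1(1) by (auto simp: section_on_def intro: smooth_subset)
  have nz: "\<exists>v\<in>?H x. \<exists>w\<in>?H x. \<Omega> x v w \<noteq> 0" if x: "x \<in> W1" for x
  proof -
    have "x \<in> S" using x W1(3) by blast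
    from F_nonintegrable[OF order_refl this]
    obtain W X Y where W: "x \<in> W" "W \<subseteq> S" "section_on ?H W X" "section_on ?H W Y" "lie_bracket X Y x \<notin> ?H x"
      by (elim exE conjE) (rule that)
    have xi: "x \<in> W \<inter> W1" using W(1) x by blast
    have "a x \<bullet> lie_bracket X Y x \<noteq> 0" using a[OF x] W(5) by blast
    then have "\<Omega> x (X x) (Y x) \<noteq> 0"
      unfolding \<Omega>b[OF xi Int_lower2 sub1[OF W(3)] sub1[OF W(4)]] .
    moreover have "X x \<in> ?H x" "Y x \<in> ?H x" using W(1,3,4) unfolding section_on_def by blast+
    ultimately show ?thesis by blast
  qed
  \<comment> \<open>The isotropic hyperplane is \<open>F (n - 1)\<close>; for \<open>n = 0\<close> the plane \<open>F 0\<close> has no predecessor, and any line in it will do.\<close>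
  have iso: "\<exists>F'. subspace F' \<and> F' \<subseteq> ?H x \<and> dim F' = n + 1 \<and> (\<forall>v\<in>F'. \<forall>w\<in>F'. \<Omega> x v w = 0)" if x: "x \<in> W1" for x
  proof (cases n)
    case 0
    obtain y where y: "y \<in> ?H x" "y \<noteq> 0"
    proof -
      have "\<not> ?H x \<subseteq> {0}" using dimH[OF x] dim_eq_0[of "?H x"] by simp
      then show ?thesis using that by blast
    qed
    have "\<Omega> x v w = 0" if "v \<in> span {y}" "w \<in> span {y}" for v w
    proof -
      obtain c d where vw: "v = c *\<^sub>R y" "w = d *\<^sub>R y" using \<open>v \<in> span {y}\<close> \<open>w \<in> span {y}\<close> by (auto simp: span_singleton)
      show ?thesis unfolding vw \<Omega>_def using smooth_linear_dd[OF sa x] by (simp add: linear_scale)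
    qed
    moreover have "dim (span {y}) = 1" using y(2) dim_insert[of y "{}"] by (simp add: dim_span)
    moreover have "span {y} \<subseteq> ?H x" using y subH[OF x] by (intro span_minimal) auto
    ultimately show ?thesis using 0 by (intro exI[of _ "span {y}"]) auto
  next
    case (Suc m)
    have xS: "x \<in> S" using x W1 by blast
    have "\<Omega> x v w = 0" if v: "v \<in> F m x" and w: "w \<in> F m x" for v w
    proof -
      have Fm: "smooth_distribution S (F m)" using F_smooth[of m] Suc by simp
      obtain V X where X: "x \<in> V" "V \<subseteq> S" "section_on (F m) V X" "X x = v" using smooth_distributionD(2)[OF Fm xS v] by blast
      obtain V' Y where Y: "x \<in> V'" "V' \<subseteq> S" "section_on (F m) V' Y" "Y x = w" using smooth_distributionD(2)[OF Fm xS w] by blast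
      let ?V = "V \<inter> V' \<inter> W1"
      have V: "x \<in> ?V" "?V \<subseteq> W1" "?V \<subseteq> S" using X Y x W1 by auto
      have XY: "section_on (F m) ?V X" "section_on (F m) ?V Y"
        using X(3) Y(3) W1(1) by (auto simp: section_on_def intro: smooth_subset)
      have "F m y \<subseteq> ?H y" if "y \<in> ?V" for y using F_mono[of m y] Suc V(3) that by auto
      then have Hs: "section_on ?H ?V X" "section_on ?H ?V Y" using XY unfolding section_on_def by blast+
      have "lie_bracket X Y x \<in> ?H x" using F_bracket[OF _ V(1,3) XY] Suc by simp
      then have "a x \<bullet> lie_bracket X Y x = 0" using a[OF x] by blast
      then show ?thesis using \<Omega>b[OF V(1,2) Hs] X Y by simp
    qed
    then show ?thesis
      using F_subspace[of m x] F_dim[of m x] F_mono[of m x] xS Suc by (intro exI[of _ "F m x"]) auto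
  qed
  have pl: "\<Omega> x v w * \<Omega> x b c - \<Omega> x v b * \<Omega> x w c + \<Omega> x v c * \<Omega> x w b = 0"
    if x: "x \<in> W1" and m: "v \<in> ?H x" "w \<in> ?H x" "b \<in> ?H x" "c \<in> ?H x" for x v w b c
  proof -
    obtain F' where F': "subspace F'" "F' \<subseteq> ?H x" "dim F' = n + 1" "\<And>v w. v \<in> F' \<Longrightarrow> w \<in> F' \<Longrightarrow> \<Omega> x v w = 0"
      using iso[OF x] by blast
    have "dim (?H x) = dim F' + 1" using F'(3) dimH[OF x] by simp
    from skew_decomposable[OF F'(1) subH[OF x] F'(2) this skew lin[OF x] F'(4) m] show ?thesis .
  qed
  obtain y1 y2 where y: "y1 \<in> ?H x0" "y2 \<in> ?H x0" "\<Omega> x0 y1 y2 \<noteq> 0" using nz[OF W1(2)] by blast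
  obtain V1 Y1 where Y1: "x0 \<in> V1" "V1 \<subseteq> W1" "section_on ?H V1 Y1" "Y1 x0 = y1" using smooth_distributionD(2)[OF H1 W1(2) y(1)] by blast
  obtain V2 Y2 where Y2: "x0 \<in> V2" "V2 \<subseteq> W1" "section_on ?H V2 Y2" "Y2 x0 = y2" using smooth_distributionD(2)[OF H1 W1(2) y(2)] by blast
  define V where "V = V1 \<inter> V2"
  have oV: "open V" "V \<subseteq> W1" "x0 \<in> V" using Y1 Y2 by (auto simp: V_def section_on_def)
  have HY: "section_on ?H V Y1" "section_on ?H V Y2"
    using Y1 Y2 oV(1) by (auto simp: V_def section_on_def intro: smooth_subset)
  have sY: "smooth_on V Y1" "smooth_on V Y2" and Ym: "\<And>x. x \<in> V \<Longrightarrow> Y1 x \<in> ?H x" "\<And>x. x \<in> V \<Longrightarrow> Y2 x \<in> ?H x"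
    using HY by (auto simp: section_on_def)
  have saV: "smooth_on V a" by (rule smooth_subset[OF sa oV(2)])
  have s\<Omega>: "smooth_on V (\<lambda>x. \<Omega> x (X x) (Y x))" if "smooth_on V X" "smooth_on V Y" for X Y
    unfolding \<Omega>_def by (intro smooth_diff smooth_inner smooth_dd_field oV saV that)
  define \<omega> where "\<omega> Y x = (\<Sum>b\<in>Basis. \<Omega> x b (Y x) *\<^sub>R b)" for Y :: "'e \<Rightarrow> 'e" and x
  have \<omega>: "\<omega> Y x \<bullet> v = \<Omega> x v (Y x)" if "x \<in> V" for Y x v
    unfolding \<omega>_def by (rule inner_covector[OF lin]) (use that oV in auto)
  have s\<omega>: "smooth_on V (\<omega> Y)" if "smooth_on V Y" for Y
    unfolding \<omega>_def[abs_def] by (intro smooth_sum smooth_scaleR s\<Omega> smooth_const that oV)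
  have HV: "smooth_distribution V ?H" by (rule smooth_distribution_subset[OF H1 oV(1,2)])
  have w1: "\<omega> Y2 x0 \<bullet> y1 \<noteq> 0" using y(3) \<omega>[OF oV(3)] Y2(4) by simp
  obtain V3 where V3: "open V3" "x0 \<in> V3" "V3 \<subseteq> V" and K1: "smooth_distribution V3 (\<lambda>x. {v \<in> ?H x. \<omega> Y2 x \<bullet> v = 0})"
    and dK1: "\<And>x. x \<in> V3 \<Longrightarrow> dim {v \<in> ?H x. \<omega> Y2 x \<bullet> v = 0} + 1 = dim (?H x)"
    by (rule smooth_distribution_kernel[OF HV s\<omega>[OF sY(2)] oV(3) y(1) w1]) (rule that)
  have y2K: "y2 \<in> {v \<in> ?H x0. \<omega> Y2 x0 \<bullet> v = 0}" using y \<omega>[OF oV(3)] Y2(4) skew[of x0 y2 y2] by simp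
  have w2: "\<omega> Y1 x0 \<bullet> y2 \<noteq> 0" using y(3) \<omega>[OF oV(3)] Y1(4) skew[of x0 y2 y1] by simp
  let ?C = "\<lambda>x. {v \<in> {v \<in> ?H x. \<omega> Y2 x \<bullet> v = 0}. \<omega> Y1 x \<bullet> v = 0}"
  obtain V4 where V4: "open V4" "x0 \<in> V4" "V4 \<subseteq> V3" and K2: "smooth_distribution V4 ?C"
    and dK2: "\<And>x. x \<in> V4 \<Longrightarrow> dim (?C x) + 1 = dim {v \<in> ?H x. \<omega> Y2 x \<bullet> v = 0}"
    by (rule smooth_distribution_kernel[OF K1 smooth_subset[OF s\<omega>[OF sY(1)] V3(3)] V3(2) y2K w2]) (rule that)
  define V5 where "V5 = {x \<in> V4. \<Omega> x (Y1 x) (Y2 x) \<noteq> 0}"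
  have V5: "open V5" "x0 \<in> V5" "V5 \<subseteq> V4" "V5 \<subseteq> V" "V5 \<subseteq> W1" "V5 \<subseteq> S"
  proof -
    show "open V5" unfolding V5_def
      by (intro open_nonzero V4 smooth_subset[OF s\<Omega>[OF sY]]) (use V3 V4 in auto)
    show "x0 \<in> V5" using V4 y Y1 Y2 by (simp add: V5_def)
    show "V5 \<subseteq> V4" "V5 \<subseteq> V" "V5 \<subseteq> W1" "V5 \<subseteq> S" using V4 V3 oV W1 by (auto simp: V5_def)
  qed
  have C5: "smooth_distribution V5 ?C" by (rule smooth_distribution_subset[OF K2 V5(1,3)])
  have dimC: "dim (?C x) = n" if "x \<in> V5" for x
  proof -
    have "x \<in> V4" "x \<in> V3" "x \<in> W1" using that V5 V4 by auto
    then show ?thesis using dK1[of x] dK2[of x] dimH[of x] by simp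
  qed
  have C0: "\<Omega> x v w = 0" if x: "x \<in> V5" and v: "v \<in> ?C x" and w: "w \<in> ?H x" for x v w
  proof -
    have xx: "x \<in> W1" "x \<in> V" using x V5 by auto
    have "\<Omega> x v (Y1 x) = 0" "\<Omega> x v (Y2 x) = 0" using v \<omega>[OF xx(2)] by auto
    then have "\<Omega> x v w * \<Omega> x (Y1 x) (Y2 x) = 0"
      using pl[OF xx(1) _ w Ym(1)[OF xx(2)] Ym(2)[OF xx(2)], of v] v by simp
    then show ?thesis using x by (simp add: V5_def)
  qed
  have CH: "section_on ?H W X" if "section_on ?C W X" for W X using that by (auto simp: section_on_def)
  \<comment> \<open>\<open>C\<close> consists of the Cauchy characteristics of \<open>F n\<close>: brackets with sections of \<open>F n\<close> stay in \<open>F n\<close>.\<close>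
  have brH: "section_on ?H W (lie_bracket X Y)"
    if "W \<subseteq> V5" "section_on ?C W X" "section_on ?H W Y" for W X Y
    unfolding section_on_def
  proof (intro conjI ballI)
    show "open W" "smooth_on W (lie_bracket X Y)"
      using that by (auto simp: section_on_def intro: smooth_lie_bracket)
    fix y assume y: "y \<in> W"
    have "a y \<bullet> lie_bracket X Y y = \<Omega> y (X y) (Y y)"
      by (rule \<Omega>b[OF y _ CH[OF that(2)] that(3)]) (use that V5 in auto)
    also have "\<dots> = 0" by (rule C0) (use that y in \<open>auto simp: section_on_def\<close>)
    finally show "lie_bracket X Y y \<in> ?H y" using a y that V5 by blast
  qed
  have invC: "lie_bracket X Y x \<in> ?C x"
    if x: "x \<in> W" and W: "W \<subseteq> V5" and X: "section_on ?C W X" and Y: "section_on ?C W Y" for x W X Y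
  proof -
    have WV: "W \<subseteq> W1" "W \<subseteq> V" and oW: "open W" using W V5 X by (auto simp: section_on_def)
    note U = brH[OF W X CH[OF Y]]
    have "\<Omega> x (lie_bracket X Y x) (Z x) = 0" if Z: "section_on ?H W Z" for Z
    proof -
      have "\<Omega> x (lie_bracket X Y x) (Z x) = a x \<bullet> lie_bracket (lie_bracket X Y) Z x"
        by (rule \<Omega>b[OF x WV(1) U Z, symmetric])
      also have "\<dots> = a x \<bullet> (lie_bracket X (lie_bracket Y Z) x - lie_bracket Y (lie_bracket X Z) x)"
        using lie_bracket_jacobi[OF oW x, of X Y Z] X Y Z by (simp add: section_on_def)
      also have "\<dots> = 0"
      proof -
        have "lie_bracket X (lie_bracket Y Z) x \<in> ?H x" "lie_bracket Y (lie_bracket X Z) x \<in> ?H x"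
          using brH[OF W X brH[OF W Y Z]] brH[OF W Y brH[OF W X Z]] x by (auto simp: section_on_def)
        then have "a x \<bullet> lie_bracket X (lie_bracket Y Z) x = 0" "a x \<bullet> lie_bracket Y (lie_bracket X Z) x = 0"
          using a x WV by blast+
        then show ?thesis by (simp add: inner_diff_right)
      qed
      finally show ?thesis .
    qed
    moreover have "section_on ?H W Y1" "section_on ?H W Y2" using section_subset[OF _ oW WV(2)] HY by auto
    ultimately have "\<Omega> x (lie_bracket X Y x) (Y1 x) = 0" "\<Omega> x (lie_bracket X Y x) (Y2 x) = 0" by blast+
    then show ?thesis using U x \<omega> WV by (auto simp: section_on_def)
  qed
  have subC: "subspace (?C x)" if "x \<in> V5" for x using smooth_distributionD(1)[OF C5 that] .
  have spC: "span (?C x0) = ?C x0" by (rule span_eq_iff[THEN iffD2, OF subC[OF V5(2)]])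
  have spH: "span (?H x0) = ?H x0" by (rule span_eq_iff[THEN iffD2, OF subH[OF W1(2)]])
  have "?C x0 \<noteq> ?H x0"
  proof
    assume "?C x0 = ?H x0"
    from arg_cong[OF this, of dim] show False unfolding dimC[OF V5(2)] dimH[OF W1(2)] by simp
  qed
  then have "?C x0 \<subset> ?H x0" by blast
  then have "span (?C x0) \<subset> span (?H x0)" unfolding spC spH .
  \<comment> \<open>A covector inside \<open>F n\<close> and orthogonal to \<open>C\<close> is independent of \<open>a\<close>, which is orthogonal to \<open>F n\<close>.\<close>
  then obtain \<beta> where \<beta>: "\<beta> \<noteq> 0" "\<beta> \<in> span (?H x0)" "\<And>y. y \<in> span (?C x0) \<Longrightarrow> orthogonal \<beta> y"
    by (rule orthogonal_to_subspace_exists_gen) (rule that)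
  have \<beta>H: "\<beta> \<in> ?H x0" using \<beta>(2) unfolding spH .
  have \<beta>C: "\<beta> \<bullet> v = 0" if "v \<in> ?C x0" for v using \<beta>(3)[OF span_base[OF that]] by (simp add: orthogonal_def)
  obtain V6 \<xi>1 where V6: "open V6" "x0 \<in> V6" "V6 \<subseteq> V5" and s1: "smooth_on V6 (\<xi>1 :: 'e \<Rightarrow> real)"
    and \<xi>1C: "\<And>x v. x \<in> V6 \<Longrightarrow> v \<in> ?C x \<Longrightarrow> dd \<xi>1 x v = 0" and \<xi>10: "\<And>v. dd \<xi>1 x0 v = \<beta> \<bullet> v"
    by (rule frobenius_first_integral[OF C5 dimC V5(2) invC \<beta>C]) (assumption+, rule that)
  have H6: "smooth_distribution V6 ?H"
    by (rule smooth_distribution_subset[OF H1 V6(1)]) (use V6 V5 in auto)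
  have g1: "gradient \<xi>1 x0 \<bullet> \<beta> \<noteq> 0" using \<beta>(1) by (simp add: gradient[OF s1 V6(2)] \<xi>10)
  let ?C' = "\<lambda>x. {v \<in> ?H x. gradient \<xi>1 x \<bullet> v = 0}"
  obtain V7 where V7: "open V7" "x0 \<in> V7" "V7 \<subseteq> V6" and C7: "smooth_distribution V7 ?C'"
    and dC': "\<And>x. x \<in> V7 \<Longrightarrow> dim (?C' x) + 1 = dim (?H x)"
    by (rule smooth_distribution_kernel[OF H6 smooth_gradient[OF V6(1) s1] V6(2) \<beta>H g1]) (rule that)
  have V7s: "V7 \<subseteq> V5" "V7 \<subseteq> W1" "V7 \<subseteq> S" using V7 V6 V5 by auto
  have dimC': "dim (?C' x) = n + 1" if "x \<in> V7" for x using dC'[OF that] dimH[of x] that V7s by auto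
  have invC': "lie_bracket X Y x \<in> ?C' x"
    if x: "x \<in> W" and W: "W \<subseteq> V7" and X: "section_on ?C' W X" and Y: "section_on ?C' W Y" for x W X Y
  proof -
    have xx: "x \<in> V7" "x \<in> V5" "x \<in> W1" "x \<in> V6" and oW: "open W" "W \<subseteq> V6" using x W V7 V7s X by (auto simp: section_on_def)
    have HX: "section_on ?H W X" "section_on ?H W Y" using X Y by (auto simp: section_on_def)
    have CC': "?C x \<subseteq> ?C' x" using \<xi>1C[OF xx(4)] by (auto simp: gradient[OF s1 xx(4)])
    have d: "dim (?C' x) = dim (?C x) + 1" using dimC[OF xx(2)] dimC'[OF xx(1)] by simp
    obtain t where t: "t \<in> ?C' x" "t \<notin> ?C x" by (rule hyperplane_complement[OF d])
    have dec: "\<exists>k. v - k *\<^sub>R t \<in> ?C x" if "v \<in> ?C' x" for v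
      by (rule hyperplane_decompose[OF subC[OF xx(2)] smooth_distributionD(1)[OF C7 xx(1)] CC' d t(1,2) that]) blast
    obtain k where k: "X x - k *\<^sub>R t \<in> ?C x" using dec[of "X x"] X x by (auto simp: section_on_def)
    obtain m where m: "Y x - m *\<^sub>R t \<in> ?C x" using dec[of "Y x"] Y x by (auto simp: section_on_def)
    have tH: "t \<in> ?H x" using t by blast
    have YH: "Y x \<in> ?H x" using Y x by (auto simp: section_on_def)
    have sub: "\<Omega> x (p - c *\<^sub>R q) r = \<Omega> x p r - c * \<Omega> x q r" for p q r c
      using linear_diff[OF lin[OF xx(3), of r], of p "c *\<^sub>R q"] linear_scale[OF lin[OF xx(3), of r], of c q] by simp
    have "\<Omega> x (X x) (Y x) = k * \<Omega> x t (Y x)" using C0[OF xx(2) k YH] sub[of "X x" k t "Y x"] by simp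
    also have "\<Omega> x t (Y x) = - \<Omega> x (Y x) t" by (rule skew)
    also have "\<Omega> x (Y x) t = m * \<Omega> x t t" using C0[OF xx(2) m tH] sub[of "Y x" m t t] by simp
    also have "\<Omega> x t t = 0" using skew[of x t t] by simp
    finally have "a x \<bullet> lie_bracket X Y x = 0" using \<Omega>b[OF x _ HX] W V7s by auto
    then have H: "lie_bracket X Y x \<in> ?H x" using a[OF xx(3)] by blast
    have s1W: "smooth_on W \<xi>1" by (rule smooth_subset[OF s1 oW(2)])
    have z: "dd \<xi>1 y (Z y) = 0" if "section_on ?C' W Z" "y \<in> W" for Z y
      using that gradient[OF s1W that(2)] by (auto simp: section_on_def)
    have zz: "dd (\<lambda>y. dd \<xi>1 y (Z y)) x u = 0" if "section_on ?C' W Z" for Z u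
      using fun_cong[OF dd_transform[OF oW(1) x, of "\<lambda>y. dd \<xi>1 y (Z y)" "\<lambda>y. 0"], of u] z[OF that] by simp
    have "dd \<xi>1 x (lie_bracket X Y x) = 0"
      using dd_lie_bracket[OF oW(1) x s1W, of X Y] X Y zz[OF X] zz[OF Y] by (simp add: section_on_def)
    then show ?thesis using H by (simp add: gradient[OF s1 xx(4)])
  qed
  have aC': "a x0 \<bullet> v = 0" if "v \<in> ?C' x0" for v using a[OF W1(2)] that by blast
  obtain V8 \<xi>2 where V8: "open V8" "x0 \<in> V8" "V8 \<subseteq> V7" and s2: "smooth_on V8 (\<xi>2 :: 'e \<Rightarrow> real)"
    and \<xi>2C: "\<And>x v. x \<in> V8 \<Longrightarrow> v \<in> ?C' x \<Longrightarrow> dd \<xi>2 x v = 0" and \<xi>20: "\<And>v. dd \<xi>2 x0 v = a x0 \<bullet> v"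
    by (rule frobenius_first_integral[OF C7 dimC' V7(2) invC' aC']) (assumption+, rule that)
  have s18: "smooth_on V8 \<xi>1" by (rule smooth_subset[OF s1]) (use V8 V7 in auto)
  let ?det = "\<lambda>x. (gradient \<xi>1 x \<bullet> \<beta>) * (gradient \<xi>2 x \<bullet> a x0) - (gradient \<xi>1 x \<bullet> a x0) * (gradient \<xi>2 x \<bullet> \<beta>)"
  define V9 where "V9 = {x \<in> V8. ?det x \<noteq> 0}"
  have a0: "a x0 \<noteq> 0"
  proof
    assume "a x0 = 0"
    then have "?H x0 = UNIV" using a[OF W1(2)] by auto
    then show False using dimH[OF W1(2)] DIM by (simp add: dim_UNIV)
  qed
  have x9: "x0 \<in> V9"
    using V8(2) a0 \<beta>(1) a[OF W1(2), of \<beta>] \<beta>H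
    by (simp add: V9_def gradient[OF s18 V8(2)] gradient[OF s2 V8(2)] \<xi>10 \<xi>20)
  show ?thesis
  proof (rule that[of V9 \<xi>1 \<xi>2])
    show "open V9" unfolding V9_def
      by (intro open_nonzero V8 smooth_diff smooth_mult smooth_inner smooth_gradient s18 s2 smooth_const)
    show "x0 \<in> V9" by (rule x9)
    show "V9 \<subseteq> S" using V8 V7s by (auto simp: V9_def)
    show "smooth_on V9 \<xi>1" "smooth_on V9 \<xi>2"
      by (auto intro: smooth_subset[OF s18] smooth_subset[OF s2] simp: V9_def)
    fix x assume x: "x \<in> V9"
    have xx: "x \<in> V8" "x \<in> V7" "?det x \<noteq> 0" using x V8 by (auto simp: V9_def)
    have e: "{v. dd \<xi>1 x v = 0 \<and> dd \<xi>2 x v = 0} = {v. gradient \<xi>1 x \<bullet> v = 0 \<and> gradient \<xi>2 x \<bullet> v = 0}"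
      by (simp add: gradient[OF s18 xx(1)] gradient[OF s2 xx(1)])
    note d = dim_two_functionals[OF xx(3)]
    show dim1: "dim {v. dd \<xi>1 x v = 0 \<and> dd \<xi>2 x v = 0} = n + 1" unfolding e using d(1) DIM by simp
    have "?C' x = {v. gradient \<xi>1 x \<bullet> v = 0 \<and> gradient \<xi>2 x \<bullet> v = 0}"
    proof (rule subspace_dim_equal[OF smooth_distributionD(1)[OF C7 xx(2)] d(2)])
      show "?C' x \<subseteq> {v. gradient \<xi>1 x \<bullet> v = 0 \<and> gradient \<xi>2 x \<bullet> v = 0}"
        using \<xi>2C[OF xx(1)] by (auto simp: gradient[OF s2 xx(1)])
      show "dim (?C' x) \<ge> dim {v. gradient \<xi>1 x \<bullet> v = 0 \<and> gradient \<xi>2 x \<bullet> v = 0}"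
        using dim1 dimC'[OF xx(2)] unfolding e by simp
    qed
    then show "{v. dd \<xi>1 x v = 0 \<and> dd \<xi>2 x v = 0} \<subseteq> F n x" unfolding e by blast
  qed
qed

end

section \<open>Adapted coordinates\<close>
lemma axis_vec_bij: "bij_betw (axis_vec :: nat \<Rightarrow> 'e::euclidean_space) {..<DIM('e)} Basis"
proof -
  have "\<exists>b. bij_betw b {..<DIM('e)} (Basis :: 'e set)"
    using ex_bij_betw_nat_finite[of "Basis :: 'e set"] by (simp add: atLeast0LessThan)
  then show ?thesis unfolding axis_vec_def by (rule someI_ex)
qed

lemma axis_vec_inner:
  assumes "i < DIM('e)" "j < DIM('e)"
  shows "(axis_vec i :: 'e::euclidean_space) \<bullet> axis_vec j = (if i = j then 1 else 0)"
proof -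
  have "(axis_vec i :: 'e) \<in> Basis" "(axis_vec j :: 'e) \<in> Basis"
    using axis_vec_bij assms by (auto dest: bij_betwE)
  moreover have "(axis_vec i :: 'e) = axis_vec j \<longleftrightarrow> i = j"
    using axis_vec_bij[where 'e='e] assms by (auto simp: bij_betw_def inj_on_def)
  ultimately show ?thesis by (simp add: inner_Basis)
qed

text \<open>The angle between consecutive bodies; the first one is measured against the fixed axis.\<close>
definition bend :: "(nat \<Rightarrow> real) \<Rightarrow> nat \<Rightarrow> real" where
  "bend t k = (if k = 0 then t 0 else t k - t (k - 1))"

text \<open>
  \<open>heading t (Suc n)\<close> is the driving field of the \<open>n\<close>-trailer system, obtained from the previous one by a rotation in
  the plane spanned by it and the next axis. Starting the recursion at the first axis treats the base
  plane like a trailer system of index \<open>- 1\<close>.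
\<close>
primrec heading :: "(nat \<Rightarrow> real) \<Rightarrow> nat \<Rightarrow> 'e::euclidean_space" where
  "heading t 0 = axis_vec 0"
| "heading t (Suc k) = cos (bend t k) *\<^sub>R heading t k + sin (bend t k) *\<^sub>R axis_vec (k + 1)"

lemma heading_cong: "(\<And>i. i < k \<Longrightarrow> s i = t i) \<Longrightarrow> (heading s k :: 'e::euclidean_space) = heading t k"
proof (induction k)
  case (Suc k)
  have "bend s k = bend t k" using Suc.prems by (simp add: bend_def)
  then show ?case using Suc by simp
qed simp

lemma heading_inner_axis:
  assumes "k < j" "j < DIM('e)" shows "(heading t k :: 'e::euclidean_space) \<bullet> axis_vec j = 0"
  using assms by (induction k) (auto simp: axis_vec_inner inner_add_left)

lemma heading_unit:
  assumes "k < DIM('e)" shows "(heading t k :: 'e::euclidean_space) \<bullet> heading t k = 1"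
  using assms
proof (induction k)
  case (Suc k)
  let ?A = "heading t k :: 'e" and ?E = "axis_vec (k + 1) :: 'e"
  have AE: "?A \<bullet> ?E = 0" by (rule heading_inner_axis) (use Suc.prems in auto)
  then have EA: "?E \<bullet> ?A = 0" by (simp add: inner_commute)
  have EE: "?E \<bullet> ?E = 1" using Suc.prems by (simp add: axis_vec_inner)
  have AA: "?A \<bullet> ?A = 1" using Suc by simp
  show ?case
    unfolding heading.simps inner_add_left inner_add_right inner_scaleR_left inner_scaleR_right AE EA EE AA
    using sin_cos_squared_add3[of "bend t k"] by simp
qed (simp add: axis_vec_inner)

lemma smooth_bend: "open W \<Longrightarrow> (\<And>i. i \<le> k \<Longrightarrow> smooth_on W (\<theta> i)) \<Longrightarrow> smooth_on W (\<lambda>y. bend (\<lambda>i. \<theta> i y) k)"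
  by (cases k) (auto simp: bend_def intro: smooth_diff)

lemma smooth_heading:
  assumes W: "open W" and \<theta>: "\<forall>i<k. smooth_on W (\<theta> i)"
  shows "smooth_on W (\<lambda>y. heading (\<lambda>i. \<theta> i y) k :: 'e::euclidean_space)"
  using \<theta>
proof (induction k)
  case (Suc k)
  then have 1: "smooth_on W (\<lambda>y. heading (\<lambda>i. \<theta> i y) k :: 'e)" by simp
  have 2: "smooth_on W (\<lambda>y. bend (\<lambda>i. \<theta> i y) k)" by (rule smooth_bend[OF W]) (use Suc in auto)
  show ?case unfolding heading.simps by (intro smooth_intros W 1 2)
qed (simp add: smooth_const)

lemma dd_rotate:
  fixes A :: "'a::real_normed_vector \<Rightarrow> 'e::euclidean_space"
  assumes x: "x \<in> W" and b: "smooth_on W b" and A: "smooth_on W A"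
  shows "dd (\<lambda>y. cos (b y) *\<^sub>R A y + sin (b y) *\<^sub>R E) x w
    = dd b x w *\<^sub>R (cos (b x) *\<^sub>R E - sin (b x) *\<^sub>R A x) + cos (b x) *\<^sub>R dd A x w"
proof (rule dd_eqI)
  show "((\<lambda>y. cos (b y) *\<^sub>R A y + sin (b y) *\<^sub>R E) has_derivative
    (\<lambda>w. dd b x w *\<^sub>R (cos (b x) *\<^sub>R E - sin (b x) *\<^sub>R A x) + cos (b x) *\<^sub>R dd A x w)) (at x)"
    by (auto intro!: derivative_eq_intros smooth_has_derivative[OF b x] smooth_has_derivative[OF A x]
        simp: algebra_simps fun_eq_iff)
qed

lemma dd_heading_zero:
  assumes W: "open W" "x \<in> W" and \<theta>: "\<forall>i<k. smooth_on W (\<theta> i)" and z: "\<And>i. i < k \<Longrightarrow> dd (\<theta> i) x w = 0"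
  shows "dd (\<lambda>y. heading (\<lambda>i. \<theta> i y) k :: 'e::euclidean_space) x w = 0"
  using \<theta> z
proof (induction k)
  case (Suc k)
  have b: "smooth_on W (\<lambda>y. bend (\<lambda>i. \<theta> i y) k)" by (rule smooth_bend[OF W(1)]) (use Suc in auto)
  have h: "smooth_on W (\<lambda>y. heading (\<lambda>i. \<theta> i y) k :: 'e)" by (rule smooth_heading[OF W(1)]) (use Suc in auto)
  have "dd (\<lambda>y. bend (\<lambda>i. \<theta> i y) k) x w = 0"
  proof (cases k)
    case 0 then show ?thesis using Suc.prems by (simp add: bend_def)
  next
    case (Suc m)
    have "dd (\<lambda>y. \<theta> k y - \<theta> m y) x w = dd (\<theta> k) x w - dd (\<theta> m) x w"
      by (rule dd_eqI) (intro has_derivative_diff smooth_has_derivative[OF Suc.prems(1)[rule_format]] W | use Suc in simp)+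
    then show ?thesis using \<open>k = Suc m\<close> Suc.prems by (simp add: bend_def)
  qed
  then show ?case using Suc by (simp add: dd_rotate[OF W(2) b h])
qed simp

text \<open>
  A planar vector field that does not vanish at \<open>x0\<close> has a smooth argument near \<open>x0\<close>: after rotating its value
  there to the positive real axis, the argument is given by the arc tangent.
\<close>
lemma local_angle:
  fixes \<alpha> \<beta> :: "'e::euclidean_space \<Rightarrow> real"
  assumes W: "open W" "x0 \<in> W" and s: "smooth_on W \<alpha>" "smooth_on W \<beta>" and nz: "\<alpha> x0 \<noteq> 0 \<or> \<beta> x0 \<noteq> 0"
  obtains W' \<psi> where "open W'" "x0 \<in> W'" "W' \<subseteq> W" "smooth_on W' \<psi>"
    "\<And>x. x \<in> W' \<Longrightarrow> \<exists>\<rho>>0. \<alpha> x = \<rho> * cos (\<psi> x) \<and> \<beta> x = \<rho> * sin (\<psi> x)"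
proof -
  define z where "z = Complex (\<alpha> x0) (\<beta> x0)"
  define p where "p = Arg z"
  have z: "cmod z > 0" using nz by (simp add: z_def complex_eq_iff)
  have rz: "\<alpha> x0 = cmod z * cos p" "\<beta> x0 = cmod z * sin p"
    using rcis_cmod_Arg[of z] unfolding p_def z_def by (metis Re_rcis complex.sel(1), metis Im_rcis complex.sel(2))
  define a where "a x = cos p * \<alpha> x + sin p * \<beta> x" for x
  define b where "b x = cos p * \<beta> x - sin p * \<alpha> x" for x
  have sab: "smooth_on W a" "smooth_on W b"
    unfolding a_def[abs_def] b_def[abs_def] by (intro smooth_intros W s)+
  have "a x0 = cmod z * (cos p * cos p + sin p * sin p)" unfolding a_def rz by (simp only: algebra_simps)
  then have a0: "a x0 > 0" using z by (simp only: sin_cos_squared_add3)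
  define W' where "W' = W \<inter> a -` {0<..}"
  have W': "open W'" unfolding W'_def
    by (rule continuous_open_preimage[OF smooth_continuous_on[OF sab(1)] W(1)]) simp
  show ?thesis
  proof (rule that[of W' "\<lambda>x. p + arctan (b x / a x)"])
    show "x0 \<in> W'" "W' \<subseteq> W" using W a0 by (auto simp: W'_def)
    show "smooth_on W' (\<lambda>x. p + arctan (b x / a x))"
      by (intro smooth_add smooth_const smooth_arctan smooth_divide W' smooth_subset[OF sab(1)] smooth_subset[OF sab(2)])
        (auto simp: W'_def)
    fix x assume "x \<in> W'"
    then have ax: "a x > 0" by (simp add: W'_def)
    let ?u = "b x / a x"
    let ?\<rho> = "a x * sqrt (1 + ?u\<^sup>2)"
    have s0: "sqrt (1 + ?u\<^sup>2) > 0" by (simp add: add_pos_nonneg)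
    have c: "?\<rho> * cos (arctan ?u) = a x" using s0 by (simp add: cos_arctan)
    have s: "?\<rho> * sin (arctan ?u) = b x" using s0 ax by (simp add: sin_arctan)
    have q: "cos p * cos p + sin p * sin p = 1" using sin_cos_squared_add3[of p] by simp
    have "?\<rho> * cos (p + arctan ?u) = cos p * (?\<rho> * cos (arctan ?u)) - sin p * (?\<rho> * sin (arctan ?u))"
      unfolding cos_add by (simp only: algebra_simps)
    also have "\<dots> = \<alpha> x * (cos p * cos p + sin p * sin p)" unfolding c s by (simp only: a_def b_def algebra_simps)
    finally have 1: "\<alpha> x = ?\<rho> * cos (p + arctan ?u)" using q by simp
    have "?\<rho> * sin (p + arctan ?u) = sin p * (?\<rho> * cos (arctan ?u)) + cos p * (?\<rho> * sin (arctan ?u))"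
      unfolding sin_add by (simp only: algebra_simps)
    also have "\<dots> = \<beta> x * (cos p * cos p + sin p * sin p)" unfolding c s by (simp only: a_def b_def algebra_simps)
    finally have 2: "\<beta> x = ?\<rho> * sin (p + arctan ?u)" using q by simp
    show "\<exists>\<rho>>0. \<alpha> x = \<rho> * cos (p + arctan ?u) \<and> \<beta> x = \<rho> * sin (p + arctan ?u)"
      using 1 2 ax s0 by (intro exI[of _ ?\<rho>]) simp
  qed (rule W')
qed

definition partial_coords ::
  "('e::euclidean_space \<Rightarrow> real) \<Rightarrow> ('e \<Rightarrow> real) \<Rightarrow> (nat \<Rightarrow> 'e \<Rightarrow> real) \<Rightarrow> nat \<Rightarrow> 'e \<Rightarrow> 'e" where
  "partial_coords \<xi>1 \<xi>2 \<theta> k x =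
     \<xi>1 x *\<^sub>R axis_vec 0 + \<xi>2 x *\<^sub>R axis_vec 1 + (\<Sum>i<k. \<theta> i x *\<^sub>R axis_vec (i + 2))"

lemma smooth_partial_coords:
  assumes "open W" "smooth_on W \<xi>1" "smooth_on W \<xi>2" "\<forall>i<k. smooth_on W (\<theta> i)"
  shows "smooth_on W (partial_coords \<xi>1 \<xi>2 \<theta> k)"
  unfolding partial_coords_def[abs_def] by (intro smooth_add smooth_sum smooth_scaleR smooth_const assms(1-3) assms(4)[rule_format]) simp

lemma dd_partial_coords:
  assumes x: "x \<in> W" and s: "smooth_on W \<xi>1" "smooth_on W \<xi>2" "\<forall>i<k. smooth_on W (\<theta> i)"
  shows "dd (partial_coords \<xi>1 \<xi>2 \<theta> k) x v
    = dd \<xi>1 x v *\<^sub>R axis_vec 0 + dd \<xi>2 x v *\<^sub>R axis_vec 1 + (\<Sum>i<k. dd (\<theta> i) x v *\<^sub>R axis_vec (i + 2))"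
  unfolding partial_coords_def[abs_def]
  by (rule dd_eqI) (intro has_derivative_add has_derivative_sum has_derivative_scaleR_left smooth_has_derivative[OF _ x] s(1,2) s(3)[rule_format], simp)

lemma dd_partial_coords_inner:
  assumes x: "x \<in> W" and s: "smooth_on W \<xi>1" "smooth_on W \<xi>2" "\<forall>i<k. smooth_on W (\<theta> i)" and k: "k + 2 \<le> DIM('e)"
  shows "dd (partial_coords \<xi>1 \<xi>2 \<theta> k :: 'e::euclidean_space \<Rightarrow> 'e) x v \<bullet> axis_vec 0 = dd \<xi>1 x v"
    "dd (partial_coords \<xi>1 \<xi>2 \<theta> k) x v \<bullet> axis_vec 1 = dd \<xi>2 x v"
    "i < k \<Longrightarrow> dd (partial_coords \<xi>1 \<xi>2 \<theta> k) x v \<bullet> axis_vec (i + 2) = dd (\<theta> i) x v"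
    "k + 2 \<le> j \<Longrightarrow> j < DIM('e) \<Longrightarrow> dd (partial_coords \<xi>1 \<xi>2 \<theta> k) x v \<bullet> axis_vec j = 0"
proof -
  have D: "0 < DIM('e)" "1 < DIM('e)" using k by auto
  have sm: "(\<Sum>i<k. dd (\<theta> i) x v *\<^sub>R axis_vec (i + 2)) \<bullet> (axis_vec j :: 'e) = (\<Sum>i<k. if i + 2 = j then dd (\<theta> i) x v else 0)"
    if "j < DIM('e)" for j
    unfolding inner_sum_left by (intro sum.cong refl) (use that k in \<open>auto simp: axis_vec_inner\<close>)
  show "dd (partial_coords \<xi>1 \<xi>2 \<theta> k :: 'e \<Rightarrow> 'e) x v \<bullet> axis_vec 0 = dd \<xi>1 x v"
    unfolding dd_partial_coords[OF x s(1,2) s(3)] inner_add_left sm[OF D(1)] using D by (simp add: axis_vec_inner)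
  show "dd (partial_coords \<xi>1 \<xi>2 \<theta> k :: 'e \<Rightarrow> 'e) x v \<bullet> axis_vec 1 = dd \<xi>2 x v"
    unfolding dd_partial_coords[OF x s(1,2) s(3)] inner_add_left sm[OF D(2)] using D by (simp add: axis_vec_inner)
  show "dd (partial_coords \<xi>1 \<xi>2 \<theta> k :: 'e \<Rightarrow> 'e) x v \<bullet> axis_vec (i + 2) = dd (\<theta> i) x v" if "i < k"
  proof -
    have "i + 2 < DIM('e)" using that k by simp
    then show ?thesis
      unfolding dd_partial_coords[OF x s(1,2) s(3)] inner_add_left sm[OF \<open>i + 2 < DIM('e)\<close>] using D that by (simp add: axis_vec_inner)
  qed
  show "dd (partial_coords \<xi>1 \<xi>2 \<theta> k :: 'e \<Rightarrow> 'e) x v \<bullet> axis_vec j = 0" if "k + 2 \<le> j" "j < DIM('e)"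
    unfolding dd_partial_coords[OF x s(1,2) s(3)] inner_add_left sm[OF that(2)] using D that by (simp add: axis_vec_inner)
qed

lemma dd_partial_coords_eq_0:
  assumes "x \<in> W" "smooth_on W \<xi>1" "smooth_on W \<xi>2" "\<forall>i<k. smooth_on W (\<theta> i)" "k + 2 \<le> DIM('e)"
  shows "dd (partial_coords \<xi>1 \<xi>2 \<theta> k :: 'e::euclidean_space \<Rightarrow> 'e) x v = 0 \<longleftrightarrow>
    dd \<xi>1 x v = 0 \<and> dd \<xi>2 x v = 0 \<and> (\<forall>i<k. dd (\<theta> i) x v = 0)" (is "?L \<longleftrightarrow> ?R")
proof
  assume z: ?L
  show ?R
    using dd_partial_coords_inner(1)[OF assms, where v=v, unfolded z] dd_partial_coords_inner(2)[OF assms, where v=v, unfolded z]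
      dd_partial_coords_inner(3)[OF assms, where v=v, unfolded z] by auto
next
  assume ?R
  then show ?L by (subst dd_partial_coords[OF assms(1-4)]) auto
qed

context goursat_flag
begin

text \<open>
  The state of the induction after \<open>k\<close> angles. The last condition makes \<open>F (n - k)\<close> the preimage of a line, and
  this line defines the next angle.
\<close>
definition adapted :: "nat \<Rightarrow> 'e set \<Rightarrow> ('e \<Rightarrow> real) \<Rightarrow> ('e \<Rightarrow> real) \<Rightarrow> (nat \<Rightarrow> 'e \<Rightarrow> real) \<Rightarrow> bool" where
  "adapted k W \<xi>1 \<xi>2 \<theta> \<longleftrightarrow> open W \<and> W \<subseteq> S \<and> smooth_on W \<xi>1 \<and> smooth_on W \<xi>2 \<and> (\<forall>i<k. smooth_on W (\<theta> i)) \<and>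
     (\<forall>x\<in>W. dim {v. dd (partial_coords \<xi>1 \<xi>2 \<theta> k :: 'e \<Rightarrow> 'e) x v = 0} = n + 1 - k \<and>
        F (n + 1 - k) x = {v. dd (partial_coords \<xi>1 \<xi>2 \<theta> k :: 'e \<Rightarrow> 'e) x v \<in> span {heading (\<lambda>i. \<theta> i x) k, axis_vec (k + 1)}} \<and>
        (k \<le> n \<longrightarrow> {v. dd (partial_coords \<xi>1 \<xi>2 \<theta> k :: 'e \<Rightarrow> 'e) x v = 0} \<subseteq> F (n - k) x))"

lemma adapted_0:
  assumes "x0 \<in> S" obtains W \<xi>1 \<xi>2 where "x0 \<in> W" "adapted 0 W \<xi>1 \<xi>2 \<theta>"
proof -
  obtain W \<xi>1 \<xi>2 where W: "open W" "x0 \<in> W" "W \<subseteq> S" and s: "smooth_on W (\<xi>1 :: 'e \<Rightarrow> real)" "smooth_on W (\<xi>2 :: 'e \<Rightarrow> real)"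
    and d: "\<And>x. x \<in> W \<Longrightarrow> dim {v. dd \<xi>1 x v = 0 \<and> dd \<xi>2 x v = 0} = n + 1"
    and sub: "\<And>x. x \<in> W \<Longrightarrow> {v. dd \<xi>1 x v = 0 \<and> dd \<xi>2 x v = 0} \<subseteq> F n x"
    by (rule first_coordinates[OF assms]) (rule that)
  show ?thesis
  proof (rule that[OF W(2)], unfold adapted_def, intro conjI ballI impI)
    fix x assume x: "x \<in> W"
    have z: "dd (partial_coords \<xi>1 \<xi>2 \<theta> 0 :: 'e \<Rightarrow> 'e) x v = 0 \<longleftrightarrow> dd \<xi>1 x v = 0 \<and> dd \<xi>2 x v = 0" for v
      by (subst dd_partial_coords_eq_0[OF x s]) (auto simp: DIM)
    show "dim {v. dd (partial_coords \<xi>1 \<xi>2 \<theta> 0 :: 'e \<Rightarrow> 'e) x v = 0} = n + 1 - 0" unfolding z using d[OF x] by simp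
    show "{v. dd (partial_coords \<xi>1 \<xi>2 \<theta> 0 :: 'e \<Rightarrow> 'e) x v = 0} \<subseteq> F (n - 0) x" unfolding z using sub[OF x] by simp
    have "dim (F (n + 1) x) = DIM('e)" using F_dim[of "n + 1" x] x W DIM by auto
    then have "F (n + 1) x = UNIV"
      using F_subspace[of "n + 1" x] x W by (metis dim_eq_full span_eq_iff order_refl subsetD)
    moreover have "dd (partial_coords \<xi>1 \<xi>2 \<theta> 0 :: 'e \<Rightarrow> 'e) x v \<in> span {heading (\<lambda>i. \<theta> i x) 0, axis_vec (0 + 1)}" for v
    proof -
      have "dd (partial_coords \<xi>1 \<xi>2 \<theta> 0 :: 'e \<Rightarrow> 'e) x v = dd \<xi>1 x v *\<^sub>R axis_vec 0 + dd \<xi>2 x v *\<^sub>R axis_vec 1"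
        by (subst dd_partial_coords[OF x s]) auto
      then show ?thesis by (simp only:) (intro span_add span_scale span_base, auto)
    qed
    ultimately show "F (n + 1 - 0) x = {v. dd (partial_coords \<xi>1 \<xi>2 \<theta> 0 :: 'e \<Rightarrow> 'e) x v \<in> span {heading (\<lambda>i. \<theta> i x) 0, axis_vec (0 + 1)}}"
      by simp
  qed (use W s in auto)
qed

text \<open>
  Let \<open>h\<close> be the coordinates found so far, \<open>H = F (n - k)\<close> and \<open>N = ker dh\<close>. Since \<open>N\<close> has corank one in \<open>H\<close>, the
  image \<open>dh H\<close> is a line in the plane of \<open>A\<close> and \<open>E\<close>, spanned by \<open>G = cos \<psi> A + sin \<psi> E\<close>. With \<open>dh v = \<mu> v G\<close> on
  \<open>H\<close>, the bracket of two sections of \<open>H\<close> is \<open>- (\<mu> \<and> d\<psi>) (X, Y)\<close> times the normal \<open>cos \<psi> E - sin \<psi> A\<close>, modulo \<open>G\<close> (fact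
  \<open>star\<close>). As \<open>H\<close> is not integrable, \<open>d\<psi>\<close> is not zero on \<open>N\<close> (fact \<open>ex\<close>), so the new angle is independent of
  the old coordinates. As \<open>F (n - k - 1)\<close> is an isotropic hyperplane of \<open>H\<close>, it contains the kernel of \<open>\<mu> \<and> d\<psi>\<close>.
\<close>
lemma adapted_Suc:
  assumes k: "k \<le> n" and ad: "adapted k W \<xi>1 \<xi>2 \<theta>" and x0: "x0 \<in> W"
  obtains W' \<theta>' where "x0 \<in> W'" "adapted (Suc k) W' \<xi>1 \<xi>2 \<theta>'"
proof -
  let ?h = "partial_coords \<xi>1 \<xi>2 \<theta> k :: 'e \<Rightarrow> 'e"
  define H where "H = F (n - k)"
  define A where "A x = (heading (\<lambda>i. \<theta> i x) k :: 'e)" for x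
  define E where "E = (axis_vec (k + 1) :: 'e)"
  define N where "N x = {v. dd ?h x v = 0}" for x
  have W: "open W" "W \<subseteq> S" and s: "smooth_on W \<xi>1" "smooth_on W \<xi>2" "\<forall>i<k. smooth_on W (\<theta> i)"
    using ad by (auto simp: adapted_def)
  have D: "k + 3 \<le> DIM('e)" "k + 2 \<le> DIM('e)" "k + 1 < DIM('e)" "k < DIM('e)" "k + 2 < DIM('e)" using k DIM by auto
  have nk: "n + 1 - k = Suc (n - k)" using k by simp
  have dN: "dim (N x) = Suc (n - k)" and FN: "F (Suc (n - k)) x = {v. dd ?h x v \<in> span {A x, E}}" and NH: "N x \<subseteq> H x"
    if "x \<in> W" for x
    using ad that k unfolding adapted_def N_def A_def E_def H_def nk by auto
  have H: "smooth_distribution S H" "\<And>x. x \<in> S \<Longrightarrow> subspace (H x)" "\<And>x. x \<in> S \<Longrightarrow> dim (H x) = n - k + 2"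
    using F_smooth[of "n - k"] F_subspace[of "n - k"] F_dim[of "n - k"] by (auto simp: H_def)
  have sh: "smooth_on W ?h" by (rule smooth_partial_coords[OF W(1) s])
  have lh: "linear (dd ?h x)" if "x \<in> W" for x by (rule smooth_linear_dd[OF sh that])
  have subN: "subspace (N x)" if "x \<in> W" for x
    unfolding N_def using lh[OF that] by (auto simp: subspace_def linear_0 linear_add linear_scale)
  have sA: "smooth_on W A" unfolding A_def[abs_def] by (rule smooth_heading[OF W(1) s(3)])
  have AA: "A x \<bullet> A x = 1" and AE: "A x \<bullet> E = 0" "E \<bullet> A x = 0" and EE: "E \<bullet> E = 1" for x
    unfolding A_def E_def using heading_unit[OF D(4)] heading_inner_axis[OF _ D(3), of k] D(3)
    by (auto simp: axis_vec_inner inner_commute)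
  have dA: "dd A x w = 0" if "x \<in> W" "w \<in> N x" for x w
    unfolding A_def[abs_def]
    by (rule dd_heading_zero[OF W(1) that(1) s(3)])
      (use that(2) dd_partial_coords_eq_0[OF that(1) s D(2), of w] in \<open>auto simp: N_def\<close>)
  have x0S: "x0 \<in> S" using x0 W by blast
  have dHN: "dim (H x) = dim (N x) + 1" if "x \<in> W" for x using H(3)[of x] dN[OF that] that W by auto
  obtain v0 where v0: "v0 \<in> H x0" "v0 \<notin> N x0" by (rule hyperplane_complement[OF dHN[OF x0]])
  obtain V0 Z where V0: "x0 \<in> V0" "V0 \<subseteq> S" "section_on H V0 Z" "Z x0 = v0" using smooth_distributionD(2)[OF H(1) x0S v0(1)] by blast
  define W1 where "W1 = W \<inter> V0"
  have W1: "open W1" "x0 \<in> W1" "W1 \<subseteq> W" "W1 \<subseteq> S" using W V0 x0 by (auto simp: W1_def section_on_def)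
  have Z: "smooth_on W1 Z" "\<And>y. y \<in> W1 \<Longrightarrow> Z y \<in> H y" using V0 smooth_subset[of V0 Z W1] by (auto simp: W1_def section_on_def)
  define \<alpha> where "\<alpha> x = dd ?h x (Z x) \<bullet> A x" for x
  define \<beta> where "\<beta> x = dd ?h x (Z x) \<bullet> E" for x
  have shZ: "smooth_on W1 (\<lambda>x. dd ?h x (Z x))"
    by (rule smooth_dd_field[OF W1(1) smooth_subset[OF sh W1(3)] Z(1)])
  have s\<alpha>\<beta>: "smooth_on W1 \<alpha>" "smooth_on W1 \<beta>"
    unfolding \<alpha>_def[abs_def] \<beta>_def[abs_def] by (intro smooth_inner W1 shZ smooth_subset[OF sA] smooth_const)+
  have HF: "H x \<subseteq> F (Suc (n - k)) x" if "x \<in> S" for x using F_mono[of "n - k" x] that by (simp add: H_def)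
  have comb: "dd ?h x v = (dd ?h x v \<bullet> A x) *\<^sub>R A x + (dd ?h x v \<bullet> E) *\<^sub>R E" if "x \<in> W" "v \<in> H x" for x v
  proof -
    have "dd ?h x v \<in> span {A x, E}" using HF[of x] FN[OF that(1)] that W by auto
    then obtain c d where cd: "dd ?h x v = c *\<^sub>R A x + d *\<^sub>R E"
      by (auto simp: span_insert span_singleton algebra_simps)
    then have "dd ?h x v \<bullet> A x = c" "dd ?h x v \<bullet> E = d" by (simp_all add: inner_add_left AA AE EE)
    then show ?thesis using cd by simp
  qed
  have nz: "\<alpha> x0 \<noteq> 0 \<or> \<beta> x0 \<noteq> 0"
    using comb[OF x0 v0(1)] v0(2) V0(4) by (auto simp: \<alpha>_def \<beta>_def N_def)
  obtain W' \<psi> where W': "open W'" "x0 \<in> W'" "W' \<subseteq> W1" and s\<psi>: "smooth_on W' \<psi>"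
    and polar: "\<And>x. x \<in> W' \<Longrightarrow> \<exists>\<rho>>0. \<alpha> x = \<rho> * cos (\<psi> x) \<and> \<beta> x = \<rho> * sin (\<psi> x)"
    by (rule local_angle[OF W1(1,2) s\<alpha>\<beta> nz]) (rule that)
  have W'W: "W' \<subseteq> W" "W' \<subseteq> S" using W' W1 by auto
  have s': "smooth_on W' \<xi>1" "smooth_on W' \<xi>2" "\<forall>i<k. smooth_on W' (\<theta> i)" "smooth_on W' ?h" "smooth_on W' A"
    using s sh sA smooth_subset[OF _ W'W(1)] by auto
  \<comment> \<open>The angle of the line relative to the previous heading is the difference of consecutive trailer angles.\<close>
  define \<theta>k where "\<theta>k x = (if k = 0 then \<psi> x else \<psi> x + \<theta> (k - 1) x)" for x
  define \<theta>' where "\<theta>' = \<theta>(k := \<theta>k)"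
  have s\<theta>k: "smooth_on W' \<theta>k"
    unfolding \<theta>k_def[abs_def] using s\<psi> s'(3)[rule_format, of "k - 1"] by (cases "k = 0") (auto intro: smooth_add W')
  have s\<theta>': "smooth_on W' (\<theta>' i)" if "i < Suc k" for i
    using that s\<theta>k s'(3)[rule_format, of i] by (auto simp: \<theta>'_def less_Suc_eq)
  then have s\<theta>'A: "\<forall>i<Suc k. smooth_on W' (\<theta>' i)" by blast
  have bnd: "bend (\<lambda>i. \<theta>' i x) k = \<psi> x" for x
    by (cases k) (auto simp: bend_def \<theta>'_def \<theta>k_def)
  have A': "heading (\<lambda>i. \<theta>' i x) k = A x" for x
    unfolding A_def by (rule heading_cong) (simp add: \<theta>'_def)
  define G where "G x = cos (\<psi> x) *\<^sub>R A x + sin (\<psi> x) *\<^sub>R E" for x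
  define Nr where "Nr x = cos (\<psi> x) *\<^sub>R E - sin (\<psi> x) *\<^sub>R A x" for x
  have G: "heading (\<lambda>i. \<theta>' i x) (Suc k) = G x" for x by (simp add: bnd A' G_def E_def)
  have cs: "cos p * cos p + sin p * sin p = 1" "sin p * sin p + cos p * cos p = 1" for p :: real
    using sin_cos_squared_add3[of p] by (simp_all only: add.commute)
  have GG: "G x \<bullet> G x = 1" and GN: "G x \<bullet> Nr x = 0" "Nr x \<bullet> G x = 0" and NN: "Nr x \<bullet> Nr x = 1" for x
    by (simp_all add: G_def Nr_def inner_add_left inner_add_right inner_diff_left inner_diff_right AA AE EE cs)
  have hZ: "\<exists>\<rho>>0. dd ?h x (Z x) = \<rho> *\<^sub>R G x" if x: "x \<in> W'" for x
  proof -
    obtain \<rho> where \<rho>: "\<rho> > 0" "\<alpha> x = \<rho> * cos (\<psi> x)" "\<beta> x = \<rho> * sin (\<psi> x)" using polar[OF x] by blast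
    have "dd ?h x (Z x) = \<alpha> x *\<^sub>R A x + \<beta> x *\<^sub>R E"
      using comb[of x "Z x"] Z(2)[of x] x W' W1 by (auto simp: \<alpha>_def \<beta>_def)
    then show ?thesis using \<rho> by (intro exI[of _ \<rho>]) (simp add: G_def scaleR_add_right)
  qed
  have ZN: "Z x \<notin> N x" if "x \<in> W'" for x
  proof -
    obtain \<rho> where "\<rho> > 0" "dd ?h x (Z x) = \<rho> *\<^sub>R G x" using hZ[OF \<open>x \<in> W'\<close>] by blast
    then show ?thesis using GG[of x] by (auto simp: N_def)
  qed
  have H_iff: "v \<in> H x \<longleftrightarrow> (\<exists>c. dd ?h x v = c *\<^sub>R G x)" if x: "x \<in> W'" for x v
  proof
    have xx: "x \<in> W" "x \<in> S" "x \<in> W1" using x W' W'W by auto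
    obtain \<rho> where \<rho>: "\<rho> > 0" "dd ?h x (Z x) = \<rho> *\<^sub>R G x" using hZ[OF x] by blast
    show "\<exists>c. dd ?h x v = c *\<^sub>R G x" if v: "v \<in> H x"
    proof -
      obtain c where "v - c *\<^sub>R Z x \<in> N x"
        by (rule hyperplane_decompose[OF subN[OF xx(1)] H(2)[OF xx(2)] NH[OF xx(1)] dHN[OF xx(1)] Z(2)[OF xx(3)] ZN[OF x] v])
      then have "dd ?h x v = c *\<^sub>R dd ?h x (Z x)" using lh[OF xx(1)] by (simp add: N_def linear_diff linear_scale)
      then show ?thesis using \<rho>(2) by auto
    qed
    assume "\<exists>c. dd ?h x v = c *\<^sub>R G x"
    then obtain c where c: "dd ?h x v = c *\<^sub>R G x" ..
    have "v - (c / \<rho>) *\<^sub>R Z x \<in> N x" using lh[OF xx(1)] \<rho> by (simp add: N_def linear_diff linear_scale c)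
    then have "v - (c / \<rho>) *\<^sub>R Z x \<in> H x" using NH[OF xx(1)] by blast
    from subspace_add[OF H(2)[OF xx(2)] this subspace_scale[OF H(2)[OF xx(2)] Z(2)[OF xx(3)], of "c / \<rho>"]]
    show "v \<in> H x" by simp
  qed
  define \<mu> where "\<mu> x v = dd ?h x v \<bullet> G x" for x v
  have \<mu>: "dd ?h x v = \<mu> x v *\<^sub>R G x" if "x \<in> W'" "v \<in> H x" for x v
    using H_iff[OF that(1)] that(2) GG[of x] by (auto simp: \<mu>_def)
  have dG: "dd G x w = dd \<psi> x w *\<^sub>R Nr x" if "x \<in> W'" "w \<in> N x" for x w
    unfolding G_def[abs_def] Nr_def dd_rotate[OF that(1) s\<psi> s'(5)] using dA[of x w] that W'W by auto
  have sG: "smooth_on W' G" unfolding G_def[abs_def] by (intro smooth_intros W' s\<psi> s')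
  have l\<psi>: "linear (dd \<psi> x)" if "x \<in> W'" for x by (rule smooth_linear_dd[OF s\<psi> that])
  have star: "dd ?h x (lie_bracket X Y x) \<bullet> Nr x = \<mu> x (Y x) * dd \<psi> x (X x) - \<mu> x (X x) * dd \<psi> x (Y x)"
      "lie_bracket X Y x \<in> H x \<longleftrightarrow> dd ?h x (lie_bracket X Y x) \<bullet> Nr x = 0"
    if x: "x \<in> W'" "x \<in> V" and X: "section_on H V X" and Y: "section_on H V Y" for x V X Y
  proof -
    define U where "U = V \<inter> W'"
    have U: "open U" "x \<in> U" "U \<subseteq> W'" using X W' x by (auto simp: U_def section_on_def)
    have sec: "smooth_on U T" "\<And>y. y \<in> U \<Longrightarrow> T y \<in> H y" if "section_on H V T" for T
      using that smooth_subset[of V T U] by (auto simp: U_def section_on_def)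
    have shU: "smooth_on U ?h" and sGU: "smooth_on U G" using smooth_subset[OF _ U(3)] s' sG by auto
    have s\<mu>: "smooth_on U (\<lambda>y. \<mu> y (T y))" if "section_on H V T" for T
      unfolding \<mu>_def by (intro smooth_inner smooth_dd_field U shU sGU sec[OF that])
    have dT: "dd (\<lambda>y. dd ?h y (T y)) x u = \<mu> x (T x) *\<^sub>R dd G x u + dd (\<lambda>y. \<mu> y (T y)) x u *\<^sub>R G x" if T: "section_on H V T" for T u
    proof -
      have "dd (\<lambda>y. dd ?h y (T y)) x u = dd (\<lambda>y. \<mu> y (T y) *\<^sub>R G y) x u"
        by (rule fun_cong[OF dd_transform[OF U(1,2)]]) (use \<mu> sec(2)[OF T] U in auto)
      also have "\<dots> = \<mu> x (T x) *\<^sub>R dd G x u + dd (\<lambda>y. \<mu> y (T y)) x u *\<^sub>R G x"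
        by (rule dd_eqI) (intro has_derivative_scaleR smooth_has_derivative[OF s\<mu>[OF T]] smooth_has_derivative[OF sGU] U)
      finally show ?thesis .
    qed
    let ?w = "\<mu> x (Y x) *\<^sub>R X x - \<mu> x (X x) *\<^sub>R Y x"
    have xW: "x \<in> W" using x W'W by blast
    \<comment> \<open>The derivatives of \<open>G\<close> enter only along this combination, which lies in \<open>N\<close>; there only \<open>\<psi>\<close> varies.\<close>
    have "dd ?h x ?w = 0"
      using \<mu>[OF x(1), of "X x"] \<mu>[OF x(1), of "Y x"] sec(2)[OF X U(2)] sec(2)[OF Y U(2)] lh[OF xW]
      by (simp add: linear_diff linear_scale mult.commute)
    then have w: "?w \<in> N x" by (simp add: N_def)
    have lG: "linear (dd G x)" by (rule smooth_linear_dd[OF sG x(1)])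
    have b: "dd ?h x (lie_bracket X Y x) = (dd (\<lambda>y. \<mu> y (Y y)) x (X x) - dd (\<lambda>y. \<mu> y (X y)) x (Y x)) *\<^sub>R G x + dd \<psi> x ?w *\<^sub>R Nr x"
    proof -
      have "dd ?h x (lie_bracket X Y x) = dd (\<lambda>y. dd ?h y (Y y)) x (X x) - dd (\<lambda>y. dd ?h y (X y)) x (Y x)"
        by (rule dd_lie_bracket[OF U(1,2) shU sec(1)[OF X] sec(1)[OF Y]])
      also have "\<dots> = (dd (\<lambda>y. \<mu> y (Y y)) x (X x) - dd (\<lambda>y. \<mu> y (X y)) x (Y x)) *\<^sub>R G x + dd G x ?w"
        unfolding dT[OF X] dT[OF Y] by (simp add: linear_diff[OF lG] linear_scale[OF lG] scaleR_diff_left)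
      finally show ?thesis unfolding dG[OF x(1) w] .
    qed
    show "dd ?h x (lie_bracket X Y x) \<bullet> Nr x = \<mu> x (Y x) * dd \<psi> x (X x) - \<mu> x (X x) * dd \<psi> x (Y x)"
      unfolding b using l\<psi>[OF x(1)] by (simp add: inner_add_left GN NN linear_diff linear_scale)
    show "lie_bracket X Y x \<in> H x \<longleftrightarrow> dd ?h x (lie_bracket X Y x) \<bullet> Nr x = 0"
    proof
      assume "lie_bracket X Y x \<in> H x"
      then show "dd ?h x (lie_bracket X Y x) \<bullet> Nr x = 0" using H_iff[OF x(1)] GN by auto
    next
      assume "dd ?h x (lie_bracket X Y x) \<bullet> Nr x = 0"
      then have "dd \<psi> x ?w = 0" unfolding b by (simp add: inner_add_left GN NN)
      then show "lie_bracket X Y x \<in> H x" unfolding H_iff[OF x(1)] b by auto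
    qed
  qed
  have ex: "\<exists>y\<in>N x. dd \<psi> x y \<noteq> 0" if x: "x \<in> W'" for x
  proof (rule ccontr)
    assume "\<not> (\<exists>y\<in>N x. dd \<psi> x y \<noteq> 0)"
    then have z: "dd \<psi> x y = 0" if "y \<in> N x" for y using that by blast
    have xx: "x \<in> S" "x \<in> W" using x W'W by auto
    have "n - k \<le> n" by simp
    from F_nonintegrable[OF this xx(1)] obtain V X Y where V: "x \<in> V" "V \<subseteq> S" "section_on H V X" "section_on H V Y" "lie_bracket X Y x \<notin> H x"
      unfolding H_def[symmetric] by (elim exE conjE) (rule that)
    have m: "X x \<in> H x" "Y x \<in> H x" using V unfolding section_on_def by blast+
    let ?w = "\<mu> x (Y x) *\<^sub>R X x - \<mu> x (X x) *\<^sub>R Y x"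
    have "dd ?h x ?w = 0"
      using \<mu>[OF x m(1)] \<mu>[OF x m(2)] lh[OF xx(2)] by (simp add: linear_diff linear_scale mult.commute)
    then have "dd \<psi> x ?w = 0" by (intro z) (simp add: N_def)
    then show False using star[OF x V(1,3,4)] V(5) l\<psi>[OF x] by (simp add: linear_diff linear_scale)
  qed
  let ?h' = "partial_coords \<xi>1 \<xi>2 \<theta>' (Suc k) :: 'e \<Rightarrow> 'e"
  have h': "dd ?h' x v = dd ?h x v + dd \<theta>k x v *\<^sub>R axis_vec (k + 2)" if "x \<in> W'" for x v
  proof -
    have "(\<Sum>i<k. dd (\<theta>' i) x v *\<^sub>R (axis_vec (i + 2) :: 'e)) = (\<Sum>i<k. dd (\<theta> i) x v *\<^sub>R axis_vec (i + 2))"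
      by (rule sum.cong) (auto simp: \<theta>'_def)
    moreover have "\<theta>' k = \<theta>k" by (simp add: \<theta>'_def)
    ultimately show ?thesis
      by (simp only: dd_partial_coords[OF that s'(1,2) s\<theta>'A, of v] dd_partial_coords[OF that s'(1-3), of v]
          sum.lessThan_Suc add.assoc)
  qed
  have hk: "dd ?h x v \<bullet> axis_vec (k + 2) = 0" if "x \<in> W'" for x v
    by (rule dd_partial_coords_inner(4)[OF that s'(1-3) D(2) _ D(5)]) auto
  have Ek: "axis_vec (k + 2) \<bullet> (axis_vec (k + 2) :: 'e) = 1" using D(5) by (simp add: axis_vec_inner)
  have Gk: "G x \<bullet> axis_vec (k + 2) = 0" for x
    unfolding G[symmetric] by (rule heading_inner_axis) (use D in auto)
  have d\<theta>k: "dd \<theta>k x v = dd \<psi> x v" if x: "x \<in> W'" "v \<in> N x" for x v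
  proof (cases k)
    case 0 then show ?thesis by (simp add: \<theta>k_def[abs_def])
  next
    case (Suc m)
    have "dd \<theta>k x v = dd \<psi> x v + dd (\<theta> m) x v"
      unfolding \<theta>k_def[abs_def] using Suc
      by simp (rule dd_eqI, intro has_derivative_add smooth_has_derivative[OF s\<psi>] smooth_has_derivative[OF s'(3)[rule_format]] x, simp add: Suc)
    moreover have "dd (\<theta> m) x v = 0"
      using dd_partial_coords_eq_0[OF x(1) s'(1-3) D(2), of v] x(2) Suc by (auto simp: N_def)
    ultimately show ?thesis by simp
  qed
  have h'0: "{v. dd ?h' x v = 0} = {v \<in> N x. gradient \<psi> x \<bullet> v = 0}" if x: "x \<in> W'" for x
  proof -
    have "dd ?h' x v = 0 \<longleftrightarrow> v \<in> N x \<and> dd \<psi> x v = 0" for v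
    proof
      assume z: "dd ?h' x v = 0"
      then have "(dd ?h x v + dd \<theta>k x v *\<^sub>R axis_vec (k + 2)) \<bullet> axis_vec (k + 2) = 0" using h'[OF x] by simp
      then have t: "dd \<theta>k x v = 0" by (simp add: inner_add_left hk[OF x] Ek del: add_2_eq_Suc')
      then have "v \<in> N x" using z h'[OF x] by (simp add: N_def)
      then show "v \<in> N x \<and> dd \<psi> x v = 0" using t d\<theta>k[OF x] by simp
    next
      assume "v \<in> N x \<and> dd \<psi> x v = 0"
      then show "dd ?h' x v = 0" using h'[OF x] d\<theta>k[OF x] by (simp add: N_def)
    qed
    then show ?thesis using gradient[OF s\<psi> x] by auto
  qed
  have "adapted (Suc k) W' \<xi>1 \<xi>2 \<theta>'"
    unfolding adapted_def
  proof (intro conjI ballI impI allI)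
    show "open W'" "W' \<subseteq> S" "smooth_on W' \<xi>1" "smooth_on W' \<xi>2" using W' W'W s' by auto
    show "smooth_on W' (\<theta>' i)" if "i < Suc k" for i by (rule s\<theta>'[OF that])
    fix x assume x: "x \<in> W'"
    have xx: "x \<in> W" "x \<in> S" "x \<in> W1" using x W'W W' by auto
    obtain y where y: "y \<in> N x" "dd \<psi> x y \<noteq> 0" using ex[OF x] by blast
    have "dim {v \<in> N x. gradient \<psi> x \<bullet> v = 0} + 1 = dim (N x)"
      by (rule dim_kernel_functional(1)[OF subN[OF xx(1)] y(1)]) (use y gradient[OF s\<psi> x] in simp)
    then show "dim {v. dd ?h' x v = 0} = n + 1 - Suc k" unfolding h'0[OF x] using dN[OF xx(1)] k by simp
    have "v \<in> H x \<longleftrightarrow> dd ?h' x v \<in> span {heading (\<lambda>i. \<theta>' i x) (Suc k), axis_vec (Suc k + 1)}" for v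
    proof -
      have ax: "(axis_vec (Suc k + 1) :: 'e) = axis_vec (k + 2)" by simp
      have "v \<in> H x \<longleftrightarrow> (\<exists>c d. dd ?h' x v = c *\<^sub>R G x + d *\<^sub>R axis_vec (k + 2))"
      proof
        assume "v \<in> H x"
        then obtain c where "dd ?h x v = c *\<^sub>R G x" using H_iff[OF x] by blast
        then show "\<exists>c d. dd ?h' x v = c *\<^sub>R G x + d *\<^sub>R axis_vec (k + 2)" using h'[OF x, of v] by auto
      next
        assume "\<exists>c d. dd ?h' x v = c *\<^sub>R G x + d *\<^sub>R axis_vec (k + 2)"
        then obtain c d where cd: "dd ?h x v + dd \<theta>k x v *\<^sub>R axis_vec (k + 2) = c *\<^sub>R G x + d *\<^sub>R axis_vec (k + 2)"
          using h'[OF x, of v] by auto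
        from arg_cong[OF this, of "\<lambda>u. u \<bullet> axis_vec (k + 2)"] have "dd \<theta>k x v = d"
          by (simp add: inner_add_left hk[OF x] Ek Gk del: add_2_eq_Suc')
        then have "dd ?h x v = c *\<^sub>R G x" using cd by simp
        then show "v \<in> H x" using H_iff[OF x] by blast
      qed
      also have "\<dots> \<longleftrightarrow> dd ?h' x v \<in> span {G x, axis_vec (k + 2)}"
        by (auto simp: span_insert span_singleton algebra_simps)
      finally show ?thesis unfolding G ax .
    qed
    then show "F (n + 1 - Suc k) x = {v. dd ?h' x v \<in> span {heading (\<lambda>i. \<theta>' i x) (Suc k), axis_vec (Suc k + 1)}}"
      by (auto simp: H_def)
    assume kn: "Suc k \<le> n"
    show "{v. dd ?h' x v = 0} \<subseteq> F (n - Suc k) x"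
    proof (rule subsetI, rule ccontr)
      fix w0 assume "w0 \<in> {v. dd ?h' x v = 0}" and w0F: "w0 \<notin> F (n - Suc k) x"
      then have w0: "w0 \<in> N x" "dd \<psi> x w0 = 0" using h'0[OF x] gradient[OF s\<psi> x] by auto
      let ?F = "F (n - Suc k)"
      have eq: "n - k = Suc (n - Suc k)" using kn by simp
      have sF: "smooth_distribution S ?F" and subF: "subspace (?F x)" and dF: "dim (H x) = dim (?F x) + 1" and FH: "\<And>y. y \<in> S \<Longrightarrow> ?F y \<subseteq> H y"
        using F_smooth[of "n - Suc k"] F_subspace[of "n - Suc k" x] F_dim[of "n - Suc k" x] F_mono[of "n - Suc k"] H(3)[of x] xx eq
        by (auto simp: H_def)
      have isoF: "\<mu> x w * dd \<psi> x v - \<mu> x v * dd \<psi> x w = 0" if v: "v \<in> ?F x" and w: "w \<in> ?F x" for v w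
      proof -
        obtain V X where X: "x \<in> V" "V \<subseteq> S" "section_on ?F V X" "X x = v" using smooth_distributionD(2)[OF sF xx(2) v] by blast
        obtain V' Y where Y: "x \<in> V'" "V' \<subseteq> S" "section_on ?F V' Y" "Y x = w" using smooth_distributionD(2)[OF sF xx(2) w] by blast
        let ?V = "V \<inter> V'"
        have XY: "section_on ?F ?V X" "section_on ?F ?V Y" using X(3) Y(3) by (auto simp: section_on_def intro: smooth_subset)
        have HXY: "section_on H ?V X" "section_on H ?V Y" using XY FH X(2) unfolding section_on_def by blast+
        have xV: "x \<in> ?V" "?V \<subseteq> S" using X Y by auto
        have "lie_bracket X Y x \<in> F (Suc (n - Suc k)) x" by (rule F_bracket[OF _ xV XY]) simp
        then have "lie_bracket X Y x \<in> H x" by (simp add: H_def eq)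
        then show ?thesis using star[OF x xV(1) HXY] X(4) Y(4) by simp
      qed
      have w0H: "w0 \<in> H x" using NH[OF xx(1)] w0 by blast
      have \<mu>w0: "\<mu> x w0 = 0" using w0 by (simp add: \<mu>_def N_def)
      \<comment> \<open>A vector \<open>w0\<close> of the kernel outside \<open>F (n - k - 1)\<close> would make the form on \<open>H\<close> determined by its values on that isotropic hyperplane, hence zero.\<close>
      have dec: "\<exists>f\<in>?F x. \<mu> x v = \<mu> x f \<and> dd \<psi> x v = dd \<psi> x f" if v: "v \<in> H x" for v
      proof -
        obtain c where c: "v - c *\<^sub>R w0 \<in> ?F x"
          by (rule hyperplane_decompose[OF subF H(2)[OF xx(2)] FH[OF xx(2)] dF w0H w0F v])
        have "\<mu> x (v - c *\<^sub>R w0) = \<mu> x v" "dd \<psi> x (v - c *\<^sub>R w0) = dd \<psi> x v"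
          using lh[OF xx(1)] l\<psi>[OF x] \<mu>w0 w0 by (simp_all add: \<mu>_def linear_diff linear_scale inner_diff_left)
        then show ?thesis using c by metis
      qed
      obtain \<rho> where \<rho>: "\<rho> > 0" "dd ?h x (Z x) = \<rho> *\<^sub>R G x" using hZ[OF x] by blast
      have \<mu>Z: "\<mu> x (Z x) = \<rho>" by (simp add: \<mu>_def \<rho> GG)
      have \<mu>y: "\<mu> x y = 0" using y by (simp add: \<mu>_def N_def)
      obtain f where f: "f \<in> ?F x" "\<mu> x (Z x) = \<mu> x f" "dd \<psi> x (Z x) = dd \<psi> x f" using dec[OF Z(2)[OF xx(3)]] by blast
      have "y \<in> H x" using NH[OF xx(1)] y by blast
      then obtain g where g: "g \<in> ?F x" "\<mu> x y = \<mu> x g" "dd \<psi> x y = dd \<psi> x g" using dec by blast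
      have "\<mu> x (Z x) * dd \<psi> x y - \<mu> x y * dd \<psi> x (Z x) = 0" using isoF[OF g(1) f(1)] f g by simp
      then show False using \<mu>Z \<mu>y \<rho>(1) y(2) by simp
    qed
  qed
  then show ?thesis using that W'(2) by blast
qed

theorem trailer_coordinates:
  assumes "x0 \<in> S"
  obtains W \<xi>1 \<xi>2 \<theta> where "x0 \<in> W" "open W" "W \<subseteq> S" "smooth_on W \<xi>1" "smooth_on W \<xi>2" "\<And>i. i \<le> n \<Longrightarrow> smooth_on W (\<theta> i)"
    "\<And>x. x \<in> W \<Longrightarrow> inj (dd (partial_coords \<xi>1 \<xi>2 \<theta> (Suc n) :: 'e \<Rightarrow> 'e) x)"
    "\<And>x. x \<in> W \<Longrightarrow> F 0 x = {v. dd (partial_coords \<xi>1 \<xi>2 \<theta> (Suc n) :: 'e \<Rightarrow> 'e) x v \<in> span {heading (\<lambda>i. \<theta> i x) (Suc n), axis_vec (n + 2)}}"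
proof -
  have "\<exists>W \<xi>1 \<xi>2 \<theta>. x0 \<in> W \<and> adapted k W \<xi>1 \<xi>2 \<theta>" if "k \<le> Suc n" for k
    using that
  proof (induction k)
    case 0 show ?case by (rule adapted_0[OF assms]) blast
  next
    case (Suc k)
    then obtain W \<xi>1 \<xi>2 \<theta> where "x0 \<in> W" "adapted k W \<xi>1 \<xi>2 \<theta>" by auto
    then obtain W' \<theta>' where "x0 \<in> W'" "adapted (Suc k) W' \<xi>1 \<xi>2 \<theta>'" using adapted_Suc[of k W \<xi>1 \<xi>2 \<theta> x0] Suc.prems by auto
    then show ?case by blast
  qed
  from this[OF order_refl] obtain W \<xi>1 \<xi>2 \<theta> where x0: "x0 \<in> W" and ad: "adapted (Suc n) W \<xi>1 \<xi>2 \<theta>" by blast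
  let ?h = "partial_coords \<xi>1 \<xi>2 \<theta> (Suc n) :: 'e \<Rightarrow> 'e"
  have W: "open W" "W \<subseteq> S" and s: "smooth_on W \<xi>1" "smooth_on W \<xi>2" "\<And>i. i \<le> n \<Longrightarrow> smooth_on W (\<theta> i)"
    using ad by (auto simp: adapted_def)
  show ?thesis
  proof (rule that[OF x0 W s])
    fix x assume x: "x \<in> W"
    have sh: "smooth_on W ?h" by (rule smooth_partial_coords[OF W(1) s(1,2)]) (simp add: s(3))
    have "dim {v. dd ?h x v = 0} = 0" using ad x by (simp add: adapted_def)
    then have "{v. dd ?h x v = 0} \<subseteq> {0}" by simp
    then show "inj (dd ?h x)" using linear_injective_0[OF smooth_linear_dd[OF sh x]] by blast
    show "F 0 x = {v. dd ?h x v \<in> span {heading (\<lambda>i. \<theta> i x) (Suc n), axis_vec (n + 2)}}"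
      using ad x by (simp add: adapted_def)
  qed
qed

end

section \<open>The derived flag in a chart\<close>
abbreviation transition :: "('a, 'e) chart \<Rightarrow> ('a, 'e) chart \<Rightarrow> 'e \<Rightarrow> 'e" where
  "transition c d \<equiv> snd d \<circ> chart_inv c"

lemma lie_bracket_natural:
  fixes \<tau> :: "'e::euclidean_space \<Rightarrow> 'e"
  assumes U: "open U" "y \<in> U" and \<tau>: "smooth_on U \<tau>" and X: "smooth_on U X" and Y: "smooth_on U Y"
    and U': "\<And>y. y \<in> U \<Longrightarrow> \<tau> y \<in> U'" and X': "smooth_on U' X'" and Y': "smooth_on U' Y'"
    and rel: "\<And>y. y \<in> U \<Longrightarrow> X' (\<tau> y) = dd \<tau> y (X y)" "\<And>y. y \<in> U \<Longrightarrow> Y' (\<tau> y) = dd \<tau> y (Y y)"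
  shows "dd \<tau> y (lie_bracket X Y y) = lie_bracket X' Y' (\<tau> y)"
proof -
  have e: "dd (\<lambda>y. dd \<tau> y (Z y)) y v = dd Z' (\<tau> y) (dd \<tau> y v)"
    if Z': "smooth_on U' Z'" and r: "\<And>y. y \<in> U \<Longrightarrow> Z' (\<tau> y) = dd \<tau> y (Z y)" for Z Z' v
  proof -
    have "dd (\<lambda>y. dd \<tau> y (Z y)) y v = dd (\<lambda>y. Z' (\<tau> y)) y v"
      by (rule fun_cong[OF dd_transform[OF U]]) (simp add: r)
    also have "\<dots> = dd Z' (\<tau> y) (dd \<tau> y v)"
      by (rule dd_eqI) (rule has_derivative_compose[OF smooth_has_derivative[OF \<tau> U(2)] smooth_has_derivative[OF Z' U'[OF U(2)]]])
    finally show ?thesis .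
  qed
  show ?thesis
    by (simp only: dd_lie_bracket[OF U \<tau> X Y] e[OF X' rel(1)] e[OF Y' rel(2)] lie_bracket_def[of X' Y']
        rel(1)[OF U(2)] rel(2)[OF U(2)])
qed

lemma subspace_section_values:
  fixes K :: "'e::euclidean_space \<Rightarrow> 'e set"
  assumes S: "open S" "x \<in> S" and K: "\<And>y. y \<in> S \<Longrightarrow> subspace (K y)"
  shows "subspace {v. \<exists>W X. x \<in> W \<and> W \<subseteq> S \<and> section_on K W X \<and> X x = v}"
  unfolding subspace_def
proof (intro conjI ballI allI)
  have "section_on K S (\<lambda>_. 0)" using S K by (simp add: section_on_def smooth_const subspace_0)
  then show "0 \<in> {v. \<exists>W X. x \<in> W \<and> W \<subseteq> S \<and> section_on K W X \<and> X x = v}" using S by blast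
next
  fix u v
  assume "u \<in> {v. \<exists>W X. x \<in> W \<and> W \<subseteq> S \<and> section_on K W X \<and> X x = v}"
    and "v \<in> {v. \<exists>W X. x \<in> W \<and> W \<subseteq> S \<and> section_on K W X \<and> X x = v}"
  then obtain W X W' Y where WX: "x \<in> W" "W \<subseteq> S" "section_on K W X" "X x = u"
    and WY: "x \<in> W'" "W' \<subseteq> S" "section_on K W' Y" "Y x = v" by blast
  have o: "open (W \<inter> W')" using WX(3) WY(3) by (auto simp: section_on_def)
  have s: "smooth_on (W \<inter> W') X" "smooth_on (W \<inter> W') Y" using WX(3) WY(3) by (auto simp: section_on_def intro: smooth_subset)
  have "section_on K (W \<inter> W') (\<lambda>y. X y + Y y)"
    using o smooth_add[OF o s] WX(2,3) WY(3) K unfolding section_on_def by (auto intro!: subspace_add)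
  then show "u + v \<in> {v. \<exists>W X. x \<in> W \<and> W \<subseteq> S \<and> section_on K W X \<and> X x = v}"
    using WX WY by (intro CollectI exI[of _ "W \<inter> W'"] exI[of _ "\<lambda>y. X y + Y y"]) auto
next
  fix c u
  assume "u \<in> {v. \<exists>W X. x \<in> W \<and> W \<subseteq> S \<and> section_on K W X \<and> X x = v}"
  then obtain W X where WX: "x \<in> W" "W \<subseteq> S" "section_on K W X" "X x = u" by blast
  have "section_on K W (\<lambda>y. c *\<^sub>R X y)"
    using smooth_scaleR[OF _ smooth_const, of W X c] WX(2,3) K unfolding section_on_def by (auto intro!: subspace_scale)
  then show "c *\<^sub>R u \<in> {v. \<exists>W X. x \<in> W \<and> W \<subseteq> S \<and> section_on K W X \<and> X x = v}"
    using WX by (intro CollectI exI[of _ W] exI[of _ "\<lambda>y. c *\<^sub>R X y"]) auto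
qed

locale smooth_manifold_locale =
  fixes M :: "('a, 'e::euclidean_space) manifold"
  assumes mfd: "smooth_manifold M"
begin

lemma chart:
  assumes "c \<in> atlas M"
  shows "openin (mtop M) (fst c)" "open (snd c ` fst c)" "inj_on (snd c) (fst c)" "fst c \<subseteq> topspace (mtop M)"
    "homeomorphic_map (subtopology (mtop M) (fst c)) (top_of_set (snd c ` fst c)) (snd c)"
proof -
  have c: "is_chart (mtop M) c" using mfd assms by (simp add: smooth_manifold_def)
  then show 1: "openin (mtop M) (fst c)" "open (snd c ` fst c)"
    and h: "homeomorphic_map (subtopology (mtop M) (fst c)) (top_of_set (snd c ` fst c)) (snd c)"
    by (auto simp: is_chart_def)
  show s: "fst c \<subseteq> topspace (mtop M)" using 1(1) by (rule openin_subset)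
  then show "inj_on (snd c) (fst c)"
    using homeomorphic_imp_injective_map[OF h] by (simp add: Int_absorb1)
qed

lemma chart_inv:
  assumes "c \<in> atlas M"
  shows "p \<in> fst c \<Longrightarrow> chart_inv c (snd c p) = p" "x \<in> snd c ` fst c \<Longrightarrow> snd c (chart_inv c x) = x"
    "x \<in> snd c ` fst c \<Longrightarrow> chart_inv c x \<in> fst c"
  using chart(3)[OF assms] by (auto simp: chart_inv_def inv_into_into f_inv_into_f)

lemma open_chart_image:
  assumes c: "c \<in> atlas M" and W: "openin (mtop M) W" shows "open (snd c ` (fst c \<inter> W))"
proof -
  have "openin (top_of_set (snd c ` fst c)) (snd c ` (fst c \<inter> W))"
    using homeomorphic_imp_open_map[OF chart(5)[OF c]] W unfolding open_map_def
    by (auto simp: openin_subtopology_Int2)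
  then show ?thesis using chart(2)[OF c] openin_open_trans by blast
qed

lemma continuous_map_chart:
  assumes c: "c \<in> atlas M"
  shows "continuous_map (subtopology (mtop M) (fst c)) euclidean (snd c)"
  using homeomorphic_imp_continuous_map[OF chart(5)[OF c]] by (simp add: continuous_map_in_subtopology)

lemma continuous_map_chart_inv:
  assumes c: "c \<in> atlas M"
  shows "continuous_map (top_of_set (snd c ` fst c)) (mtop M) (chart_inv c)"
  unfolding continuous_map_def
proof (intro conjI allI impI)
  show "chart_inv c \<in> topspace (top_of_set (snd c ` fst c)) \<rightarrow> topspace (mtop M)"
    using chart_inv(3)[OF c] chart(4)[OF c] by auto
  fix W assume W: "openin (mtop M) W"
  have "{x \<in> topspace (top_of_set (snd c ` fst c)). chart_inv c x \<in> W} = snd c ` (fst c \<inter> W)"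
    using chart_inv[OF c] by auto
  then show "openin (top_of_set (snd c ` fst c)) {x \<in> topspace (top_of_set (snd c ` fst c)). chart_inv c x \<in> W}"
    using open_chart_image[OF c W] by (auto intro!: open_subset)
qed

lemma open_chart_preimage:
  assumes c: "c \<in> atlas M" and Q: "open Q" shows "openin (mtop M) {p \<in> fst c. snd c p \<in> Q}"
proof -
  have "openin (subtopology (mtop M) (fst c)) {p \<in> topspace (subtopology (mtop M) (fst c)). snd c p \<in> Q}"
    by (rule openin_continuous_map_preimage[OF continuous_map_chart[OF c]]) (use Q in simp)
  moreover have "topspace (subtopology (mtop M) (fst c)) = fst c" using chart(4)[OF c] by auto
  ultimately have "openin (subtopology (mtop M) (fst c)) {p \<in> fst c. snd c p \<in> Q}" by (simp only:)
  then show ?thesis using openin_open_subtopology[OF chart(1)[OF c]] by blast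
qed

lemma chart_at:
  assumes "p \<in> topspace (mtop M)" shows "chart_at M p \<in> atlas M" "p \<in> fst (chart_at M p)"
proof -
  have "p \<in> (\<Union>c\<in>atlas M. fst c)" using mfd assms by (simp only: smooth_manifold_def)
  then have "\<exists>c. c \<in> atlas M \<and> p \<in> fst c" by blast
  from someI_ex[OF this] show "chart_at M p \<in> atlas M" "p \<in> fst (chart_at M p)" by (auto simp: chart_at_def)
qed

lemma smooth_trans:
  assumes "c \<in> atlas M" "d \<in> atlas M" shows "smooth_on (snd c ` (fst c \<inter> fst d)) (transition c d)"
  using mfd assms by (auto simp: smooth_manifold_def)

lemma trans_has_derivative:
  assumes "c \<in> atlas M" "d \<in> atlas M" "p \<in> fst c" "p \<in> fst d"
  shows "(transition c d has_derivative dd (transition c d) (snd c p)) (at (snd c p))"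
  by (rule smooth_has_derivative[OF smooth_trans[OF assms(1,2)]]) (use assms in auto)

lemma dd_trans_chain:
  assumes a: "c \<in> atlas M" "d \<in> atlas M" "e \<in> atlas M" and p: "p \<in> fst c" "p \<in> fst d" "p \<in> fst e"
  shows "dd (transition c e) (snd c p) v = dd (transition d e) (snd d p) (dd (transition c d) (snd c p) v)"
proof -
  let ?O = "snd c ` (fst c \<inter> (fst d \<inter> fst e))"
  have O: "open ?O" by (intro open_chart_image a openin_Int chart)
  have tp: "transition c d (snd c p) = snd d p" using p a by (simp add: chart_inv)
  have "dd (transition c e) (snd c p) v = dd (\<lambda>x. transition d e (transition c d x)) (snd c p) v"
    by (rule fun_cong[OF dd_transform[OF O]]) (use p a in \<open>auto simp: chart_inv\<close>)
  also have "\<dots> = dd (transition d e) (snd d p) (dd (transition c d) (snd c p) v)"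
    by (rule dd_eqI, rule has_derivative_compose[OF trans_has_derivative[OF a(1,2) p(1,2)]])
      (unfold tp, rule trans_has_derivative[OF a(2,3) p(2,3)])
  finally show ?thesis .
qed

lemma dd_trans_self:
  assumes a: "c \<in> atlas M" and p: "p \<in> fst c"
  shows "dd (transition c c) (snd c p) v = v"
proof -
  have "dd (transition c c) (snd c p) v = dd (\<lambda>x. x) (snd c p) v"
    by (rule fun_cong[OF dd_transform[OF chart(2)[OF a]]]) (use p a in \<open>auto simp: chart_inv\<close>)
  then show ?thesis by simp
qed

lemma vector_in_chart_change:
  assumes a: "c \<in> atlas M" "d \<in> atlas M" and p: "p \<in> fst c" "p \<in> fst d"
  shows "vector_in_chart M d p v = dd (transition c d) (snd c p) (vector_in_chart M c p v)"
proof -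
  have "p \<in> topspace (mtop M)" using chart(4)[OF a(1)] p by blast
  then show ?thesis unfolding vector_in_chart_def by (intro dd_trans_chain a p chart_at)
qed

lemma linear_vector_in_chart:
  assumes a: "c \<in> atlas M" and p: "p \<in> fst c"
  shows "linear (vector_in_chart M c p)"
proof -
  have "p \<in> topspace (mtop M)" using chart(4)[OF a(1)] p by blast
  from trans_has_derivative[OF chart_at(1)[OF this] a chart_at(2)[OF this] p] show ?thesis
    unfolding vector_in_chart_def using has_derivative_bounded_linear bounded_linear.linear by blast
qed

lemma inj_vector_in_chart:
  assumes a: "c \<in> atlas M" and p: "p \<in> fst c"
  shows "inj (vector_in_chart M c p)"
proof (rule inj_on_inverseI)
  fix v
  have t: "p \<in> topspace (mtop M)" using chart(4)[OF a(1)] p by blast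
  let ?c = "chart_at M p"
  show "dd (transition c ?c) (snd c p) (vector_in_chart M c p v) = v"
    unfolding vector_in_chart_def dd_trans_chain[OF chart_at(1)[OF t] a chart_at(1)[OF t] chart_at(2)[OF t] p chart_at(2)[OF t], symmetric]
    by (rule dd_trans_self[OF chart_at[OF t]])
qed

lemma field_in_chart_change:
  assumes a: "c \<in> atlas M" "d \<in> atlas M" and x: "x \<in> snd c ` (fst c \<inter> fst d)"
  shows "field_in_chart M d X (transition c d x) = dd (transition c d) x (field_in_chart M c X x)"
proof -
  obtain p where p: "x = snd c p" "p \<in> fst c" "p \<in> fst d" using x by blast
  show ?thesis unfolding p(1) field_in_chart_def o_def chart_inv(1)[OF a(1) p(2)] chart_inv(1)[OF a(2) p(3)]
    using vector_in_chart_change[OF a p(2,3), of "X p"] by (simp add: o_def)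
qed

text \<open>
  The bracket of two fields is defined in the preferred chart of the point; naturality under the transition map gives
  the same vector when it is computed in any other chart.
\<close>
lemma bracket_in_chart:
  assumes a: "c \<in> atlas M" and p: "p \<in> fst c" "p \<in> W" and X: "smooth_vector_field M W X" and Y: "smooth_vector_field M W Y"
  shows "vector_in_chart M c p (field_bracket M X Y p) = lie_bracket (field_in_chart M c X) (field_in_chart M c Y) (snd c p)"
proof -
  have t: "p \<in> topspace (mtop M)" using chart(4)[OF a(1)] p by blast
  let ?c = "chart_at M p"
  have ca: "?c \<in> atlas M" "p \<in> fst ?c" using chart_at[OF t] by auto
  have W: "openin (mtop M) W" using X by (simp add: smooth_vector_field_def)
  have sm: "smooth_on (snd d ` (fst d \<inter> W)) (field_in_chart M d Z)" if "d \<in> atlas M" "smooth_vector_field M W Z" for d Z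
    using that by (simp add: smooth_vector_field_def)
  let ?U = "snd ?c ` (fst ?c \<inter> (fst c \<inter> W))"
  have tp: "transition ?c c (snd ?c p) = snd c p" using chart_inv(1)[OF ca] by simp
  have "dd (transition ?c c) (snd ?c p) (lie_bracket (field_in_chart M ?c X) (field_in_chart M ?c Y) (snd ?c p))
    = lie_bracket (field_in_chart M c X) (field_in_chart M c Y) (transition ?c c (snd ?c p))"
  proof (rule lie_bracket_natural[of ?U _ _ _ _ "snd c ` (fst c \<inter> W)"])
    show "open ?U" by (intro open_chart_image ca openin_Int chart a W)
    show "snd ?c p \<in> ?U" using p ca by blast
    show "smooth_on ?U (transition ?c c)" by (rule smooth_subset[OF smooth_trans[OF ca(1) a]]) auto
    show "smooth_on ?U (field_in_chart M ?c X)" "smooth_on ?U (field_in_chart M ?c Y)"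
      by (rule smooth_subset[OF sm[OF ca(1) X]], blast, rule smooth_subset[OF sm[OF ca(1) Y]], blast)
    show "transition ?c c y \<in> snd c ` (fst c \<inter> W)" if "y \<in> ?U" for y
      using that chart_inv(1)[OF ca(1)] by auto
    show "smooth_on (snd c ` (fst c \<inter> W)) (field_in_chart M c X)" "smooth_on (snd c ` (fst c \<inter> W)) (field_in_chart M c Y)"
      using sm[OF a] X Y by auto
    show "field_in_chart M c X (transition ?c c y) = dd (transition ?c c) y (field_in_chart M ?c X y)"
      "field_in_chart M c Y (transition ?c c y) = dd (transition ?c c) y (field_in_chart M ?c Y y)" if "y \<in> ?U" for y
    proof -
      have "y \<in> snd ?c ` (fst ?c \<inter> fst c)" using that by blast
      then show "field_in_chart M c X (transition ?c c y) = dd (transition ?c c) y (field_in_chart M ?c X y)"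
        "field_in_chart M c Y (transition ?c c y) = dd (transition ?c c) y (field_in_chart M ?c Y y)"
        by (rule field_in_chart_change[OF ca(1) a])+
    qed
  qed
  then show ?thesis unfolding tp by (simp add: vector_in_chart_def field_bracket_def)
qed

text \<open>Coordinate vectors refer to the preferred chart of each point, so they are first transported to the chart \<open>c\<close>.\<close>
definition dist_in_chart :: "('a, 'e) chart \<Rightarrow> ('a \<Rightarrow> 'e set) \<Rightarrow> 'e \<Rightarrow> 'e set" where
  "dist_in_chart c K x = vector_in_chart M c (chart_inv c x) ` K (chart_inv c x)"

lemma section_in_chart:
  assumes c: "c \<in> atlas M" and X: "local_section M K W X"
  shows "section_on (dist_in_chart c K) (snd c ` (fst c \<inter> W)) (field_in_chart M c X)"
  unfolding section_on_def
proof (intro conjI ballI)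
  have W: "openin (mtop M) W" using X by (simp add: local_section_def smooth_vector_field_def)
  then show "open (snd c ` (fst c \<inter> W))" by (rule open_chart_image[OF c])
  show "smooth_on (snd c ` (fst c \<inter> W)) (field_in_chart M c X)"
    using X c by (simp add: local_section_def smooth_vector_field_def)
  fix y assume "y \<in> snd c ` (fst c \<inter> W)"
  then show "field_in_chart M c X y \<in> dist_in_chart c K y"
    using X chart_inv(1)[OF c] by (auto simp: field_in_chart_def dist_in_chart_def local_section_def)
qed

text \<open>Sections over an open set of the chart come from local sections of the manifold, so the chart sees all brackets.\<close>
lemma section_from_chart:
  assumes c: "c \<in> atlas M" and Y: "section_on (dist_in_chart c K) W Y" and W: "W \<subseteq> snd c ` fst c"
  obtains X where "local_section M K {p \<in> fst c. snd c p \<in> W} X" "\<And>x. x \<in> W \<Longrightarrow> field_in_chart M c X x = Y x"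
proof -
  define X where "X p = inv_into (K p) (vector_in_chart M c p) (Y (snd c p))" for p
  let ?W = "{p \<in> fst c. snd c p \<in> W}"
  have oW: "open W" and sY: "smooth_on W Y" and Ym: "\<And>y. y \<in> W \<Longrightarrow> Y y \<in> dist_in_chart c K y" using Y by (auto simp: section_on_def)
  have V: "vector_in_chart M c p (X p) = Y (snd c p)" and XK: "X p \<in> K p" if "p \<in> ?W" for p
  proof -
    have "Y (snd c p) \<in> vector_in_chart M c p ` K p"
      using Ym[of "snd c p"] that chart_inv(1)[OF c] by (auto simp: dist_in_chart_def)
    then show "vector_in_chart M c p (X p) = Y (snd c p)" "X p \<in> K p"
      unfolding X_def by (auto intro: f_inv_into_f inv_into_into)
  qed
  have fic: "field_in_chart M c X x = Y x" if "x \<in> W" for x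
    using V[of "chart_inv c x"] that W chart_inv(2,3)[OF c, of x] by (auto simp: field_in_chart_def)
  have oWM: "openin (mtop M) ?W" by (rule open_chart_preimage[OF c oW])
  have "smooth_on (snd d ` (fst d \<inter> ?W)) (field_in_chart M d X)" if d: "d \<in> atlas M" for d
  proof (rule smooth_cong)
    show o: "open (snd d ` (fst d \<inter> ?W))" by (rule open_chart_image[OF d oWM])
    let ?T = "snd c ` (fst c \<inter> (fst d \<inter> ?W))"
    have oT: "open ?T" by (intro open_chart_image c openin_Int chart d oWM)
    have s: "smooth_on ?T (\<lambda>x. dd (transition c d) x (Y x))"
    proof (rule smooth_dd_field[OF oT])
      show "smooth_on ?T (transition c d)" by (rule smooth_subset[OF smooth_trans[OF c d]]) auto
      show "smooth_on ?T Y" by (rule smooth_subset[OF sY]) auto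
    qed
    show "smooth_on (snd d ` (fst d \<inter> ?W)) (\<lambda>y. dd (transition c d) (transition d c y) (Y (transition d c y)))"
    proof (rule smooth_compose[OF o _ s])
      show "smooth_on (snd d ` (fst d \<inter> ?W)) (transition d c)" by (rule smooth_subset[OF smooth_trans[OF d c]]) auto
      show "transition d c y \<in> ?T" if "y \<in> snd d ` (fst d \<inter> ?W)" for y
        using that chart_inv(1)[OF d] by auto
    qed
    fix y assume "y \<in> snd d ` (fst d \<inter> ?W)"
    then obtain p where p: "y = snd d p" "p \<in> fst d" "p \<in> fst c" "snd c p \<in> W" by blast
    have t: "transition d c y = snd c p" "transition c d (snd c p) = y" using p chart_inv(1)[OF d p(2)] chart_inv(1)[OF c p(3)] by auto
    have "field_in_chart M d X (transition c d (snd c p)) = dd (transition c d) (snd c p) (field_in_chart M c X (snd c p))"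
      by (rule field_in_chart_change[OF c d]) (use p in auto)
    then show "dd (transition c d) (transition d c y) (Y (transition d c y)) = field_in_chart M d X y"
      unfolding t fic[OF p(4)] by simp
  qed
  then have "local_section M K ?W X" using oWM XK by (auto simp: local_section_def smooth_vector_field_def)
  then show ?thesis using that fic by blast
qed

lemma bracket_derived_in_chart:
  assumes c: "c \<in> atlas M" and x: "x \<in> W" and W: "W \<subseteq> snd c ` fst c"
    and X: "section_on (dist_in_chart c K) W X" and Y: "section_on (dist_in_chart c K) W Y"
  shows "lie_bracket X Y x \<in> dist_in_chart c (derived M K) x"
proof -
  let ?W = "{p \<in> fst c. snd c p \<in> W}" and ?p = "chart_inv c x"
  obtain X' where X': "local_section M K ?W X'" "\<And>x. x \<in> W \<Longrightarrow> field_in_chart M c X' x = X x"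
    by (rule section_from_chart[OF c X W]) (rule that)
  obtain Y' where Y': "local_section M K ?W Y'" "\<And>x. x \<in> W \<Longrightarrow> field_in_chart M c Y' x = Y x"
    by (rule section_from_chart[OF c Y W]) (rule that)
  have p: "?p \<in> fst c" "snd c ?p = x" "?p \<in> ?W" using x W chart_inv(2,3)[OF c, of x] by auto
  have "field_bracket M X' Y' ?p \<in> derived M K ?p"
    unfolding derived_def
    by (rule span_base, rule UnI2, rule CollectI, rule exI[of _ X'], rule exI[of _ Y'], rule exI[of _ ?W])
      (intro conjI refl X'(1) Y'(1) p(3))
  moreover have "vector_in_chart M c ?p (field_bracket M X' Y' ?p) = lie_bracket X Y x"
  proof -
    have "vector_in_chart M c ?p (field_bracket M X' Y' ?p) = lie_bracket (field_in_chart M c X') (field_in_chart M c Y') x"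
      using bracket_in_chart[OF c p(1,3), of X' Y'] X'(1) Y'(1) p(2) by (simp add: local_section_def)
    also have "\<dots> = lie_bracket X Y x"
      by (rule lie_bracket_cong[of W]) (use X x X'(2) Y'(2) in \<open>auto simp: section_on_def\<close>)
    finally show ?thesis .
  qed
  ultimately show ?thesis unfolding dist_in_chart_def by (metis imageI)
qed

lemma derived_in_chart_generators:
  assumes c: "c \<in> atlas M" and x: "x \<in> snd c ` fst c"
  shows "dist_in_chart c (derived M K) x \<subseteq> span (dist_in_chart c K x \<union> {lie_bracket X Y x | X Y W.
    x \<in> W \<and> W \<subseteq> snd c ` fst c \<and> section_on (dist_in_chart c K) W X \<and> section_on (dist_in_chart c K) W Y})" (is "_ \<subseteq> span ?G")
proof -
  let ?p = "chart_inv c x"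
  have p: "?p \<in> fst c" "snd c ?p = x" using x chart_inv(2,3)[OF c, of x] by auto
  let ?V = "vector_in_chart M c ?p"
  let ?A = "K ?p \<union> {field_bracket M X Y ?p | X Y W. ?p \<in> W \<and> local_section M K W X \<and> local_section M K W Y}"
  have "?V ` ?A \<subseteq> ?G"
  proof
    fix v assume "v \<in> ?V ` ?A"
    then consider (a) u where "u \<in> K ?p" "v = ?V u"
      | (b) X Y W where "?p \<in> W" "local_section M K W X" "local_section M K W Y" "v = ?V (field_bracket M X Y ?p)" by blast
    then show "v \<in> ?G"
    proof cases
      case a then show ?thesis by (simp add: dist_in_chart_def)
    next
      case b
      have "v = lie_bracket (field_in_chart M c X) (field_in_chart M c Y) x"
        using bracket_in_chart[OF c p(1) b(1), of X Y] b p(2) by (simp add: local_section_def)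
      moreover have "x \<in> snd c ` (fst c \<inter> W)" using p b(1) by (metis IntI imageI)
      moreover have "snd c ` (fst c \<inter> W) \<subseteq> snd c ` fst c" by blast
      ultimately show ?thesis
        using section_in_chart[OF c b(2)] section_in_chart[OF c b(3)]
        by (intro UnI2 CollectI exI[of _ "field_in_chart M c X"] exI[of _ "field_in_chart M c Y"] exI[of _ "snd c ` (fst c \<inter> W)"] conjI)
    qed
  qed
  then have "span (?V ` ?A) \<subseteq> span ?G" by (rule span_mono)
  moreover have "dist_in_chart c (derived M K) x = span (?V ` ?A)"
    unfolding dist_in_chart_def derived_def using linear_span_image[OF linear_vector_in_chart[OF c p(1)]] by simp
  ultimately show ?thesis by simp
qed

lemma dist_in_chart_mono: "K (chart_inv c x) \<subseteq> L (chart_inv c x) \<Longrightarrow> dist_in_chart c K x \<subseteq> dist_in_chart c L x"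
  by (auto simp: dist_in_chart_def)

lemma subspace_dist_in_chart:
  assumes "c \<in> atlas M" "x \<in> snd c ` fst c" "subspace (K (chart_inv c x))"
  shows "subspace (dist_in_chart c K x)"
  unfolding dist_in_chart_def
  by (rule linear_subspace_image[OF linear_vector_in_chart assms(3)]) (use assms chart_inv in auto)

lemma dim_dist_in_chart:
  assumes "c \<in> atlas M" "x \<in> snd c ` fst c"
  shows "dim (dist_in_chart c K x) = dim (K (chart_inv c x))"
  unfolding dist_in_chart_def
  by (rule dim_image_eq[OF linear_vector_in_chart inj_on_subset[OF inj_vector_in_chart]]) (use assms chart_inv in auto)

text \<open>
  Vectors that extend to local sections form a subspace. It contains the values of sections of \<open>K\<close> and of their
  brackets, because a bracket of two sections over \<open>W\<close> is a section of the derived distribution over \<open>W\<close>.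
\<close>
lemma smooth_distribution_derived:
  assumes c: "c \<in> atlas M" and K: "smooth_distribution (snd c ` fst c) (dist_in_chart c K)"
  shows "smooth_distribution (snd c ` fst c) (dist_in_chart c (derived M K))"
  unfolding smooth_distribution_def
proof (intro conjI ballI)
  let ?S = "snd c ` fst c" and ?K = "dist_in_chart c (derived M K)"
  show oS: "open ?S" by (rule chart(2)[OF c])
  have sub: "subspace (?K y)" if "y \<in> ?S" for y
    by (rule subspace_dist_in_chart[OF c that]) (simp add: derived_def)
  fix x assume x: "x \<in> ?S"
  show "subspace (?K x)" by (rule sub[OF x])
  fix v assume v: "v \<in> ?K x"
  let ?T = "{v. \<exists>W X. x \<in> W \<and> W \<subseteq> ?S \<and> section_on ?K W X \<and> X x = v}"
  have KD: "dist_in_chart c K y \<subseteq> ?K y" for y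
    by (rule dist_in_chart_mono) (auto simp: derived_def intro: span_base)
  have "dist_in_chart c K x \<union> {lie_bracket X Y x | X Y W.
    x \<in> W \<and> W \<subseteq> ?S \<and> section_on (dist_in_chart c K) W X \<and> section_on (dist_in_chart c K) W Y} \<subseteq> ?T"
  proof (intro Un_least subsetI)
    fix u assume "u \<in> dist_in_chart c K x"
    then obtain W X where WX: "x \<in> W" "W \<subseteq> ?S" "section_on (dist_in_chart c K) W X" "X x = u"
      using smooth_distributionD(2)[OF K x] by blast
    then have "section_on ?K W X" using KD unfolding section_on_def by blast
    then show "u \<in> ?T" using WX by blast
  next
    fix u assume "u \<in> {lie_bracket X Y x | X Y W.
      x \<in> W \<and> W \<subseteq> ?S \<and> section_on (dist_in_chart c K) W X \<and> section_on (dist_in_chart c K) W Y}"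
    then obtain X Y W where W: "x \<in> W" "W \<subseteq> ?S" "section_on (dist_in_chart c K) W X" "section_on (dist_in_chart c K) W Y"
      and u: "u = lie_bracket X Y x" by blast
    have "section_on ?K W (lie_bracket X Y)"
      unfolding section_on_def
    proof (intro conjI ballI)
      show "open W" "smooth_on W (lie_bracket X Y)" using W by (auto simp: section_on_def intro: smooth_lie_bracket)
      show "lie_bracket X Y y \<in> ?K y" if "y \<in> W" for y by (rule bracket_derived_in_chart[OF c that W(2-4)])
    qed
    then show "u \<in> ?T" using W u by blast
  qed
  then have "span (dist_in_chart c K x \<union> {lie_bracket X Y x | X Y W.
    x \<in> W \<and> W \<subseteq> ?S \<and> section_on (dist_in_chart c K) W X \<and> section_on (dist_in_chart c K) W Y}) \<subseteq> ?T"
    by (rule span_minimal) (rule subspace_section_values[OF oS x sub])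
  then show "\<exists>W X. x \<in> W \<and> W \<subseteq> ?S \<and> section_on ?K W X \<and> X x = v"
    using derived_in_chart_generators[OF c x, of K] v by blast
qed

lemma smooth_distribution_in_chart:
  assumes c: "c \<in> atlas M" and D: "distribution M k D"
  shows "smooth_distribution (snd c ` fst c) (dist_in_chart c D)"
  unfolding smooth_distribution_def
proof (intro conjI ballI)
  let ?S = "snd c ` fst c" and ?K = "dist_in_chart c D"
  show oS: "open ?S" by (rule chart(2)[OF c])
  have sub: "subspace (?K y)" if "y \<in> ?S" for y
    by (rule subspace_dist_in_chart[OF c that])
      (use D that chart_inv(3)[OF c that] chart(4)[OF c] in \<open>auto simp: distribution_def\<close>)
  fix x assume x: "x \<in> ?S"
  show "subspace (?K x)" by (rule sub[OF x])
  fix v assume v: "v \<in> ?K x"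
  let ?T = "{v. \<exists>W X. x \<in> W \<and> W \<subseteq> ?S \<and> section_on ?K W X \<and> X x = v}"
  let ?p = "chart_inv c x"
  have p: "?p \<in> fst c" "snd c ?p = x" using x chart_inv(2,3)[OF c, of x] by auto
  then have "?p \<in> topspace (mtop M)" using chart(4)[OF c] by blast
  from D[unfolded distribution_def, THEN bspec, OF this]
  obtain W X where W: "?p \<in> W" and X': "\<forall>i<k. smooth_vector_field M W (X i)"
    and sp': "\<forall>q\<in>W. D q = span ((\<lambda>i. X i q) ` {..<k})"
    by (elim conjE exE) (rule that)
  have X: "smooth_vector_field M W (X i)" if "i < k" for i using X' that by simp
  have sp: "D q = span ((\<lambda>i. X i q) ` {..<k})" if "q \<in> W" for q using sp' that by simp
  let ?V = "vector_in_chart M c ?p"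
  have "?V ` ((\<lambda>i. X i ?p) ` {..<k}) \<subseteq> ?T"
  proof safe
    fix i assume i: "i < k"
    have "local_section M D W (X i)" using X[OF i] sp i by (auto simp: local_section_def intro!: span_base)
    note s = section_in_chart[OF c this]
    have "x \<in> snd c ` (fst c \<inter> W)" using p W by (metis IntI imageI)
    moreover have "snd c ` (fst c \<inter> W) \<subseteq> ?S" by blast
    moreover have "field_in_chart M c (X i) x = ?V (X i ?p)" by (simp only: field_in_chart_def)
    ultimately show "\<exists>W' Y. x \<in> W' \<and> W' \<subseteq> ?S \<and> section_on ?K W' Y \<and> Y x = ?V (X i ?p)"
      using s by (intro exI conjI)
  qed
  then have "span (?V ` ((\<lambda>i. X i ?p) ` {..<k})) \<subseteq> ?T"
    by (rule span_minimal) (rule subspace_section_values[OF oS x sub])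
  moreover have "?K x = span (?V ` ((\<lambda>i. X i ?p) ` {..<k}))"
    unfolding dist_in_chart_def sp[OF W] using linear_span_image[OF linear_vector_in_chart[OF c p(1)]] by simp
  ultimately show "\<exists>W X. x \<in> W \<and> W \<subseteq> ?S \<and> section_on ?K W X \<and> X x = v" using v by blast
qed

text \<open>If all brackets of sections of one member of the flag stayed in it at a point, the next member would have the same rank there.\<close>
theorem goursat_flag_in_chart:
  assumes G: "goursat_structure M D" and dim: "DIM('e) = n + 3" and c: "c \<in> atlas M"
  shows "goursat_flag (snd c ` fst c) n (\<lambda>i. dist_in_chart c (derived_flag M D i))"
proof -
  let ?S = "snd c ` fst c" and ?F = "\<lambda>i. dist_in_chart c (derived_flag M D i)"
  have D: "distribution M 2 D" and dims: "\<And>i q. i \<le> n + 1 \<Longrightarrow> q \<in> topspace (mtop M) \<Longrightarrow> dim (derived_flag M D i q) = i + 2"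
    using G dim by (auto simp: goursat_structure_def)
  have ds: "derived_flag M D (Suc i) = derived M (derived_flag M D i)" for i by (simp add: derived_flag_def)
  have d0: "derived_flag M D 0 = D" by (simp add: derived_flag_def)
  have sm: "smooth_distribution ?S (?F i)" for i
    by (induction i) (simp_all add: d0 ds smooth_distribution_in_chart[OF c D] smooth_distribution_derived[OF c])
  have top: "chart_inv c x \<in> topspace (mtop M)" if "x \<in> ?S" for x using chart_inv(3)[OF c that] chart(4)[OF c] by blast
  have dF: "dim (?F i x) = i + 2" if "i \<le> n + 1" "x \<in> ?S" for i x
    using dim_dist_in_chart[OF c that(2)] dims[OF that(1) top[OF that(2)]] by simp
  show ?thesis
  proof
    show "DIM('e) = n + 3" by (rule dim)
    show "smooth_distribution ?S (?F i)" if "i \<le> n + 1" for i by (rule sm)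
    show "dim (?F i x) = i + 2" if "i \<le> n + 1" "x \<in> ?S" for i x by (rule dF[OF that])
    show "?F i x \<subseteq> ?F (Suc i) x" if "i \<le> n" "x \<in> ?S" for i x
      unfolding ds by (rule dist_in_chart_mono) (auto simp: derived_def intro: span_base)
    show "lie_bracket X Y x \<in> ?F (Suc i) x"
      if "i \<le> n" "x \<in> W" "W \<subseteq> ?S" "section_on (?F i) W X" "section_on (?F i) W Y" for i x W X Y
      unfolding ds by (rule bracket_derived_in_chart[OF c that(2-5)])
    show "\<exists>W X Y. x \<in> W \<and> W \<subseteq> ?S \<and> section_on (?F i) W X \<and> section_on (?F i) W Y \<and> lie_bracket X Y x \<notin> ?F i x"
      if i: "i \<le> n" and x: "x \<in> ?S" for i x
    proof (rule ccontr)
      assume "\<not> ?thesis"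
      then have "?F i x \<union> {lie_bracket X Y x | X Y W. x \<in> W \<and> W \<subseteq> ?S \<and> section_on (?F i) W X \<and> section_on (?F i) W Y} \<subseteq> ?F i x"
        by blast
      then have "span (?F i x \<union> {lie_bracket X Y x | X Y W. x \<in> W \<and> W \<subseteq> ?S \<and> section_on (?F i) W X \<and> section_on (?F i) W Y}) \<subseteq> ?F i x"
        by (rule span_minimal[OF _ smooth_distributionD(1)[OF sm x]])
      then have "?F (Suc i) x \<subseteq> ?F i x" using derived_in_chart_generators[OF c x, of "derived_flag M D i"] unfolding ds by blast
      then have "dim (?F (Suc i) x) \<le> dim (?F i x)" by (rule dim_subset)
      then show False using dF[of "Suc i" x] dF[of i x] i x by simp
    qed
  qed
qed

end

section \<open>The trailer system\<close>
lemma heading_cis_cong: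
  assumes "\<And>i. i < k \<Longrightarrow> cis (s i) = cis (t i)"
  shows "(heading s k :: 'e::euclidean_space) = heading t k"
  using assms
proof (induction k)
  case (Suc k)
  have e: "cos (s i) = cos (t i)" "sin (s i) = sin (t i)" if "i \<le> k" for i
    using Suc.prems[of i] that by (auto simp: complex_eq_iff)
  have "cos (bend s k) = cos (bend t k)" "sin (bend s k) = sin (bend t k)"
    using e[of k] e[of "k - 1"] by (auto simp: bend_def cos_diff sin_diff)
  then show ?case using Suc by simp
qed simp

lemma trailer_pi_Suc: "i \<le> n \<Longrightarrow> trailer_pi (Suc n) t i = cos (bend t (Suc n)) * trailer_pi n t i"
  by (simp add: trailer_pi_def bend_def mult.commute)

lemma trailer_pi_self: "trailer_pi n t n = 1"
  by (simp add: trailer_pi_def)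

lemma heading_eq_trailer:
  "(heading t (Suc n) :: 'e::euclidean_space) =
     (trailer_pi n t 0 * cos (t 0)) *\<^sub>R axis_vec 0 + (trailer_pi n t 0 * sin (t 0)) *\<^sub>R axis_vec 1 +
     (\<Sum>i<n. (trailer_pi n t (i + 1) * sin (t (i + 1) - t i)) *\<^sub>R axis_vec (i + 2))"
proof (induction n)
  case 0 then show ?case by (simp add: trailer_pi_def bend_def)
next
  case (Suc n)
  let ?c = "cos (bend t (Suc n))"
  have s: "(\<Sum>i<n. (trailer_pi (Suc n) t (i + 1) * sin (t (i + 1) - t i)) *\<^sub>R (axis_vec (i + 2) :: 'e))
    = ?c *\<^sub>R (\<Sum>i<n. (trailer_pi n t (i + 1) * sin (t (i + 1) - t i)) *\<^sub>R axis_vec (i + 2))"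
    unfolding scaleR_sum_right by (rule sum.cong) (simp_all add: trailer_pi_Suc mult.assoc)
  have l: "sin (bend t (Suc n)) *\<^sub>R (axis_vec (Suc n + 1) :: 'e)
    = (trailer_pi (Suc n) t (n + 1) * sin (t (n + 1) - t n)) *\<^sub>R axis_vec (n + 2)"
    using trailer_pi_self[of "Suc n" t] by (simp add: bend_def)
  have "(heading t (Suc (Suc n)) :: 'e) = ?c *\<^sub>R heading t (Suc n) + sin (bend t (Suc n)) *\<^sub>R axis_vec (Suc n + 1)"
    by (rule heading.simps(2))
  also have "\<dots> = (trailer_pi (Suc n) t 0 * cos (t 0)) *\<^sub>R axis_vec 0 + (trailer_pi (Suc n) t 0 * sin (t 0)) *\<^sub>R axis_vec 1 +
     (\<Sum>i<Suc n. (trailer_pi (Suc n) t (i + 1) * sin (t (i + 1) - t i)) *\<^sub>R axis_vec (i + 2))"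
    unfolding Suc sum.lessThan_Suc s l by (simp only: trailer_pi_Suc[OF le0] scaleR_add_right scaleR_scaleR mult.assoc add.assoc)
  finally show ?case .
qed

lemma trailer_field_heading: "trailer_field n (\<xi>, z) = heading (\<lambda>i. Arg (z i)) (Suc n)"
  unfolding heading_eq_trailer by (simp add: trailer_field_def Let_def)

lemma cis_minus_mult: "cis (- b) * cis t = cis (t - b)"
  by (simp add: cis_mult)

lemma cis_eq_minus_cis: "cis t = - cis b \<longleftrightarrow> cis (t - b) = -1"
proof
  assume "cis t = - cis b"
  then have "cis (- b) * cis t = - (cis (- b) * cis b)" by simp
  then show "cis (t - b) = -1" by (simp add: cis_mult)
next
  assume "cis (t - b) = -1"
  then have "cis b * cis (t - b) = - cis b" by simp
  then show "cis t = - cis b" by (simp add: cis_mult)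
qed

lemma cis_not_minus_1: "\<bar>s\<bar> < pi \<Longrightarrow> cis s \<noteq> -1"
proof
  assume s: "\<bar>s\<bar> < pi" and "cis s = -1"
  then have "Arg (-1) = s" using Arg_cis[of s] by (auto simp: abs_less_iff)
  moreover have "Arg (-1) = pi" using Arg_cis[of pi] by simp
  ultimately show False using s by simp
qed

lemma angle_in_range:
  assumes "\<bar>t - a\<bar> < pi" shows "a + Arg (cis (- a) * cis t) = t" "cis t \<noteq> - cis a"
  using Arg_cis[of "t - a"] assms cis_not_minus_1[OF assms] unfolding cis_minus_mult cis_eq_minus_cis
  by (auto simp: abs_less_iff)

text \<open>
  A branch of the argument of \<open>cis t\<close> differs from \<open>t\<close> by a locally constant function; the branch with
  values around \<open>b\<close> is defined off the point opposite to \<open>b\<close>.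
\<close>
lemma angle_locally_translation:
  assumes "cis t0 \<noteq> - cis b"
  shows "\<exists>\<epsilon>>0. \<forall>t. \<bar>t - t0\<bar> < \<epsilon> \<longrightarrow>
    cis t \<noteq> - cis b \<and> b + Arg (cis (- b) * cis t) = t + (b + Arg (cis (- b) * cis t0) - t0)"
proof -
  define s where "s = Arg (cis (t0 - b))"
  have cs: "cis s = cis (t0 - b)" unfolding s_def by (subst cis_Arg) auto
  have "s \<noteq> pi" using assms cs unfolding cis_eq_minus_cis by auto
  then have s: "- pi < s" "s < pi" using Arg_bounded[of "cis (t0 - b)"] by (auto simp: s_def)
  show ?thesis
  proof (intro exI[of _ "min (pi - s) (s + pi)"] conjI[of "0 < _"] allI impI)
    show "0 < min (pi - s) (s + pi)" using s by simp
    fix t assume t: "\<bar>t - t0\<bar> < min (pi - s) (s + pi)"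
    then have r: "\<bar>s + (t - t0)\<bar> < pi" by linarith
    have "cis (s + (t - t0)) = cis s * cis (t - t0)" by (simp add: cis_mult)
    also have "\<dots> = cis (t - b)" unfolding cs by (simp add: cis_mult)
    finally have e: "cis (t - b) = cis (s + (t - t0))" by simp
    have "Arg (cis (t - b)) = s + (t - t0)" unfolding e by (rule Arg_cis) (use r in auto)
    then show "cis t \<noteq> - cis b \<and> b + Arg (cis (- b) * cis t) = t + (b + Arg (cis (- b) * cis t0) - t0)"
      using cis_not_minus_1[OF r] unfolding cis_eq_minus_cis cis_minus_mult e by (simp add: s_def)
  qed
qed

lemma axis_vec_expansion:
  fixes y :: "'e::euclidean_space" assumes "DIM('e) = n + 3"
  shows "(y \<bullet> axis_vec 0) *\<^sub>R axis_vec 0 + (y \<bullet> axis_vec 1) *\<^sub>R axis_vec 1 + (\<Sum>i\<le>n. (y \<bullet> axis_vec (i + 2)) *\<^sub>R axis_vec (i + 2)) = y"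
proof -
  have "y = (\<Sum>b\<in>Basis. (y \<bullet> b) *\<^sub>R b)" by (simp add: euclidean_representation)
  also have "\<dots> = (\<Sum>j<DIM('e). (y \<bullet> axis_vec j) *\<^sub>R axis_vec j)"
    by (rule sum.reindex_bij_betw[OF axis_vec_bij, symmetric])
  also have "DIM('e) = Suc (Suc (Suc n))" using assms by simp
  finally show ?thesis by (simp add: sum.lessThan_Suc_shift lessThan_Suc_atMost[symmetric] add.assoc del: sum.lessThan_Suc)
qed

lemma trailer_coords_inner:
  assumes D: "DIM('e) = n + 3"
  shows "(trailer_coords n \<xi> \<theta> :: 'e::euclidean_space) \<bullet> axis_vec 0 = fst \<xi>"
    "(trailer_coords n \<xi> \<theta> :: 'e) \<bullet> axis_vec 1 = snd \<xi>"
    "i \<le> n \<Longrightarrow> (trailer_coords n \<xi> \<theta> :: 'e) \<bullet> axis_vec (i + 2) = \<theta> i"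
proof -
  have sm: "(\<Sum>i\<le>n. \<theta> i *\<^sub>R axis_vec (i + 2)) \<bullet> (axis_vec j :: 'e) = (\<Sum>i\<le>n. if i + 2 = j then \<theta> i else 0)"
    if "j < DIM('e)" for j
    unfolding inner_sum_left by (intro sum.cong refl) (use that D in \<open>auto simp: axis_vec_inner\<close>)
  show "(trailer_coords n \<xi> \<theta> :: 'e) \<bullet> axis_vec 0 = fst \<xi>"
    unfolding trailer_coords_def inner_add_left using D sm[of 0] by (simp add: axis_vec_inner)
  show "(trailer_coords n \<xi> \<theta> :: 'e) \<bullet> axis_vec 1 = snd \<xi>"
    unfolding trailer_coords_def inner_add_left using D sm[of 1] by (simp add: axis_vec_inner)
  show "(trailer_coords n \<xi> \<theta> :: 'e) \<bullet> axis_vec (i + 2) = \<theta> i" if "i \<le> n"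
    unfolding trailer_coords_def inner_add_left using D that sm[of "i + 2"] by (simp add: axis_vec_inner)
qed

text \<open>The covering map of the configuration space; every chart of the trailer manifold is a local inverse of it.\<close>
definition torus_point :: "nat \<Rightarrow> 'e::euclidean_space \<Rightarrow> configuration" where
  "torus_point n y = ((y \<bullet> axis_vec 0, y \<bullet> axis_vec 1), \<lambda>i\<in>{..n}. cis (y \<bullet> axis_vec (i + 2)))"

lemma topspace_trailer: "z \<in> topspace (trailer_top n) \<longleftrightarrow> snd z \<in> (\<Pi>\<^sub>E i\<in>{..n}. sphere 0 1)"
  by (cases z) (simp add: trailer_top_def)

lemma torus_point_top: "torus_point n y \<in> topspace (trailer_top n)"
  by (auto simp: topspace_trailer torus_point_def)

lemma trailer_chart_dom:
  "z \<in> fst (trailer_chart n a) \<longleftrightarrow> z \<in> topspace (trailer_top n) \<and> (\<forall>i\<le>n. snd z i \<noteq> - cis (a i))"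
  by (simp add: trailer_chart_def)

lemma trailer_chart_map:
  "snd (trailer_chart n a) z = trailer_coords n (fst z) (\<lambda>i. a i + Arg (cis (- a i) * snd z i))"
  by (simp add: trailer_chart_def split_beta)

lemma torus_point_chart:
  fixes a :: "nat \<Rightarrow> real"
  assumes D: "DIM('e) = n + 3" and z: "z \<in> topspace (trailer_top n)"
  shows "torus_point n (snd (trailer_chart n a) z :: 'e::euclidean_space) = z"
proof -
  have pe: "snd z \<in> (\<Pi>\<^sub>E i\<in>{..n}. sphere 0 1)" using z by (simp add: topspace_trailer)
  have "cis (a i + Arg (cis (- a i) * snd z i)) = snd z i" if "i \<le> n" for i
  proof -
    have n1: "norm (snd z i) = 1" using PiE_mem[OF pe, of i] that by simp
    then have "cis (Arg (cis (- a i) * snd z i)) = cis (- a i) * snd z i"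
      by (subst cis_Arg) (auto simp: sgn_div_norm norm_mult)
    then have "cis (a i + Arg (cis (- a i) * snd z i)) = cis (a i) * (cis (- a i) * snd z i)" by (simp add: cis_mult[symmetric])
    also have "\<dots> = (cis (a i) * cis (- a i)) * snd z i" by (simp only: mult.assoc)
    finally show ?thesis by (simp add: cis_mult)
  qed
  moreover have "snd z i = undefined" if "\<not> i \<le> n" for i using PiE_arb[OF pe, of i] that by simp
  ultimately have r: "(\<lambda>i\<in>{..n}. cis (a i + Arg (cis (- a i) * snd z i))) = snd z" by (auto simp: restrict_def fun_eq_iff)
  let ?y = "snd (trailer_chart n a) z :: 'e"
  have y01: "?y \<bullet> axis_vec 0 = fst (fst z)" "?y \<bullet> axis_vec 1 = snd (fst z)"
    unfolding trailer_chart_map by (rule trailer_coords_inner[OF D])+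
  have yi: "?y \<bullet> axis_vec (i + 2) = a i + Arg (cis (- a i) * snd z i)" if "i \<le> n" for i
    unfolding trailer_chart_map by (rule trailer_coords_inner(3)[OF D that])
  have "(\<lambda>i\<in>{..n}. cis (?y \<bullet> axis_vec (i + 2))) = (\<lambda>i\<in>{..n}. cis (a i + Arg (cis (- a i) * snd z i)))"
    by (rule restrict_ext) (simp only: yi atMost_iff)
  then show ?thesis unfolding torus_point_def y01 r by simp
qed

lemma chart_torus_point:
  assumes D: "DIM('e) = n + 3" and y: "\<And>i. i \<le> n \<Longrightarrow> \<bar>(y :: 'e::euclidean_space) \<bullet> axis_vec (i + 2) - a i\<bar> < pi"
  shows "torus_point n y \<in> fst (trailer_chart n a :: (configuration, 'e) chart)" "snd (trailer_chart n a) (torus_point n y) = y"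
proof -
  show "torus_point n y \<in> fst (trailer_chart n a :: (configuration, 'e) chart)"
    unfolding trailer_chart_dom
  proof (intro conjI allI impI torus_point_top)
    show "snd (torus_point n y) i \<noteq> - cis (a i)" if "i \<le> n" for i
      using angle_in_range(2)[OF y[OF that]] that by (simp add: torus_point_def)
  qed
  have "snd (trailer_chart n a) (torus_point n y) = (y \<bullet> axis_vec 0) *\<^sub>R axis_vec 0 + (y \<bullet> axis_vec 1) *\<^sub>R axis_vec 1 + (\<Sum>i\<le>n. (y \<bullet> axis_vec (i + 2)) *\<^sub>R (axis_vec (i + 2) :: 'e))"
    unfolding trailer_chart_map trailer_coords_def torus_point_def fst_conv snd_conv
    by (intro arg_cong2[of _ _ _ _ "(+)"] refl sum.cong) (use angle_in_range(1)[OF y] in \<open>simp del: add_2_eq_Suc'\<close>)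
  then show "snd (trailer_chart n a) (torus_point n y) = y" unfolding axis_vec_expansion[OF D] .
qed

lemma chart_torus_point_local:
  assumes D: "DIM('e) = n + 3" and y0: "torus_point n (y0 :: 'e::euclidean_space) \<in> fst (trailer_chart n b :: (configuration, 'e) chart)"
  obtains Q where "open Q" "y0 \<in> Q" "\<And>y. y \<in> Q \<Longrightarrow> torus_point n y \<in> fst (trailer_chart n b :: (configuration, 'e) chart)"
    "\<And>y. y \<in> Q \<Longrightarrow> snd (trailer_chart n b) (torus_point n y) = y + (snd (trailer_chart n b) (torus_point n y0) - y0)"
proof -
  let ?t = "\<lambda>y i. (y :: 'e) \<bullet> axis_vec (i + 2)"
  let ?L = "\<lambda>i t. b i + Arg (cis (- b i) * cis t)"
  define good where "good i e \<longleftrightarrow> e > 0 \<and>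
    (\<forall>t. \<bar>t - ?t y0 i\<bar> < e \<longrightarrow> cis t \<noteq> - cis (b i) \<and> ?L i t = t + (?L i (?t y0 i) - ?t y0 i))" for i and e :: real
  have "\<forall>i\<in>{..n}. \<exists>e. good i e"
  proof
    fix i assume "i \<in> {..n}"
    then have "cis (?t y0 i) \<noteq> - cis (b i)"
      using y0 unfolding trailer_chart_dom torus_point_def by auto
    then show "\<exists>e. good i e" unfolding good_def by (rule angle_locally_translation)
  qed
  from bchoice[OF this] obtain \<epsilon> where "\<forall>i\<in>{..n}. good i (\<epsilon> i)" ..
  then have g: "good i (\<epsilon> i)" if "i \<le> n" for i using that by simp
  define Q where "Q = (\<Inter>i\<in>{..n}. {y. \<bar>?t y i - ?t y0 i\<bar> < \<epsilon> i})"
  define k where "k = (\<Sum>i\<le>n. (?L i (?t y0 i) - ?t y0 i) *\<^sub>R (axis_vec (i + 2) :: 'e))"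
  have Qi: "cis (?t y i) \<noteq> - cis (b i)" "?L i (?t y i) = ?t y i + (?L i (?t y0 i) - ?t y0 i)" if "y \<in> Q" "i \<le> n" for y i
    using g[OF that(2)] that unfolding good_def Q_def by blast+
  have m: "snd (trailer_chart n b) (torus_point n y) = y + k" if y: "y \<in> Q" for y
  proof -
    have "snd (trailer_chart n b) (torus_point n y) = (y \<bullet> axis_vec 0) *\<^sub>R axis_vec 0 + (y \<bullet> axis_vec 1) *\<^sub>R axis_vec 1 + (\<Sum>i\<le>n. ?L i (?t y i) *\<^sub>R (axis_vec (i + 2) :: 'e))"
      unfolding trailer_chart_map trailer_coords_def torus_point_def fst_conv snd_conv
      by (intro arg_cong2[of _ _ _ _ "(+)"] refl sum.cong) simp
    also have "(\<Sum>i\<le>n. ?L i (?t y i) *\<^sub>R (axis_vec (i + 2) :: 'e)) = (\<Sum>i\<le>n. ?t y i *\<^sub>R axis_vec (i + 2)) + k"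
      unfolding k_def sum.distrib[symmetric] scaleR_add_left[symmetric] using Qi(2)[OF y] by (intro sum.cong) auto
    finally show ?thesis using axis_vec_expansion[OF D, of y] by (simp only: add.assoc[symmetric])
  qed
  have y0Q: "y0 \<in> Q" using g unfolding good_def Q_def by simp
  show ?thesis
  proof (rule that[of Q])
    show "open Q" unfolding Q_def by (intro open_INT finite_atMost ballI open_Collect_less continuous_intros)
    show "y0 \<in> Q" by (rule y0Q)
    show "torus_point n y \<in> fst (trailer_chart n b :: (configuration, 'e) chart)" if "y \<in> Q" for y
      unfolding trailer_chart_dom using torus_point_top[of n y] Qi(1)[OF that] by (auto simp: torus_point_def simp del: add_2_eq_Suc')
    show "snd (trailer_chart n b) (torus_point n y) = y + (snd (trailer_chart n b) (torus_point n y0) - y0)" if "y \<in> Q" for y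
      using m[OF that] m[OF y0Q] by simp
  qed
qed

lemma inj_on_trailer_chart:
  assumes D: "DIM('e) = n + 3"
  shows "inj_on (snd (trailer_chart n a :: (configuration, 'e::euclidean_space) chart)) (fst (trailer_chart n a :: (configuration, 'e) chart))"
  by (rule inj_on_inverseI[where g = "torus_point n"]) (simp add: torus_point_chart[OF D] trailer_chart_dom)

lemma chart_inv_trailer:
  assumes D: "DIM('e) = n + 3" and z: "z \<in> fst (trailer_chart n a :: (configuration, 'e::euclidean_space) chart)"
  shows "chart_inv (trailer_chart n a :: (configuration, 'e) chart) (snd (trailer_chart n a) z) = z"
  unfolding chart_inv_def by (rule inv_into_f_f[OF inj_on_trailer_chart[OF D] z])

lemma continuous_map_torus_point: "continuous_map euclidean (trailer_top n) (torus_point n :: 'e::euclidean_space \<Rightarrow> _)"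
proof -
  have 1: "continuous_map euclidean euclidean (fst \<circ> (torus_point n :: 'e \<Rightarrow> _))"
    by (auto simp: torus_point_def o_def intro!: continuous_intros)
  have 2: "continuous_map euclidean (product_topology (\<lambda>_. top_of_set (sphere 0 1)) {..n}) (snd \<circ> (torus_point n :: 'e \<Rightarrow> _))"
    unfolding continuous_map_componentwise
    by (auto simp: torus_point_def o_def continuous_map_in_subtopology extensional_def intro!: continuous_intros)
  show ?thesis unfolding trailer_top_def continuous_map_pairwise using 1 2 by simp
qed

lemma continuous_map_trailer_angle:
  assumes "i \<le> n" shows "continuous_map (trailer_top n) (top_of_set (sphere 0 1)) (\<lambda>z. snd z i)"
proof -
  have "continuous_map (product_topology (\<lambda>_. top_of_set (sphere 0 1)) {..n}) (top_of_set (sphere 0 1)) (\<lambda>x :: nat \<Rightarrow> complex. x i)"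
    by (rule continuous_map_product_projection) (use assms in simp)
  from continuous_map_compose[OF continuous_map_snd this] show ?thesis
    unfolding trailer_top_def by (simp add: o_def)
qed

lemma openin_trailer_chart_dom: "openin (trailer_top n) (fst (trailer_chart n a :: (configuration, 'e::euclidean_space) chart))"
proof -
  let ?A = "\<lambda>i. {z \<in> topspace (trailer_top n). snd z i \<in> sphere 0 1 - {- cis (a i)}}"
  have "openin (trailer_top n) (?A i)" if "i \<le> n" for i
    by (rule openin_continuous_map_preimage[OF continuous_map_trailer_angle[OF that]])
      (auto simp: openin_open intro!: exI[of _ "- {- cis (a i)}"])
  then have "openin (trailer_top n) ((\<Inter>i\<in>{..n}. ?A i) \<inter> topspace (trailer_top n))" by (intro openin_INT) auto
  moreover have "(\<Inter>i\<in>{..n}. ?A i) \<inter> topspace (trailer_top n) = fst (trailer_chart n a :: (configuration, 'e) chart)"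
    by (auto simp: trailer_chart_dom topspace_trailer PiE_iff)
  ultimately show ?thesis by simp
qed

lemma continuous_map_scaleR_vec:
  "continuous_map X euclidean f \<Longrightarrow> continuous_map X euclidean (\<lambda>x. f x *\<^sub>R (v :: 'e::real_normed_vector))"
proof -
  assume f: "continuous_map X euclidean f"
  have "continuous_map euclidean euclidean (\<lambda>r. r *\<^sub>R v)" by (auto intro!: continuous_intros)
  from continuous_map_compose[OF f this] show ?thesis by (simp add: o_def)
qed

lemma continuous_map_trailer_chart:
  fixes a :: "nat \<Rightarrow> real" and n :: nat
  defines "C \<equiv> trailer_chart n a :: (configuration, 'e::euclidean_space) chart"
  shows "continuous_map (subtopology (trailer_top n) (fst C)) euclidean (snd C)"
proof -
  let ?X = "subtopology (trailer_top n) (fst C)"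
  have top: "topspace ?X = fst C" using openin_subset[OF openin_trailer_chart_dom[of n a, where 'e='e]] by (auto simp: C_def)
  have f: "continuous_map ?X euclidean fst"
    by (rule continuous_map_from_subtopology) (simp add: trailer_top_def continuous_map_fst)
  have f1: "continuous_map ?X euclidean (\<lambda>z. fst (fst z))"
    using continuous_map_compose[OF f, of euclidean fst] by (simp add: o_def continuous_on_fst)
  have f2: "continuous_map ?X euclidean (\<lambda>z. snd (fst z))"
    using continuous_map_compose[OF f, of euclidean snd] by (simp add: o_def continuous_on_snd)
  have ang: "continuous_map ?X euclidean (\<lambda>z. a i + Arg (cis (- a i) * snd z i))" if i: "i \<le> n" for i
  proof -
    let ?T = "sphere 0 1 - {- cis (a i)}"
    have "continuous_map ?X (top_of_set (sphere 0 1)) (\<lambda>z. snd z i)"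
      by (rule continuous_map_from_subtopology[OF continuous_map_trailer_angle[OF i]])
    then have c1: "continuous_map ?X (top_of_set ?T) (\<lambda>z. snd z i)"
      unfolding continuous_map_in_subtopology top using i by (auto simp: C_def trailer_chart_dom)
    have "cis (- a i) * w \<notin> \<real>\<^sub>\<le>\<^sub>0" if w: "w \<in> ?T" for w
    proof
      assume "cis (- a i) * w \<in> \<real>\<^sub>\<le>\<^sub>0"
      then obtain r where r: "r \<le> 0" "cis (- a i) * w = of_real r" by (auto simp: nonpos_Reals_def)
      then have "norm (cis (- a i) * w) = - r" by simp
      moreover have "norm (cis (- a i) * w) = 1" using w by (simp add: norm_mult)
      ultimately have "cis (- a i) * w = -1" using r by simp
      then have "cis (a i) * (cis (- a i) * w) = - cis (a i)" by simp
      moreover have "cis (a i) * (cis (- a i) * w) = w" by (simp add: mult.assoc[symmetric] cis_mult)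
      ultimately show False using w by simp
    qed
    then have "continuous_on ?T (\<lambda>w. a i + Arg (cis (- a i) * w))"
      by (intro continuous_intros) auto
    then have c2: "continuous_map (top_of_set ?T) euclidean (\<lambda>w. a i + Arg (cis (- a i) * w))" by simp
    from continuous_map_compose[OF c1 c2] show ?thesis by (simp add: o_def)
  qed
  have "continuous_map ?X euclidean (\<lambda>z. fst (fst z) *\<^sub>R axis_vec 0 + snd (fst z) *\<^sub>R axis_vec 1
      + (\<Sum>i\<le>n. (a i + Arg (cis (- a i) * snd z i)) *\<^sub>R (axis_vec (i + 2) :: 'e)))"
    by (intro continuous_map_add continuous_map_sum continuous_map_scaleR_vec f1 f2 ang) auto
  then show ?thesis by (simp add: C_def trailer_chart_map[abs_def] trailer_coords_def)
qed

section \<open>The local equivalence\<close>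
lemma partial_coords_eq: "partial_coords \<xi>1 \<xi>2 \<theta> (Suc n) x = trailer_coords n (\<xi>1 x, \<xi>2 x) (\<lambda>i. \<theta> i x)"
  by (simp add: partial_coords_def trailer_coords_def lessThan_Suc_atMost del: sum.lessThan_Suc)

text \<open>The coefficients of the driving field depend on the angles only modulo \<open>2 * pi\<close>, so principal values may be replaced by \<open>\<theta> i\<close>.\<close>
lemma trailer_distribution_torus_point:
  assumes D: "DIM('e) = n + 3"
  shows "trailer_distribution n (torus_point n (partial_coords \<xi>1 \<xi>2 \<theta> (Suc n) x :: 'e::euclidean_space))
    = span {heading (\<lambda>i. \<theta> i x) (Suc n), axis_vec (n + 2) :: 'e}"
proof -
  let ?y = "partial_coords \<xi>1 \<xi>2 \<theta> (Suc n) x :: 'e"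
  have z: "snd (torus_point n ?y) i = cis (\<theta> i x)" if "i \<le> n" for i
    using trailer_coords_inner(3)[OF D that] that by (simp add: torus_point_def partial_coords_eq del: add_2_eq_Suc')
  have "trailer_field n (torus_point n ?y) = (heading (\<lambda>i. Arg (snd (torus_point n ?y) i)) (Suc n) :: 'e)"
    using trailer_field_heading[of n "fst (torus_point n ?y)" "snd (torus_point n ?y)"] by simp
  also have "\<dots> = heading (\<lambda>i. \<theta> i x) (Suc n)"
    by (rule heading_cis_cong) (simp add: z cis_Arg)
  finally show ?thesis by (simp add: trailer_distribution_def insert_commute)
qed

text \<open>
  In a chart around \<open>q\<close> the adapted coordinates form a local diffeomorphism \<open>H\<close> of the model space, and the
  equivalence is the covering map after \<open>H\<close>. The coordinates are restricted to a neighbourhood on which every angle stays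
  within \<open>pi\<close> of its value at \<open>q\<close>; on it the covering map is inverted by a single chart. In other charts the
  equivalence is \<open>H\<close> up to transition maps and a locally constant translation, which gives smoothness and the derivative.
\<close>

theorem theorem3p3:
  fixes n :: nat
    and M :: "('a, 'e::euclidean_space) manifold"
    and D :: "'a \<Rightarrow> 'e set"
    and q :: 'a
  assumes "DIM('e) = n + 3"
    and "goursat_structure M D"
    and "q \<in> topspace (mtop M)"
  shows "\<exists>p \<in> topspace (trailer_top n).
    locally_equivalent M D q
      (trailer_manifold n :: (configuration, 'e) manifold) (trailer_distribution n) p"
proof -
  note D = assms(1) and G = assms(2) and q = assms(3)
  let ?N = "trailer_manifold n :: (configuration, 'e) manifold"
  let ?Q = "torus_point n :: 'e \<Rightarrow> configuration"
  let ?C = "\<lambda>b. trailer_chart n b :: (configuration, 'e) chart"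
  interpret smooth_manifold_locale M by unfold_locales (use G in \<open>simp add: goursat_structure_def\<close>)
  define c where "c = chart_at M q"
  have c: "c \<in> atlas M" "q \<in> fst c" using chart_at[OF q] by (auto simp: c_def)
  define S where "S = snd c ` fst c"
  define x0 where "x0 = snd c q"
  have x0S: "x0 \<in> S" using c by (auto simp: S_def x0_def)
  interpret goursat_flag S n "\<lambda>i. dist_in_chart c (derived_flag M D i)"
    unfolding S_def by (rule goursat_flag_in_chart[OF G D c(1)])
  obtain W \<xi>1 \<xi>2 \<theta> where W: "x0 \<in> W" "open W" "W \<subseteq> S" and s: "smooth_on W \<xi>1" "smooth_on W \<xi>2" "\<And>i. i \<le> n \<Longrightarrow> smooth_on W (\<theta> i)"
    and inj: "\<And>x. x \<in> W \<Longrightarrow> inj (dd (partial_coords \<xi>1 \<xi>2 \<theta> (Suc n) :: 'e \<Rightarrow> 'e) x)"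
    and F0: "\<And>x. x \<in> W \<Longrightarrow> dist_in_chart c (derived_flag M D 0) x =
      {v. dd (partial_coords \<xi>1 \<xi>2 \<theta> (Suc n) :: 'e \<Rightarrow> 'e) x v \<in> span {heading (\<lambda>i. \<theta> i x) (Suc n), axis_vec (n + 2)}}"
    by (rule trailer_coordinates[OF x0S]) (rule that)
  define H where "H = (partial_coords \<xi>1 \<xi>2 \<theta> (Suc n) :: 'e \<Rightarrow> 'e)"
  have H\<theta>: "H x \<bullet> axis_vec (i + 2) = \<theta> i x" if "i \<le> n" for i x
    unfolding H_def partial_coords_eq by (rule trailer_coords_inner(3)[OF D that])
  define a where "a i = \<theta> i x0" for i
  define W2 where "W2 = W \<inter> (\<Inter>i\<in>{..n}. {x \<in> W. \<bar>\<theta> i x - a i\<bar> < pi})"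
  have "open {x \<in> W. \<bar>\<theta> i x - a i\<bar> < pi}" if i: "i \<le> n" for i
  proof -
    have "continuous_on W (\<lambda>x. \<bar>\<theta> i x - a i\<bar>)" by (intro continuous_intros smooth_continuous_on s i)
    moreover have "{x \<in> W. \<bar>\<theta> i x - a i\<bar> < pi} = W \<inter> (\<lambda>x. \<bar>\<theta> i x - a i\<bar>) -` {..<pi}" by auto
    ultimately show ?thesis using continuous_open_preimage[OF _ W(2), of _ "{..<pi}"] by simp
  qed
  then have W2: "open W2" "x0 \<in> W2" "W2 \<subseteq> W" using W by (auto simp: W2_def a_def intro!: open_Int open_INT)
  have sH: "smooth_on W2 H"
    unfolding H_def by (rule smooth_partial_coords[OF W2(1)]) (use s smooth_subset[OF _ W2(3)] in \<open>auto simp: less_Suc_eq_le\<close>)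
  have injx0: "inj (dd H x0)" using inj[OF W(1)] by (simp add: H_def)
  obtain U' V g where U': "open U'" "U' \<subseteq> W2" "x0 \<in> U'" and V: "open V" "H x0 \<in> V" and hom: "homeomorphism U' V H g"
    and sg: "smooth_on V g"
    by (rule smooth_inverse_function[OF W2(1,2) sH injx0]) (rule that)
  have Hg: "\<And>x. x \<in> U' \<Longrightarrow> H x \<in> V" "\<And>x. x \<in> U' \<Longrightarrow> g (H x) = x" "\<And>y. y \<in> V \<Longrightarrow> g y \<in> U'" "\<And>y. y \<in> V \<Longrightarrow> H (g y) = y"
    using hom by (auto simp: homeomorphism_def)
  have U'S: "U' \<subseteq> S" "U' \<subseteq> W" using U' W2 W by auto
  have box: "\<bar>H x \<bullet> axis_vec (i + 2) - a i\<bar> < pi" if "x \<in> U'" "i \<le> n" for x i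
    using that U'(2) unfolding H\<theta>[OF that(2)] by (auto simp: W2_def)
  have CQ: "?Q (H x) \<in> fst (?C a)" "snd (?C a) (?Q (H x)) = H x" if "x \<in> U'" for x
    using chart_torus_point[OF D, of "H x" a] box[OF that] by auto
  define U where "U = {p \<in> fst c. snd c p \<in> U'}"
  define VN where "VN = {z \<in> fst (?C a). snd (?C a) z \<in> V}"
  define f where "f p = ?Q (H (snd c p))" for p
  define k where "k z = chart_inv c (g (snd (?C a) z))" for z
  have oU: "openin (mtop M) U" unfolding U_def by (rule open_chart_preimage[OF c(1) U'(1)])
  have topN: "mtop ?N = trailer_top n" and atN: "atlas ?N = range ?C" by (simp_all add: trailer_manifold_def)
  have oVN: "openin (trailer_top n) VN"
  proof -
    have "topspace (subtopology (trailer_top n) (fst (?C a))) = fst (?C a)"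
      using openin_subset[OF openin_trailer_chart_dom[of n a, where 'e='e]] by auto
    then have "openin (subtopology (trailer_top n) (fst (?C a))) VN"
      using openin_continuous_map_preimage[OF continuous_map_trailer_chart[of n a, where 'e='e], of V] V(1) by (simp add: VN_def)
    then show ?thesis using openin_open_subtopology[OF openin_trailer_chart_dom[of n a, where 'e='e]] by blast
  qed
  have Usub: "snd c p \<in> U'" "p \<in> fst c" if "p \<in> U" for p using that by (auto simp: U_def)
  have fV: "f p \<in> VN" if "p \<in> U" for p
    unfolding f_def VN_def using CQ[OF Usub(1)[OF that]] Hg(1)[OF Usub(1)[OF that]] by simp
  have kU: "k z \<in> U" "snd c (k z) = g (snd (?C a) z)" if "z \<in> VN" for z
  proof -
    have g: "g (snd (?C a) z) \<in> U'" using that Hg(3) by (simp add: VN_def)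
    then have "g (snd (?C a) z) \<in> snd c ` fst c" using U'S S_def by blast
    from chart_inv(2,3)[OF c(1) this] g show "k z \<in> U" "snd c (k z) = g (snd (?C a) z)"
      by (simp_all add: k_def U_def)
  qed
  have kf: "k (f p) = p" if "p \<in> U" for p
    using CQ(2)[OF Usub(1)[OF that]] Hg(2)[OF Usub(1)[OF that]] chart_inv(1)[OF c(1) Usub(2)[OF that]] by (simp add: k_def f_def)
  have fk: "f (k z) = z" if "z \<in> VN" for z
  proof -
    have "f (k z) = ?Q (snd (?C a) z)" unfolding f_def kU(2)[OF that] using Hg(4)[of "snd (?C a) z"] that by (simp add: VN_def)
    also have "\<dots> = z" by (rule torus_point_chart[OF D]) (use that in \<open>simp add: VN_def trailer_chart_dom\<close>)
    finally show ?thesis .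
  qed
  have bij: "bij_betw f U VN"
    by (rule bij_betwI[where g = k]) (use fV kU kf fk in auto)
  have invf: "inv_into U f z = k z" if "z \<in> VN" for z
    by (rule inv_into_f_eq) (use bij kU fk that in \<open>auto simp: bij_betw_def\<close>)
  \<comment> \<open>In any pair of charts the map is, near a given point, a transition map followed by \<open>H\<close> and a translation.\<close>
  have localform: "\<exists>T m. open T \<and> snd c' p \<in> T \<and> T \<subseteq> snd c' ` (fst c' \<inter> U) \<and>
      (\<forall>y\<in>T. snd (?C b) (f (chart_inv c' y)) = H (transition c' c y) + m) \<and> smooth_on T (\<lambda>y. H (transition c' c y) + m)"
    if c': "c' \<in> atlas M" and p: "p \<in> fst c'" "p \<in> U" and b: "f p \<in> fst (?C b)" for c' p b
  proof -
    have "?Q (H (snd c p)) \<in> fst (?C b)" using b by (simp add: f_def)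
    then obtain R where R: "open R" "H (snd c p) \<in> R"
      "\<And>y. y \<in> R \<Longrightarrow> snd (?C b) (?Q y) = y + (snd (?C b) (?Q (H (snd c p))) - H (snd c p))"
      by (rule chart_torus_point_local[OF D]) (rule that)
    define m where "m = snd (?C b) (?Q (H (snd c p))) - H (snd c p)"
    let ?O = "snd c' ` (fst c' \<inter> U)"
    have oO: "open ?O" by (rule open_chart_image[OF c' oU])
    have tU: "transition c' c y \<in> U'" "chart_inv c' y \<in> U" if "y \<in> ?O" for y
      using that chart_inv(1)[OF c'] by (auto simp: U_def)
    have st: "smooth_on ?O (transition c' c)"
      by (rule smooth_subset[OF smooth_trans[OF c' c(1)]]) (auto simp: U_def)
    have sHt: "smooth_on ?O (\<lambda>y. H (transition c' c y))"
      by (rule smooth_compose[OF oO st sH]) (use tU U'(2) in blast)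
    define T where "T = ?O \<inter> (\<lambda>y. H (transition c' c y)) -` R"
    have oT: "open T" unfolding T_def by (rule continuous_open_preimage[OF smooth_continuous_on[OF sHt] oO R(1)])
    have "transition c' c (snd c' p) = snd c p" using chart_inv(1)[OF c' p(1)] by simp
    then have pT: "snd c' p \<in> T" using p R(2) by (simp add: T_def)
    have "snd (?C b) (f (chart_inv c' y)) = H (transition c' c y) + m" if "y \<in> T" for y
      using R(3)[of "H (transition c' c y)"] that by (simp add: T_def m_def f_def)
    moreover have "smooth_on T (\<lambda>y. H (transition c' c y) + m)"
      by (intro smooth_add oT smooth_const smooth_subset[OF sHt]) (auto simp: T_def)
    moreover have "T \<subseteq> ?O" by (simp add: T_def)
    ultimately show ?thesis using oT pT by blast
  qed
  have "smooth_map M U ?N f"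
    unfolding smooth_map_def topN atN
  proof (intro conjI ballI)
    have cc: "continuous_map (subtopology (mtop M) U) (top_of_set U') (snd c)"
      unfolding continuous_map_in_subtopology
    proof
      show "continuous_map (subtopology (mtop M) U) euclidean (snd c)"
        by (rule continuous_map_from_subtopology_mono[OF continuous_map_chart[OF c(1)]]) (auto simp: U_def)
      show "snd c \<in> topspace (subtopology (mtop M) U) \<rightarrow> U'" by (auto simp: U_def)
    qed
    have "continuous_map (top_of_set U') euclidean H"
      using hom by (simp add: homeomorphism_def)
    from continuous_map_compose[OF continuous_map_compose[OF cc this] continuous_map_torus_point]
    show "continuous_map (subtopology (mtop M) U) (trailer_top n) f" by (simp add: f_def[abs_def] o_def)
    fix c' d assume c': "c' \<in> atlas M" and d: "d \<in> range ?C"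
    then obtain b where b: "d = ?C b" by blast
    show "smooth_on (snd c' ` (fst c' \<inter> U \<inter> f -` fst d)) (snd d \<circ> f \<circ> chart_inv c')"
    proof (rule smooth_local)
      fix y assume "y \<in> snd c' ` (fst c' \<inter> U \<inter> f -` fst d)"
      then obtain p where p: "y = snd c' p" "p \<in> fst c'" "p \<in> U" "f p \<in> fst (?C b)" by (auto simp: b)
      obtain T m where T: "open T" "snd c' p \<in> T" "\<forall>y\<in>T. snd (?C b) (f (chart_inv c' y)) = H (transition c' c y) + m"
        "smooth_on T (\<lambda>y. H (transition c' c y) + m)"
        using localform[OF c' p(2-4)] by (elim exE conjE) (rule that)
      have "smooth_on T (snd d \<circ> f \<circ> chart_inv c')"
        by (rule smooth_cong[OF T(4,1)]) (use T(3) in \<open>simp add: b\<close>)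
      then show "\<exists>T. open T \<and> y \<in> T \<and> smooth_on T (snd d \<circ> f \<circ> chart_inv c')" using T(1,2) p(1) by blast
    qed
  qed
  moreover have "smooth_map ?N VN M (inv_into U f)"
    unfolding smooth_map_def topN atN
  proof (intro conjI ballI)
    have c1: "continuous_map (subtopology (trailer_top n) VN) (top_of_set V) (snd (?C a))"
      unfolding continuous_map_in_subtopology
    proof
      show "continuous_map (subtopology (trailer_top n) VN) euclidean (snd (?C a))"
        by (rule continuous_map_from_subtopology_mono[OF continuous_map_trailer_chart]) (auto simp: VN_def)
      show "snd (?C a) \<in> topspace (subtopology (trailer_top n) VN) \<rightarrow> V" by (auto simp: VN_def)
    qed
    have c2: "continuous_map (top_of_set V) (top_of_set (snd c ` fst c)) g"
      using smooth_continuous_on[OF sg] Hg(3) U'S by (auto simp: S_def)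
    have "continuous_map (subtopology (trailer_top n) VN) (mtop M) k"
      using continuous_map_compose[OF continuous_map_compose[OF c1 c2] continuous_map_chart_inv[OF c(1)]]
      by (simp add: k_def[abs_def] o_def)
    then show "continuous_map (subtopology (trailer_top n) VN) (mtop M) (inv_into U f)"
      by (rule continuous_map_eq) (simp add: invf)
    fix d c' assume d: "d \<in> range ?C" and c': "c' \<in> atlas M"
    then obtain b where b: "d = ?C b" by blast
    show "smooth_on (snd d ` (fst d \<inter> VN \<inter> inv_into U f -` fst c')) (snd c' \<circ> inv_into U f \<circ> chart_inv d)"
    proof (rule smooth_local)
      fix y0 assume "y0 \<in> snd d ` (fst d \<inter> VN \<inter> inv_into U f -` fst c')"
      then obtain z0 where z0: "y0 = snd (?C b) z0" "z0 \<in> fst (?C b)" "z0 \<in> VN" "inv_into U f z0 \<in> fst c'" by (auto simp: b)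
      have z0a: "z0 \<in> fst (?C a)" "snd (?C a) z0 \<in> V" using z0(3) by (auto simp: VN_def)
      have Qy0: "?Q y0 = z0" unfolding z0(1) by (rule torus_point_chart[OF D]) (use z0(2) in \<open>simp add: trailer_chart_dom\<close>)
      have ya: "?Q y0 \<in> fst (?C a)" and yb: "?Q y0 \<in> fst (?C b)" using z0a z0(2) Qy0 by auto
      obtain R where R: "open R" "y0 \<in> R" "\<And>y. y \<in> R \<Longrightarrow> ?Q y \<in> fst (?C a)"
        "\<And>y. y \<in> R \<Longrightarrow> snd (?C a) (?Q y) = y + (snd (?C a) (?Q y0) - y0)"
        by (rule chart_torus_point_local[OF D ya]) (rule that)
      obtain R' where R': "open R'" "y0 \<in> R'" "\<And>y. y \<in> R' \<Longrightarrow> ?Q y \<in> fst (?C b)"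
        "\<And>y. y \<in> R' \<Longrightarrow> snd (?C b) (?Q y) = y + (snd (?C b) (?Q y0) - y0)"
        by (rule chart_torus_point_local[OF D yb]) (rule that)
      \<comment> \<open>Near \<open>y0\<close> the charts with centres \<open>b\<close> and \<open>a\<close> differ by this translation.\<close>
      define m where "m = snd (?C a) z0 - y0"
      have R4: "snd (?C a) (?Q y) = y + m" if "y \<in> R" for y using R(4)[OF that] by (simp add: Qy0 m_def)
      have R'4: "snd (?C b) (?Q y) = y" if "y \<in> R'" for y using R'(4)[OF that] unfolding Qy0 z0(1)[symmetric] by simp
      let ?O = "snd c ` (fst c \<inter> fst c')"
      have oO: "open ?O" by (rule open_chart_image[OF c(1) chart(1)[OF c']])
      define V' where "V' = V \<inter> g -` ?O"
      have oV': "open V'" unfolding V'_def by (rule continuous_open_preimage[OF smooth_continuous_on[OF sg] V(1) oO])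
      define T where "T = R \<inter> R' \<inter> (\<lambda>y. y + m) -` V'"
      have oT: "open T" unfolding T_def by (intro open_Int R R' open_vimage oV' continuous_intros)
      have "k z0 \<in> fst c'" using z0(4) invf[OF z0(3)] by simp
      then have "g (snd (?C a) z0) \<in> ?O" using kU[OF z0(3)] by (metis IntI Usub(2) imageI)
      then have y0T: "y0 \<in> T" using R(2) R'(2) z0a(2) by (simp add: T_def V'_def m_def)
      have eq: "transition c c' (g (y + m)) = (snd c' \<circ> inv_into U f \<circ> chart_inv d) y" if y: "y \<in> T" for y
      proof -
        have yy: "y \<in> R" "y \<in> R'" "y + m \<in> V" using y by (auto simp: T_def V'_def)
        have "chart_inv d y = ?Q y"
          using chart_inv_trailer[OF D R'(3)[OF yy(2)]] R'4[OF yy(2)] by (simp add: b)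
        moreover have "?Q y \<in> VN" using R(3)[OF yy(1)] R4[OF yy(1)] yy(3) by (simp add: VN_def)
        moreover have "k (?Q y) = chart_inv c (g (y + m))" by (simp add: k_def R4[OF yy(1)])
        ultimately show ?thesis by (simp add: invf)
      qed
      have "smooth_on T (\<lambda>y. transition c c' (g (y + m)))"
      proof (rule smooth_compose[OF oT _ smooth_trans[OF c(1) c']])
        show "smooth_on T (\<lambda>y. g (y + m))"
          by (rule smooth_compose[OF oT smooth_add[OF oT smooth_id smooth_const] sg]) (simp add: T_def V'_def)
        show "g (y + m) \<in> ?O" if "y \<in> T" for y using that by (simp add: T_def V'_def)
      qed
      then have "smooth_on T (snd c' \<circ> inv_into U f \<circ> chart_inv d)"
        by (rule smooth_cong[OF _ oT eq])
      then show "\<exists>T. open T \<and> y0 \<in> T \<and> smooth_on T (snd c' \<circ> inv_into U f \<circ> chart_inv d)" using oT y0T by blast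
    qed
  qed
  ultimately have diffeo: "diffeomorphism M U ?N VN f"
    unfolding diffeomorphism_def topN using oU oVN bij by blast
  have tangent: "tangent_map M ?N f p ` D p = trailer_distribution n (f p)" if p: "p \<in> U" for p
  proof -
    let ?x = "snd c p"
    have px: "p \<in> fst c" "?x \<in> U'" "?x \<in> W2" "?x \<in> W" using Usub[OF p] U' W2 by auto
    have pt: "p \<in> topspace (mtop M)" using px(1) chart(4)[OF c(1)] by blast
    let ?c' = "chart_at M p" and ?d = "chart_at ?N (f p)"
    have c': "?c' \<in> atlas M" "p \<in> fst ?c'" using chart_at[OF pt] by auto
    have "f p \<in> fst (?C a)" using fV[OF p] by (simp add: VN_def)
    then have "\<exists>d. d \<in> atlas ?N \<and> f p \<in> fst d" unfolding atN by blast
    from someI_ex[OF this] have d: "?d \<in> range ?C" "f p \<in> fst ?d" unfolding chart_at_def atN by auto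
    then obtain b where b: "?d = ?C b" by blast
    obtain T m where T: "open T" "snd ?c' p \<in> T" "\<forall>y\<in>T. snd (?C b) (f (chart_inv ?c' y)) = H (transition ?c' c y) + m"
      using localform[OF c'(1,2) p d(2)[unfolded b]] by (elim exE conjE) (rule that)
    have t: "transition ?c' c (snd ?c' p) = ?x" using chart_inv(1)[OF c'] by simp
    have "tangent_map M ?N f p v = dd H ?x (vector_in_chart M c p v)" for v
    proof -
      have "tangent_map M ?N f p v = dd (\<lambda>y. H (transition ?c' c y) + m) (snd ?c' p) v"
        unfolding tangent_map_def b by (rule fun_cong[OF dd_transform[OF T(1,2)]]) (use T(3) in simp)
      also have "\<dots> = dd H ?x (dd (transition ?c' c) (snd ?c' p) v)"
      proof (rule dd_eqI)
        have "((\<lambda>y. H (transition ?c' c y)) has_derivative (\<lambda>v. dd H ?x (dd (transition ?c' c) (snd ?c' p) v))) (at (snd ?c' p))"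
          by (rule has_derivative_compose[OF trans_has_derivative[OF c'(1) c(1) c'(2) px(1)]])
            (unfold t, rule smooth_has_derivative[OF sH px(3)])
        then show "((\<lambda>y. H (transition ?c' c y) + m) has_derivative (\<lambda>v. dd H ?x (dd (transition ?c' c) (snd ?c' p) v))) (at (snd ?c' p))"
          using has_derivative_add_const by blast
      qed
      finally show ?thesis by (simp add: vector_in_chart_def)
    qed
    then have "tangent_map M ?N f p ` D p = dd H ?x ` (vector_in_chart M c p ` D p)" by (auto simp: image_image)
    also have "vector_in_chart M c p ` D p = dist_in_chart c (derived_flag M D 0) ?x"
      by (simp add: dist_in_chart_def derived_flag_def chart_inv(1)[OF c(1) px(1)])
    also have "dd H ?x ` \<dots> = span {heading (\<lambda>i. \<theta> i ?x) (Suc n), axis_vec (n + 2)}"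
    proof -
      have "surj (dd H ?x)"
        using linear_injective_imp_surjective[OF smooth_linear_dd[OF sH px(3)]] inj[OF px(4)] by (simp add: H_def)
      then show ?thesis unfolding F0[OF px(4)] H_def[symmetric] by (auto simp: surj_def image_iff)
    qed
    also have "\<dots> = trailer_distribution n (f p)"
      unfolding f_def H_def by (rule trailer_distribution_torus_point[OF D, symmetric])
    finally show ?thesis .
  qed
  have "q \<in> U" using c(2) U'(3) by (simp add: U_def x0_def)
  then have "locally_equivalent M D q ?N (trailer_distribution n) (f q)"
    unfolding locally_equivalent_def using diffeo tangent fV by blast
  moreover have "f q \<in> topspace (trailer_top n)" by (simp add: f_def torus_point_top)
  ultimately show ?thesis by blast
qed

end
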